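(* Let $L$, $K$ be étale $k$-algebras of dimensions $3$, $2$ respectively, let $(E,\tau)=(L\otimes_k K,1\otimes\bar{\ })$ be the $K$-unitary algebra and $T=\mathbf{SU}(E,\tau)$ the $K$-unitary torus associated with the pair $(L,K)$. Then $H^1(k,T)=0$ if and only if $J(E,\tau,u,\mu)\cong_L J(E,\tau,1,1)$ for all admissible pairs $(u,\mu)\in L^*\times K^*$.
   Context: $k$ is a field of characteristic different from $2$ and $3$; $\bar{\ }$ is the non-trivial $k$-automorphism of $K$; $L$, $K$ need not be fields; $L$ is identified with $E^\tau=\{x\in E:\tau(x)=x\}$. $\mathbf{SU}(E,\tau)$ is the $k$-torus with $\mathbf{SU}(E,\tau)(R)=\{x\in E\otimes_k R : x\tau(x)=1,\ N_{E/K}(x)=1\}$. A pair $(u,\mu)\in L^*\times K^*$ is admissible if $N_{L/k}(u)=N_{K/k}(\mu)=\mu\overline\mu$. For an admissible pair, the étale Tits process algebra $J(E,\tau,u,\mu)$ is the $9$-dimensional Jordan algebra of degree $3$ on the vector space $L\oplus E$ with unit $1=(1,0)$, cubic norm $$N(a,b)=N_{L/k}(a)+\mu N_{E/K}(b)+\overline{\mu N_{E/K}(b)}-T_{L/k}(a\,b\,u\,\tau(b)),$$ adjoint $(a,b)^\#=(a^\#-b u\tau(b),\ \overline\mu\,\tau(b)^\#u^{-1}-ab)$ and trace $T(a,b)=T_{L/k}(a)$; here $^\#$ on $L$ and $E$ is the usual adjoint, characterized as the quadratic map with $xx^\#=N_{L/k}(x)$, resp. $xx^\#=N_{E/K}(x)$,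 and the Jordan product is the bilinearization of $x^2=x^\#+T(x)x-T(x^\#)1$. It contains $L=\{(l,0):l\in L\}$ as a subalgebra. Write $J_1\cong_L J_2$ ($L$-isomorphic) for two such algebras if there exists a $k$-algebra isomorphism $J_1\to J_2$ which restricts to the subalgebra $L$ of $J_1$ and $J_2$, i.e. maps $L\subset J_1$ onto $L\subset J_2$ (not necessarily as the identity). *)

theory Defs
  imports
    "HOL-Algebra.Elementary_Groups"
    "HOL-Library.Product_Plus"
    "HOL-Library.Poly_Mapping"
    "HOL-Computational_Algebra.Computational_Algebra"
    "Jordan_Normal_Form.Determinant"
begin

section \<open>Commutative algebras\<close>

text \<open>
  A commutative algebra over a commutative ring is given by its structure homomorphism, so that
  several algebras over the same type of scalars can be considered at once.
\<close>

definition alg_scale :: "('a::comm_ring_1 \<Rightarrow> 'b::comm_ring_1) \<Rightarrow> 'a \<Rightarrow> 'b \<Rightarrow> 'b" where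
  "alg_scale \<phi> a x = \<phi> a * x"

definition is_alg_basis :: "('a::comm_ring_1 \<Rightarrow> 'b::comm_ring_1) \<Rightarrow> 'b list \<Rightarrow> bool" where
  "is_alg_basis \<phi> bs \<longleftrightarrow> distinct bs \<and>
     \<not> module.dependent (alg_scale \<phi>) (set bs) \<and> module.span (alg_scale \<phi>) (set bs) = UNIV"

definition mult_matrix :: "('a::comm_ring_1 \<Rightarrow> 'b::comm_ring_1) \<Rightarrow> 'b list \<Rightarrow> 'b \<Rightarrow> 'a mat" where
  "mult_matrix \<phi> bs x = mat (length bs) (length bs)
     (\<lambda>(i, j). module.representation (alg_scale \<phi>) (set bs) (x * bs ! j) (bs ! i))"

text \<open>
  Norm and trace of a finite free algebra: determinant and trace of multiplication by \<open>x\<close>.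
  They do not depend on the basis; they are only used for algebras that have one.
\<close>

definition alg_norm :: "('a::comm_ring_1 \<Rightarrow> 'b::comm_ring_1) \<Rightarrow> 'b \<Rightarrow> 'a" where
  "alg_norm \<phi> x = det (mult_matrix \<phi> (SOME bs. is_alg_basis \<phi> bs) x)"

definition alg_trace :: "('a::comm_ring_1 \<Rightarrow> 'b::comm_ring_1) \<Rightarrow> 'b \<Rightarrow> 'a" where
  "alg_trace \<phi> x = (let bs = (SOME bs. is_alg_basis \<phi> bs) in
     \<Sum>i<length bs. mult_matrix \<phi> bs x $$ (i, i))"

definition quadratic_map :: "('a::comm_ring_1 \<Rightarrow> 'b::comm_ring_1) \<Rightarrow> ('b \<Rightarrow> 'b) \<Rightarrow> bool" where
  "quadratic_map \<phi> q \<longleftrightarrow>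
     (\<forall>c x. q (\<phi> c * x) = \<phi> c ^ 2 * q x) \<and>
     (let p = (\<lambda>x y. q (x + y) - q x - q y) in
        (\<forall>x y z. p (x + y) z = p x z + p y z) \<and> (\<forall>x y z. p x (y + z) = p x y + p x z) \<and>
        (\<forall>c x y. p (\<phi> c * x) y = \<phi> c * p x y \<and> p x (\<phi> c * y) = \<phi> c * p x y))"

text \<open>
  The adjoint of a cubic algebra.  If 6 is invertible, a quadratic map \<open>d\<close> with \<open>x * d x = 0\<close> for
  all \<open>x\<close> is zero (linearise, then specialise to 1), so there is at most one such map.
\<close>

definition alg_adjoint :: "('a::comm_ring_1 \<Rightarrow> 'b::comm_ring_1) \<Rightarrow> 'b \<Rightarrow> 'b" where
  "alg_adjoint \<phi> = (THE q. quadratic_map \<phi> q \<and> (\<forall>x. x * q x = \<phi> (alg_norm \<phi> x)))"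


section \<open>Separability\<close>

definition separable_poly :: "'k::field poly \<Rightarrow> bool" where
  "separable_poly p \<longleftrightarrow> coprime p (pderiv p)"

definition separable_closure :: "('k::field \<Rightarrow> 's::field) \<Rightarrow> bool" where
  "separable_closure \<phi> \<longleftrightarrow> comm_ring_hom \<phi> \<and>
     (\<forall>x. \<exists>p. separable_poly p \<and> poly (map_poly \<phi> p) x = 0) \<and>
     (\<forall>q::'s poly. separable_poly q \<and> degree q > 0 \<longrightarrow> (\<exists>x. poly q x = 0))"

text \<open>
  Etale algebras, i.e. finite products of finite separable field extensions.  The factors are the
  ideals \<open>e A\<close> cut out by orthogonal idempotents \<open>e\<close>; such a factor has unit \<open>e\<close> and structure map
  \<open>\<lambda>c. \<phi> c * e\<close>.
\<close>

definition etale :: "('k::field \<Rightarrow> 'a::comm_ring_1) \<Rightarrow> bool" where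
  "etale \<phi> \<longleftrightarrow> comm_ring_hom \<phi> \<and>
     (\<exists>B. finite B \<and> module.span (alg_scale \<phi>) B = UNIV) \<and>
     (\<exists>I. finite I \<and> (\<Sum>e\<in>I. e) = 1 \<and>
        (\<forall>e\<in>I. \<forall>f\<in>I. e * f = (if e = f then e else 0)) \<and>
        (\<forall>e\<in>I. e \<noteq> 0 \<and>
           (\<forall>x. e * x \<noteq> 0 \<longrightarrow> (\<exists>y. (e * x) * (e * y) = e)) \<and>
           (\<forall>x. \<exists>p. separable_poly p \<and> poly (map_poly (\<lambda>c. \<phi> c * e) p) (e * x) = 0)))"

definition nontrivial_automorphism ::
    "('k::field \<Rightarrow> 'a::comm_ring_1) \<Rightarrow> ('a \<Rightarrow> 'a) \<Rightarrow> bool" where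
  "nontrivial_automorphism \<phi> f \<longleftrightarrow>
     comm_ring_hom f \<and> bij f \<and> (\<forall>c. f (\<phi> c) = \<phi> c) \<and> f \<noteq> id"


section \<open>Tensor products\<close>

text \<open>
  The free abelian group on \<open>A \<times> B\<close> modulo the subgroup generated by \<open>balanced_relations\<close> is the
  usual construction of the tensor product.  A commutative ring \<open>C\<close> with homomorphisms
  \<open>i : A \<rightarrow> C\<close> and \<open>j : B \<rightarrow> C\<close> is a tensor product of the algebras \<open>A\<close> and \<open>B\<close>, with
  \<open>a \<otimes> b = i a * j b\<close>, if the map \<open>(a, b) \<mapsto> i a * j b\<close> identifies it with this quotient.
\<close>

definition balanced_relations ::
    "('k::comm_ring_1 \<Rightarrow> 'a::comm_ring_1) \<Rightarrow> ('k \<Rightarrow> 'b::comm_ring_1) \<Rightarrow> ('a \<times> 'b \<Rightarrow>\<^sub>0 int) set" where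
  "balanced_relations \<phi> \<psi> =
     (let g = (\<lambda>a b. Poly_Mapping.single (a, b) (1::int)) in
        {g (a + a') b - g a b - g a' b | a a' b. True} \<union>
        {g a (b + b') - g a b - g a b' | a b b'. True} \<union>
        {g (\<phi> c * a) b - g a (\<psi> c * b) | a b c. True})"

definition tensor_eval ::
    "('a::comm_ring_1 \<Rightarrow> 'c::comm_ring_1) \<Rightarrow> ('b::comm_ring_1 \<Rightarrow> 'c) \<Rightarrow> ('a \<times> 'b \<Rightarrow>\<^sub>0 int) \<Rightarrow> 'c" where
  "tensor_eval i j f =
     (\<Sum>x\<in>Poly_Mapping.keys f. of_int (Poly_Mapping.lookup f x) * (i (fst x) * j (snd x)))"

definition tensor_product ::
    "('k::comm_ring_1 \<Rightarrow> 'a::comm_ring_1) \<Rightarrow> ('k \<Rightarrow> 'b::comm_ring_1) \<Rightarrow>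
     ('a \<Rightarrow> 'c::comm_ring_1) \<Rightarrow> ('b \<Rightarrow> 'c) \<Rightarrow> bool" where
  "tensor_product \<phi> \<psi> i j \<longleftrightarrow>
     comm_ring_hom i \<and> comm_ring_hom j \<and> (\<forall>c. i (\<phi> c) = j (\<psi> c)) \<and>
     surj (tensor_eval i j) \<and>
     {f. tensor_eval i j f = 0} = group_closure (balanced_relations \<phi> \<psi>)"

text \<open>The homomorphism \<open>f \<otimes> g\<close> between the tensor products given by \<open>(i, j)\<close> and \<open>(i', j')\<close>.\<close>

definition tensor_map ::
    "('a::comm_ring_1 \<Rightarrow> 'c::comm_ring_1) \<Rightarrow> ('b::comm_ring_1 \<Rightarrow> 'c) \<Rightarrow>
     ('a'::comm_ring_1 \<Rightarrow> 'c'::comm_ring_1) \<Rightarrow> ('b'::comm_ring_1 \<Rightarrow> 'c') \<Rightarrow>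
     ('a \<Rightarrow> 'a') \<Rightarrow> ('b \<Rightarrow> 'b') \<Rightarrow> 'c \<Rightarrow> 'c'" where
  "tensor_map i j i' j' f g =
     (THE h. comm_ring_hom h \<and> (\<forall>a b. h (i a * j b) = i' (f a) * j' (g b)))"


section \<open>Galois cohomology\<close>

definition galois_group :: "('k::field \<Rightarrow> 's::field) \<Rightarrow> ('s \<Rightarrow> 's) set" where
  "galois_group \<phi> = {\<sigma>. comm_ring_hom \<sigma> \<and> bij \<sigma> \<and> (\<forall>c. \<sigma> (\<phi> c) = \<phi> c)}"

text \<open>
  Continuity for the Krull topology on the Galois group and the discrete topology on the
  coefficients: automorphisms agreeing with \<open>\<sigma>\<close> on a finite set form a basic neighbourhood of \<open>\<sigma>\<close>.
\<close>

definition galois_continuous :: "('k::field \<Rightarrow> 's::field) \<Rightarrow> (('s \<Rightarrow> 's) \<Rightarrow> 'm) \<Rightarrow> bool" where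
  "galois_continuous \<phi> c \<longleftrightarrow>
     (\<forall>\<sigma>\<in>galois_group \<phi>. \<exists>F. finite F \<and>
        (\<forall>\<rho>\<in>galois_group \<phi>. (\<forall>x\<in>F. \<rho> x = \<sigma> x) \<longrightarrow> c \<rho> = c \<sigma>))"

text \<open>Here \<open>M\<close> is an abelian group on which the Galois group acts through \<open>act\<close>.\<close>

definition galois_Z1 ::
    "('k::field \<Rightarrow> 's::field) \<Rightarrow> 'm monoid \<Rightarrow> (('s \<Rightarrow> 's) \<Rightarrow> 'm \<Rightarrow> 'm) \<Rightarrow> (('s \<Rightarrow> 's) \<Rightarrow> 'm) monoid" where
  "galois_Z1 \<phi> M act =
     \<lparr>carrier = {c \<in> galois_group \<phi> \<rightarrow>\<^sub>E carrier M. galois_continuous \<phi> c \<and>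
        (\<forall>\<sigma>\<in>galois_group \<phi>. \<forall>\<rho>\<in>galois_group \<phi>. c (\<sigma> \<circ> \<rho>) = c \<sigma> \<otimes>\<^bsub>M\<^esub> act \<sigma> (c \<rho>))},
      monoid.mult = (\<lambda>c d. \<lambda>\<sigma>\<in>galois_group \<phi>. c \<sigma> \<otimes>\<^bsub>M\<^esub> d \<sigma>),
      monoid.one = (\<lambda>\<sigma>\<in>galois_group \<phi>. \<one>\<^bsub>M\<^esub>)\<rparr>"

definition galois_B1 ::
    "('k::field \<Rightarrow> 's::field) \<Rightarrow> 'm monoid \<Rightarrow> (('s \<Rightarrow> 's) \<Rightarrow> 'm \<Rightarrow> 'm) \<Rightarrow> (('s \<Rightarrow> 's) \<Rightarrow> 'm) set" where
  "galois_B1 \<phi> M act =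
     {c \<in> carrier (galois_Z1 \<phi> M act).
        \<exists>a\<in>carrier M. \<forall>\<sigma>\<in>galois_group \<phi>. c \<sigma> = inv\<^bsub>M\<^esub> a \<otimes>\<^bsub>M\<^esub> act \<sigma> a}"

definition galois_H1 ::
    "('k::field \<Rightarrow> 's::field) \<Rightarrow> 'm monoid \<Rightarrow> (('s \<Rightarrow> 's) \<Rightarrow> 'm \<Rightarrow> 'm) \<Rightarrow> (('s \<Rightarrow> 's) \<Rightarrow> 'm) set monoid" where
  "galois_H1 \<phi> M act = galois_Z1 \<phi> M act Mod galois_B1 \<phi> M act"


section \<open>The unitary torus\<close>

text \<open>
  From here on \<open>\<phi>L\<close>, \<open>\<phi>K\<close> are the structure maps of \<open>L\<close>, \<open>K\<close> over \<open>k\<close>, \<open>\<iota>\<close> is the non-trivial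
  automorphism of \<open>K\<close>, and \<open>iL\<close>, \<open>iK\<close> are the maps of \<open>L\<close>, \<open>K\<close> to \<open>E = L \<otimes> K\<close>.  Thus \<open>iK\<close> is the
  structure map of \<open>E\<close> as a \<open>K\<close>-algebra, and \<open>iL\<close> identifies \<open>L\<close> with the fixed points of \<open>\<tau>\<close>.
\<close>

definition unitary_inv ::
    "('c::comm_ring_1 \<Rightarrow> 'c) \<Rightarrow> ('l::comm_ring_1 \<Rightarrow> 'e::comm_ring_1) \<Rightarrow> ('c \<Rightarrow> 'e) \<Rightarrow> 'e \<Rightarrow> 'e" where
  "unitary_inv \<iota> iL iK = tensor_map iL iK iL iK id \<iota>"

text \<open>
  The group \<open>SU(E, \<tau>)(R)\<close> of a \<open>K\<close>-algebra \<open>E\<close> with involution \<open>\<tau>\<close>, where \<open>iE\<close>, \<open>iR\<close> are the maps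
  of \<open>E\<close>, \<open>R\<close> to \<open>E \<otimes>\<^sub>k R\<close> and \<open>jK\<close>, \<open>jR\<close> those of \<open>K\<close>, \<open>R\<close> to \<open>K \<otimes>\<^sub>k R\<close>; the norm on \<open>E \<otimes>\<^sub>k R\<close> is
  that over \<open>K \<otimes>\<^sub>k R\<close>.
\<close>

definition SU_points ::
    "('c::comm_ring_1 \<Rightarrow> 'e::comm_ring_1) \<Rightarrow> ('e \<Rightarrow> 'e) \<Rightarrow>
     ('c \<Rightarrow> 'd::comm_ring_1) \<Rightarrow> ('r::comm_ring_1 \<Rightarrow> 'd) \<Rightarrow>
     ('e \<Rightarrow> 'f::comm_ring_1) \<Rightarrow> ('r \<Rightarrow> 'f) \<Rightarrow> 'f monoid" where
  "SU_points iK \<tau> jK jR iE iR =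
     \<lparr>carrier = {x. x * tensor_map iE iR iE iR \<tau> id x = 1 \<and>
                    alg_norm (tensor_map jK jR iE iR iK id) x = 1},
      monoid.mult = (*), monoid.one = 1\<rparr>"


section \<open>Etale Tits processes\<close>

definition admissible ::
    "('k::field \<Rightarrow> 'l::comm_ring_1) \<Rightarrow> ('k \<Rightarrow> 'c::comm_ring_1) \<Rightarrow> ('c \<Rightarrow> 'c) \<Rightarrow> 'l \<Rightarrow> 'c \<Rightarrow> bool" where
  "admissible \<phi>L \<phi>K \<iota> u \<mu> \<longleftrightarrow> u dvd 1 \<and> \<mu> dvd 1 \<and>
     alg_norm \<phi>L u = alg_norm \<phi>K \<mu> \<and> \<phi>K (alg_norm \<phi>K \<mu>) = \<mu> * \<iota> \<mu>"

definition unit_inv :: "'a::comm_ring_1 \<Rightarrow> 'a" where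
  "unit_inv u = (THE v. u * v = 1)"

text \<open>
  The algebra \<open>J(E, \<tau>, u, \<mu>)\<close> lives on \<open>L \<times> E\<close>.  The element \<open>b u \<tau>(b)\<close> of \<open>E\<close> is fixed by \<open>\<tau>\<close>; where
  it is needed as an element of \<open>L\<close> it is pulled back along \<open>iL\<close>.
\<close>

definition tits_scale ::
    "('k::field \<Rightarrow> 'l::comm_ring_1) \<Rightarrow> ('l \<Rightarrow> 'e::comm_ring_1) \<Rightarrow> 'k \<Rightarrow> 'l \<times> 'e \<Rightarrow> 'l \<times> 'e" where
  "tits_scale \<phi>L iL c x = (\<phi>L c * fst x, iL (\<phi>L c) * snd x)"

definition tits_herm ::
    "('c::comm_ring_1 \<Rightarrow> 'c) \<Rightarrow> ('l::comm_ring_1 \<Rightarrow> 'e::comm_ring_1) \<Rightarrow> ('c \<Rightarrow> 'e) \<Rightarrow> 'l \<Rightarrow> 'e \<Rightarrow> 'l" where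
  "tits_herm \<iota> iL iK u b = the_inv iL (b * iL u * unitary_inv \<iota> iL iK b)"

definition tits_sharp ::
    "('k::field \<Rightarrow> 'l::comm_ring_1) \<Rightarrow> ('c::comm_ring_1 \<Rightarrow> 'c) \<Rightarrow> ('l \<Rightarrow> 'e::comm_ring_1) \<Rightarrow>
     ('c \<Rightarrow> 'e) \<Rightarrow> 'l \<Rightarrow> 'c \<Rightarrow> 'l \<times> 'e \<Rightarrow> 'l \<times> 'e" where
  "tits_sharp \<phi>L \<iota> iL iK u \<mu> = (\<lambda>(a, b).
     (alg_adjoint \<phi>L a - tits_herm \<iota> iL iK u b,
      iK (\<iota> \<mu>) * alg_adjoint iK (unitary_inv \<iota> iL iK b) * iL (unit_inv u) - iL a * b))"

definition tits_trace :: "('k::field \<Rightarrow> 'l::comm_ring_1) \<Rightarrow> 'l \<times> 'e \<Rightarrow> 'k" where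
  "tits_trace \<phi>L = (\<lambda>(a, b). alg_trace \<phi>L a)"

text \<open>The cubic norm; the product below is determined by adjoint, trace and unit alone.\<close>

definition tits_norm ::
    "('k::field \<Rightarrow> 'l::comm_ring_1) \<Rightarrow> ('k \<Rightarrow> 'c::comm_ring_1) \<Rightarrow> ('c \<Rightarrow> 'c) \<Rightarrow>
     ('l \<Rightarrow> 'e::comm_ring_1) \<Rightarrow> ('c \<Rightarrow> 'e) \<Rightarrow> 'l \<Rightarrow> 'c \<Rightarrow> 'l \<times> 'e \<Rightarrow> 'k" where
  "tits_norm \<phi>L \<phi>K \<iota> iL iK u \<mu> = (\<lambda>(a, b).
     alg_norm \<phi>L a + the_inv \<phi>K (\<mu> * alg_norm iK b + \<iota> (\<mu> * alg_norm iK b))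
       - alg_trace \<phi>L (a * tits_herm \<iota> iL iK u b))"

definition tits_square ::
    "('k::field \<Rightarrow> 'l::comm_ring_1) \<Rightarrow> ('c::comm_ring_1 \<Rightarrow> 'c) \<Rightarrow> ('l \<Rightarrow> 'e::comm_ring_1) \<Rightarrow>
     ('c \<Rightarrow> 'e) \<Rightarrow> 'l \<Rightarrow> 'c \<Rightarrow> 'l \<times> 'e \<Rightarrow> 'l \<times> 'e" where
  "tits_square \<phi>L \<iota> iL iK u \<mu> x =
     tits_sharp \<phi>L \<iota> iL iK u \<mu> x + tits_scale \<phi>L iL (tits_trace \<phi>L x) x
       - tits_scale \<phi>L iL (tits_trace \<phi>L (tits_sharp \<phi>L \<iota> iL iK u \<mu> x)) (1, 0)"

text \<open>The factor 1/2 makes the product of \<open>x\<close> with itself equal to the square above.\<close>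

definition tits_mult ::
    "('k::field \<Rightarrow> 'l::comm_ring_1) \<Rightarrow> ('c::comm_ring_1 \<Rightarrow> 'c) \<Rightarrow> ('l \<Rightarrow> 'e::comm_ring_1) \<Rightarrow>
     ('c \<Rightarrow> 'e) \<Rightarrow> 'l \<Rightarrow> 'c \<Rightarrow> 'l \<times> 'e \<Rightarrow> 'l \<times> 'e \<Rightarrow> 'l \<times> 'e" where
  "tits_mult \<phi>L \<iota> iL iK u \<mu> x y =
     tits_scale \<phi>L iL (1 / 2)
       (tits_square \<phi>L \<iota> iL iK u \<mu> (x + y) - tits_square \<phi>L \<iota> iL iK u \<mu> x
          - tits_square \<phi>L \<iota> iL iK u \<mu> y)"

text \<open>
  \<open>J(E, \<tau>, u, \<mu>)\<close> and \<open>J(E, \<tau>, u', \<mu>')\<close> are isomorphic by an isomorphism mapping \<open>L\<close> onto \<open>L\<close>,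
  not necessarily identically.
\<close>

definition tits_L_isomorphic ::
    "('k::field \<Rightarrow> 'l::comm_ring_1) \<Rightarrow> ('c::comm_ring_1 \<Rightarrow> 'c) \<Rightarrow> ('l \<Rightarrow> 'e::comm_ring_1) \<Rightarrow>
     ('c \<Rightarrow> 'e) \<Rightarrow> 'l \<times> 'c \<Rightarrow> 'l \<times> 'c \<Rightarrow> bool" where
  "tits_L_isomorphic \<phi>L \<iota> iL iK = (\<lambda>(u, \<mu>) (u', \<mu>').
     \<exists>h. Vector_Spaces.linear (tits_scale \<phi>L iL) (tits_scale \<phi>L iL) h \<and> bij h \<and>
         (\<forall>x y. h (tits_mult \<phi>L \<iota> iL iK u \<mu> x y) = tits_mult \<phi>L \<iota> iL iK u' \<mu>' (h x) (h y)) \<and>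
         h ` (UNIV \<times> {0}) = UNIV \<times> {0})"

end

theory Submission
  imports Defs
begin

text \<open>
  Both sides of the equivalence say that every admissible pair \<open>(u, \<mu>)\<close> has the form
  \<open>(w * \<tau> w, N\<^sub>E\<^sub>/\<^sub>K w)\<close> for some \<open>w\<close> in \<open>E\<close>; call such a pair a norm.

  For the torus \<open>T\<close> this is the long exact sequence of
  \<open>1 \<rightarrow> T \<rightarrow> R\<^sub>E\<^sub>/\<^sub>k(G\<^sub>m) \<rightarrow> {(u, \<mu>). N\<^sub>L u = N\<^sub>K \<mu>} \<rightarrow> 1\<close> together with Hilbert 90
  (\<open>H1_trivial_iff_norms\<close>).  Over a separable closure \<open>S\<close> an admissible pair is a norm: \<open>K \<otimes> S\<close> is
  \<open>S \<times> S\<close> with \<open>\<tau>\<close> exchanging the two factors of \<open>E \<otimes> S\<close>, so it is enough to prescribe \<open>z\<close> in one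
  factor with norm the corresponding component of \<open>\<mu>\<close>, and a cube root of that component will do
  (\<open>split_solution\<close>).  The cocycle \<open>z\<inverse> \<sigma>(z)\<close> has values in \<open>T\<close>, and if it is the coboundary of \<open>a\<close>
  then \<open>z a\<inverse>\<close> is fixed by the Galois group, hence lies in \<open>E\<close>.  Conversely Hilbert 90 for
  \<open>(E \<otimes> S)\<^sup>*\<close> turns a cocycle of \<open>T\<close> into a coboundary of some \<open>v\<close> whose norms are Galois invariant,
  i.e. into an admissible pair, and dividing \<open>v\<close> by \<open>w\<close> moves it into \<open>T\<close>.

  Hilbert 90 (\<open>hilbert_90\<close>) looks for a unit among the fixed points of the action twisted by the
  cocycle.  Poincare sums and the independence of characters give a fixed point that is non-zero on
  any given direct factor of \<open>E\<close>.  A fixed point with the smallest possible annihilator in \<open>E\<close> then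
  has annihilator \<open>0\<close>, because \<open>E\<close> is von Neumann regular, and it is a unit because Galois stable
  subspaces of \<open>E \<otimes> S\<close> come from \<open>E\<close>.  All this rests on \<open>k\<close> being the fixed field of the Galois
  group of \<open>S\<close> (\<open>galois_fixed\<close>), where automorphisms of \<open>S\<close> are built by Zorn's lemma.

  For the Jordan algebras (\<open>isomorphic_iff_norms\<close>), a norm gives the isomorphism
  \<open>(a, b) \<mapsto> (a, b * w)\<close>.  Conversely let \<open>h\<close> be an isomorphism mapping \<open>L\<close> onto \<open>L\<close>, and \<open>\<alpha>\<close> the
  automorphism of \<open>L\<close> that it induces.  The component \<open>f : E \<rightarrow> L\<close> of \<open>h\<close> satisfies
  \<open>f (a b) = (T a - 2 \<alpha> a) f b\<close>, which forces \<open>f = 0\<close> on summing over dual bases of the trace form.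
  So \<open>h\<close> maps \<open>E\<close> to \<open>E\<close>; after composing with the inverse of the extension of \<open>\<alpha>\<close> to \<open>E\<close> this is an
  \<open>L\<close>-linear map \<open>\<psi>\<close> taking the form \<open>b u \<tau>(b)\<close> to \<open>b \<tau>(b)\<close> and respecting the adjoints.  Being an
  isometry of a binary form, \<open>\<psi>\<close> is multiplication by \<open>w = \<psi> 1\<close> on \<open>1\<close> and by \<open>w q\<close> with \<open>q\<^sup>2 = 1\<close>,
  \<open>q \<in> L\<close>, on a generator of \<open>K\<close> of trace \<open>0\<close>.  Compatibility with the adjoints forces the norm of \<open>w\<close>
  to be \<open>\<mu>\<close> or its conjugate, so \<open>w\<close> or \<open>\<tau>(w)\<close> shows that \<open>(u, \<mu>)\<close> is a norm.

  Norms and traces have to be computed over \<open>K\<close> and \<open>K \<otimes> S\<close>, which are not fields.  Therefore algebras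
  are handled through explicit free bases, which are carried along base change.
\<close>

section \<open>Free bases, norms and traces\<close>

text \<open>
  Bases are families over an index set, so that they can be multiplied in towers and transported
  along homomorphisms without discussing repetitions or orderings.
\<close>
definition free_basis :: "('a::comm_ring_1 \<Rightarrow> 'b::comm_ring_1) \<Rightarrow> 'i set \<Rightarrow> ('i \<Rightarrow> 'b) \<Rightarrow> bool" where
  "free_basis \<phi> I b \<longleftrightarrow> finite I \<and> (\<forall>x. \<exists>c. x = (\<Sum>i\<in>I. \<phi> (c i) * b i)) \<and>
     (\<forall>c. (\<Sum>i\<in>I. \<phi> (c i) * b i) = 0 \<longrightarrow> (\<forall>i\<in>I. c i = 0))"

definition coord :: "('a::comm_ring_1 \<Rightarrow> 'b::comm_ring_1) \<Rightarrow> 'i set \<Rightarrow> ('i \<Rightarrow> 'b) \<Rightarrow> 'b \<Rightarrow> 'i \<Rightarrow> 'a" where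
  "coord \<phi> I b x = (SOME c. x = (\<Sum>i\<in>I. \<phi> (c i) * b i))"

lemma free_basisD:
  assumes "free_basis \<phi> I b"
  shows "finite I" and "\<exists>c. x = (\<Sum>i\<in>I. \<phi> (c i) * b i)"
    and "(\<Sum>i\<in>I. \<phi> (c i) * b i) = 0 \<Longrightarrow> i \<in> I \<Longrightarrow> c i = 0"
  using assms unfolding free_basis_def by auto

lemma coord_sum:
  assumes "free_basis \<phi> I b"
  shows "(\<Sum>i\<in>I. \<phi> (coord \<phi> I b x i) * b i) = x"
  using someI_ex[OF free_basisD(2)[OF assms, of x]] unfolding coord_def by simp

lemma coord_unique:
  assumes "comm_ring_hom \<phi>" "free_basis \<phi> I b" "x = (\<Sum>i\<in>I. \<phi> (c i) * b i)" "i \<in> I"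
  shows "coord \<phi> I b x i = c i"
proof -
  interpret comm_ring_hom \<phi> by fact
  have "(\<Sum>i\<in>I. \<phi> (coord \<phi> I b x i - c i) * b i) = x - x"
    unfolding hom_minus left_diff_distrib sum_subtractf
    using coord_sum[OF assms(2), of x] assms(3) by simp
  then have "coord \<phi> I b x i - c i = 0"
    using free_basisD(3)[OF assms(2), of "\<lambda>i. coord \<phi> I b x i - c i" i] assms(4) by simp
  then show ?thesis by simp
qed

lemma coord_add:
  assumes "comm_ring_hom \<phi>" "free_basis \<phi> I b" "i \<in> I"
  shows "coord \<phi> I b (x + y) i = coord \<phi> I b x i + coord \<phi> I b y i"
proof -
  interpret comm_ring_hom \<phi> by fact
  show ?thesis
    by (rule coord_unique[OF assms(1,2) _ assms(3)])
       (simp add: hom_add distrib_right sum.distrib coord_sum[OF assms(2)])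
qed

lemma coord_scale:
  assumes "comm_ring_hom \<phi>" "free_basis \<phi> I b" "i \<in> I"
  shows "coord \<phi> I b (\<phi> a * x) i = a * coord \<phi> I b x i"
proof -
  interpret comm_ring_hom \<phi> by fact
  have "\<phi> a * x = \<phi> a * (\<Sum>i\<in>I. \<phi> (coord \<phi> I b x i) * b i)" by (simp add: coord_sum[OF assms(2)])
  also have "\<dots> = (\<Sum>i\<in>I. \<phi> (a * coord \<phi> I b x i) * b i)"
    by (simp add: hom_mult sum_distrib_left mult.assoc)
  finally show ?thesis
    by (intro coord_unique[OF assms(1,2) _ assms(3)])
qed

lemma coord_basis:
  assumes "comm_ring_hom \<phi>" "free_basis \<phi> I b" "i \<in> I" "j \<in> I"
  shows "coord \<phi> I b (b j) i = (if i = j then 1 else 0)"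
proof -
  interpret comm_ring_hom \<phi> by fact
  have "(\<Sum>i\<in>I. \<phi> (if i = j then 1 else 0) * b i) = (\<Sum>i\<in>I. if i = j then b i else 0)"
    by (intro sum.cong) auto
  also have "\<dots> = b j" using assms(4) free_basisD(1)[OF assms(2)] by simp
  finally show ?thesis
    by (intro coord_unique[OF assms(1,2) _ assms(3)]) simp
qed

lemma module_alg_scale:
  assumes "comm_ring_hom \<phi>" shows "Modules.module (alg_scale \<phi>)"
proof -
  interpret comm_ring_hom \<phi> by fact
  show ?thesis by unfold_locales (simp_all add: alg_scale_def algebra_simps hom_distribs)
qed

lemma vector_space_alg_scale:
  assumes "comm_ring_hom (\<phi> :: 'k::field \<Rightarrow> 'b::comm_ring_1)" shows "vector_space (alg_scale \<phi>)"
proof -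
  interpret comm_ring_hom \<phi> by fact
  show ?thesis by unfold_locales (simp_all add: alg_scale_def algebra_simps hom_distribs)
qed

lemma free_basis_set:
  assumes hom: "comm_ring_hom \<phi>" and fin: "finite B"
    and ind: "\<not> module.dependent (alg_scale \<phi>) B" and sp: "module.span (alg_scale \<phi>) B = UNIV"
  shows "free_basis \<phi> B id"
proof -
  interpret comm_ring_hom \<phi> by fact
  interpret M: Modules.module "alg_scale \<phi>" by (rule module_alg_scale[OF hom])
  show ?thesis unfolding free_basis_def
  proof (intro conjI allI impI fin)
    fix x show "\<exists>c. x = (\<Sum>i\<in>B. \<phi> (c i) * id i)"
      using sp unfolding M.span_finite[OF fin] by (auto simp: alg_scale_def image_def)
  next
    fix c assume "(\<Sum>i\<in>B. \<phi> (c i) * id i) = 0"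
    then show "\<forall>i\<in>B. c i = 0" using ind fin unfolding M.dependent_finite[OF fin] alg_scale_def by auto
  qed
qed

lemma free_basis_reindex:
  assumes "bij_betw h J I" "free_basis \<phi> I b"
  shows "free_basis \<phi> J (b \<circ> h)"
proof -
  have fin: "finite J" using assms bij_betw_finite free_basisD(1) by blast
  have eq: "(\<Sum>i\<in>I. \<phi> (c i) * b i) = (\<Sum>j\<in>J. \<phi> (c (h j)) * b (h j))" for c
    using sum.reindex_bij_betw[OF assms(1), of "\<lambda>i. \<phi> (c i) * b i"] by simp
  have inv: "the_inv_into J h (h j) = j" if "j \<in> J" for j
    using assms(1) that by (simp add: bij_betw_def the_inv_into_f_f)
  show ?thesis unfolding free_basis_def o_def
  proof (intro conjI allI impI fin)
    fix x show "\<exists>c. x = (\<Sum>i\<in>J. \<phi> (c i) * b (h i))"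
      using free_basisD(2)[OF assms(2), of x] eq by metis
  next
    fix c assume "(\<Sum>j\<in>J. \<phi> (c j) * b (h j)) = 0"
    then have "(\<Sum>i\<in>I. \<phi> (c (the_inv_into J h i)) * b i) = 0"
      unfolding eq by (simp add: inv cong: sum.cong)
    from free_basisD(3)[OF assms(2) this] show "\<forall>j\<in>J. c j = 0"
      using assms(1) inv by (metis bij_betw_apply)
  qed
qed

lemma free_basis_nth:
  assumes "comm_ring_hom \<phi>" "is_alg_basis \<phi> bs"
  shows "free_basis \<phi> {..<length bs} ((!) bs)"
proof -
  have "free_basis \<phi> (set bs) id" and "distinct bs"
    using assms free_basis_set[of \<phi> "set bs"] unfolding is_alg_basis_def by auto
  then show ?thesis using free_basis_reindex[OF bij_betw_nth[of bs "{..<length bs}" "set bs"]]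
    unfolding o_def id_def by auto
qed

lemma is_alg_basis_map:
  assumes hom: "comm_ring_hom \<phi>" and fb: "free_basis \<phi> {..<n::nat} b"
  shows "is_alg_basis \<phi> (map b [0..<n])"
proof -
  interpret comm_ring_hom \<phi> by fact
  interpret M: Modules.module "alg_scale \<phi>" by (rule module_alg_scale[OF hom])
  have inj: "inj_on b {..<n}"
  proof (rule inj_onI)
    fix i j assume ij: "i \<in> {..<n}" "j \<in> {..<n}" "b i = b j"
    have "(if i = i then 1 else 0) = (if i = j then 1 else (0::'a))"
      using coord_basis[OF hom fb ij(1) ij(1)] coord_basis[OF hom fb ij(1) ij(2)] ij(3) by simp
    then show "i = j" by (auto split: if_splits)
  qed
  have s: "set (map b [0..<n]) = b ` {..<n}" by auto
  have r: "(\<Sum>v\<in>b ` {..<n}. alg_scale \<phi> (u v) v) = (\<Sum>i<n. \<phi> (u (b i)) * b i)" for u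
    by (simp add: sum.reindex[OF inj] alg_scale_def)
  show ?thesis unfolding is_alg_basis_def s
  proof (intro conjI)
    show "distinct (map b [0..<n])" using inj by (auto simp: distinct_map inj_on_def)
    show "\<not> M.dependent (b ` {..<n})"
      unfolding M.dependent_finite[OF finite_imageI[OF finite_lessThan]] r
      using free_basisD(3)[OF fb] by fastforce
    have "x \<in> M.span (b ` {..<n})" for x
    proof -
      have "(\<Sum>i<n. alg_scale \<phi> (coord \<phi> {..<n} b x i) (b i)) \<in> M.span (b ` {..<n})"
        by (intro M.span_sum M.span_scale M.span_base) auto
      then show ?thesis by (simp add: alg_scale_def coord_sum[OF fb])
    qed
    then show "M.span (b ` {..<n}) = UNIV" by blast
  qed
qed

lemma det_zero_column:
  assumes A: "(A :: 'a::comm_ring_1 mat) \<in> carrier_mat n n" and j: "j < n" and z: "\<And>i. i < n \<Longrightarrow> A $$ (i, j) = 0"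
  shows "det A = 0"
  using laplace_expansion_column[OF A j] z by simp

text \<open>
  Invariant basis number: padding with zeros to square matrices would give a matrix with a zero
  column and determinant \<open>1\<close>.
\<close>
lemma mult_one_mat_le:
  assumes P: "(P :: 'a::comm_ring_1 mat) \<in> carrier_mat n m" and Q: "Q \<in> carrier_mat m n"
    and QP: "Q * P = 1\<^sub>m m"
  shows "m \<le> n"
proof (rule ccontr)
  assume "\<not> m \<le> n"
  then have nm: "n < m" by simp
  define Q' where "Q' = mat m m (\<lambda>(i,j). if j < n then Q $$ (i,j) else 0)"
  define P' where "P' = mat m m (\<lambda>(i,j). if i < n then P $$ (i,j) else 0)"
  have c: "Q' \<in> carrier_mat m m" "P' \<in> carrier_mat m m" unfolding Q'_def P'_def by auto
  have "Q' * P' = Q * P"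
  proof (rule eq_matI)
    fix i j assume "i < dim_row (Q * P)" "j < dim_col (Q * P)"
    then have ij: "i < m" "j < m" using P Q by auto
    have "(Q' * P') $$ (i,j) = (\<Sum>k\<in>{0..<m}. (if k < n then Q $$ (i,k) * P $$ (k,j) else 0))"
      using ij c by (auto simp: scalar_prod_def Q'_def P'_def intro!: sum.cong)
    also have "\<dots> = (\<Sum>k\<in>{0..<n}. Q $$ (i,k) * P $$ (k,j))"
      using nm by (subst sum.inter_filter[symmetric]) (auto intro!: sum.cong)
    also have "\<dots> = (Q * P) $$ (i,j)"
      using ij P Q by (auto simp: scalar_prod_def intro!: sum.cong)
    finally show "(Q' * P') $$ (i,j) = (Q * P) $$ (i,j)" .
  qed (use P Q c in auto)
  then have "det Q' * det P' = 1" using QP det_mult[OF c] by simp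
  moreover have "det Q' = 0" by (rule det_zero_column[OF c(1) nm]) (use nm in \<open>simp add: Q'_def\<close>)
  ultimately show False by simp
qed

text \<open>
  Norm and trace are defined by an arbitrary choice of basis.  The matrices of multiplication by \<open>x\<close>
  in two bases are conjugate under the transition matrices \<open>P\<close> and \<open>Q\<close>, which are square by invariance
  of the basis number.
\<close>
lemma alg_norm_trace_coord:
  assumes hom: "comm_ring_hom \<phi>" and fb: "free_basis \<phi> {..<n::nat} b"
  shows "alg_norm \<phi> x = det (mat n n (\<lambda>(i,j). coord \<phi> {..<n} b (x * b j) i))"
    and "alg_trace \<phi> x = (\<Sum>i<n. coord \<phi> {..<n} b (x * b i) i)"
proof -
  interpret comm_ring_hom \<phi> by fact
  interpret M: Modules.module "alg_scale \<phi>" by (rule module_alg_scale[OF hom])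
  define bs where "bs = (SOME bs. is_alg_basis \<phi> bs)"
  have bs: "is_alg_basis \<phi> bs" unfolding bs_def by (rule someI, rule is_alg_basis_map[OF hom fb])
  define m where "m = length bs"
  have fb': "free_basis \<phi> {..<m} ((!) bs)" using free_basis_nth[OF hom bs] unfolding m_def .
  define co where "co = coord \<phi> {..<n} b"
  define co' where "co' = coord \<phi> {..<m} ((!) bs)"
  have mm: "mult_matrix \<phi> bs x = mat m m (\<lambda>(i,j). co' (x * bs ! j) i)"
  proof -
    have "M.representation (set bs) y (bs ! i) = co' y i" if "i < m" for y i
    proof -
      have "y = (\<Sum>v\<in>set bs. alg_scale \<phi> (M.representation (set bs) y v) v)"
        using bs by (intro M.sum_representation_eq[symmetric]) (auto simp: is_alg_basis_def)
      also have "\<dots> = (\<Sum>i<m. \<phi> (M.representation (set bs) y (bs ! i)) * bs ! i)"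
        using sum.reindex_bij_betw[OF bij_betw_nth[of bs "{..<m}" "set bs"], symmetric] bs
        by (simp add: m_def is_alg_basis_def alg_scale_def)
      finally show ?thesis unfolding co'_def
        by (rule coord_unique[OF hom fb', symmetric]) (use that in simp)
    qed
    then show ?thesis unfolding mult_matrix_def m_def[symmetric] by (intro cong_mat) auto
  qed
  define P where "P = mat n m (\<lambda>(i,j). co (bs ! j) i)"
  define Q where "Q = mat m n (\<lambda>(i,j). co' (b j) i)"
  have P: "P \<in> carrier_mat n m" and Q: "Q \<in> carrier_mat m n" by (auto simp: P_def Q_def)
  have comp: "co y i = (\<Sum>k<m. co (bs ! k) i * co' y k)" if "i < n" for y i
  proof -
    have "y = (\<Sum>k<m. \<phi> (co' y k) * bs ! k)" using coord_sum[OF fb'] unfolding co'_def by simp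
    also have "\<dots> = (\<Sum>k<m. \<phi> (co' y k) * (\<Sum>i<n. \<phi> (co (bs ! k) i) * b i))"
      using coord_sum[OF fb] unfolding co_def by simp
    also have "\<dots> = (\<Sum>i<n. \<phi> (\<Sum>k<m. co (bs ! k) i * co' y k) * b i)"
      by (simp add: sum_distrib_left sum_distrib_right hom_sum hom_mult mult_ac) (rule sum.swap)
    finally show ?thesis unfolding co_def
      by (rule coord_unique[OF hom fb]) (use that in simp)
  qed
  have comp': "co' y i = (\<Sum>k<n. co' (b k) i * co y k)" if "i < m" for y i
  proof -
    have "y = (\<Sum>k<n. \<phi> (co y k) * b k)" using coord_sum[OF fb] unfolding co_def by simp
    also have "\<dots> = (\<Sum>k<n. \<phi> (co y k) * (\<Sum>i<m. \<phi> (co' (b k) i) * bs ! i))"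
      using coord_sum[OF fb'] unfolding co'_def by simp
    also have "\<dots> = (\<Sum>i<m. \<phi> (\<Sum>k<n. co' (b k) i * co y k) * bs ! i)"
      by (simp add: sum_distrib_left sum_distrib_right hom_sum hom_mult mult_ac) (rule sum.swap)
    finally show ?thesis unfolding co'_def
      by (rule coord_unique[OF hom fb']) (use that in simp)
  qed
  have PQ: "P * Q = 1\<^sub>m n"
  proof (rule eq_matI)
    fix i j assume "i < dim_row (1\<^sub>m n :: 'a mat)" "j < dim_col (1\<^sub>m n :: 'a mat)"
    then have ij: "i < n" "j < n" by auto
    have "(P * Q) $$ (i,j) = (\<Sum>k<m. co (bs ! k) i * co' (b j) k)"
      using ij by (simp add: P_def Q_def scalar_prod_def atLeast0LessThan)
    also have "\<dots> = co (b j) i" by (rule comp[OF ij(1), symmetric])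
    also have "\<dots> = 1\<^sub>m n $$ (i,j)"
      unfolding co_def using coord_basis[OF hom fb] ij by simp
    finally show "(P * Q) $$ (i,j) = 1\<^sub>m n $$ (i,j)" .
  qed (use P Q in auto)
  have QP: "Q * P = 1\<^sub>m m"
  proof (rule eq_matI)
    fix i j assume "i < dim_row (1\<^sub>m m :: 'a mat)" "j < dim_col (1\<^sub>m m :: 'a mat)"
    then have ij: "i < m" "j < m" by auto
    have "(Q * P) $$ (i,j) = (\<Sum>k<n. co' (b k) i * co (bs ! j) k)"
      using ij by (simp add: P_def Q_def scalar_prod_def atLeast0LessThan)
    also have "\<dots> = co' (bs ! j) i" by (rule comp'[OF ij(1), symmetric])
    also have "\<dots> = 1\<^sub>m m $$ (i,j)"
      unfolding co'_def using coord_basis[OF hom fb'] ij by simp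
    finally show "(Q * P) $$ (i,j) = 1\<^sub>m m $$ (i,j)" .
  qed (use P Q in auto)
  have nm: "m = n" using mult_one_mat_le[OF P Q QP] mult_one_mat_le[OF Q P PQ] by simp
  have P: "P \<in> carrier_mat n n" and Q: "Q \<in> carrier_mat n n" using P Q nm by auto
  define A where "A = mat n n (\<lambda>(i,j). co (x * b j) i)"
  define A' where "A' = mat n n (\<lambda>(i,j). co' (x * bs ! j) i)"
  have A: "A \<in> carrier_mat n n" and A': "A' \<in> carrier_mat n n" by (auto simp: A_def A'_def)
  have lin: "co (x * y) i = (\<Sum>k<n. co (x * b k) i * co y k)" if "i < n" for y i
  proof -
    have "x * y = x * (\<Sum>k<n. \<phi> (co y k) * b k)" using coord_sum[OF fb] unfolding co_def by simp
    also have "\<dots> = (\<Sum>k<n. \<phi> (co y k) * (x * b k))" by (simp add: sum_distrib_left mult_ac)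
    also have "\<dots> = (\<Sum>k<n. \<phi> (co y k) * (\<Sum>i<n. \<phi> (co (x * b k) i) * b i))"
      using coord_sum[OF fb] unfolding co_def by simp
    also have "\<dots> = (\<Sum>i<n. \<phi> (\<Sum>k<n. co (x * b k) i * co y k) * b i)"
      by (simp add: sum_distrib_left sum_distrib_right hom_sum hom_mult mult_ac) (rule sum.swap)
    finally show ?thesis unfolding co_def
      by (rule coord_unique[OF hom fb]) (use that in simp)
  qed
  have AP: "A * P = P * A'"
  proof (rule eq_matI)
    fix i j assume "i < dim_row (P * A')" "j < dim_col (P * A')"
    then have ij: "i < n" "j < n" using P A' by auto
    have "(A * P) $$ (i,j) = (\<Sum>k<n. co (x * b k) i * co (bs ! j) k)"
      using ij nm by (simp add: A_def P_def scalar_prod_def atLeast0LessThan)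
    also have "\<dots> = (\<Sum>k<n. co (bs ! k) i * co' (x * bs ! j) k)"
      using lin[OF ij(1), of "bs ! j"] comp[OF ij(1), of "x * bs ! j"] nm by simp
    also have "\<dots> = (P * A') $$ (i,j)"
      using ij nm by (simp add: A'_def P_def scalar_prod_def atLeast0LessThan)
    finally show "(A * P) $$ (i,j) = (P * A') $$ (i,j)" .
  qed (use A P A' in auto)
  have eqA: "A = P * (A' * Q)"
  proof -
    have "A = A * (P * Q)" using PQ A by simp
    also have "\<dots> = P * A' * Q" using AP A P Q assoc_mult_mat[OF A P Q] by simp
    also have "\<dots> = P * (A' * Q)" by (rule assoc_mult_mat[OF P A' Q])
    finally show ?thesis .
  qed
  have eqA': "A' = (A' * Q) * P"
  proof -
    have "A' = A' * (Q * P)" using QP A' nm by simp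
    also have "\<dots> = (A' * Q) * P" using assoc_mult_mat[OF A' Q P] by simp
    finally show ?thesis .
  qed
  have c: "A' * Q \<in> carrier_mat n n" using A' Q by auto
  have "det A = det A'" using eqA eqA' det_mult[OF P c] det_mult[OF c P] by (metis mult.commute)
  then show "alg_norm \<phi> x = det (mat n n (\<lambda>(i,j). coord \<phi> {..<n} b (x * b j) i))"
    unfolding alg_norm_def bs_def[symmetric] mm unfolding A_def A'_def nm co_def by simp
  have "(\<Sum>i<n. A $$ (i,i)) = (\<Sum>i<n. \<Sum>k<n. P $$ (i,k) * (A' * Q) $$ (k,i))"
    using carrier_matD[OF P] carrier_matD[OF c]
    by (subst eqA) (simp add: scalar_prod_def atLeast0LessThan del: index_mult_mat(2,3) assoc_mult_mat)
  also have "\<dots> = (\<Sum>k<n. \<Sum>i<n. (A' * Q) $$ (k,i) * P $$ (i,k))"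
    by (subst sum.swap) (simp add: mult.commute)
  also have "\<dots> = (\<Sum>k<n. A' $$ (k,k))"
    using carrier_matD[OF P] carrier_matD[OF c]
    by (subst (2) eqA') (simp add: scalar_prod_def atLeast0LessThan del: index_mult_mat(2,3))
  finally show "alg_trace \<phi> x = (\<Sum>i<n. coord \<phi> {..<n} b (x * b i) i)"
    unfolding alg_trace_def bs_def[symmetric] mm Let_def m_def[symmetric]
    by (simp add: A_def A'_def nm co_def)
qed

lemma alg_norm_trace_eq:
  assumes hom: "comm_ring_hom \<phi>" and fb: "free_basis \<phi> {..<n::nat} b"
    and m: "\<And>j. j < n \<Longrightarrow> x * b j = (\<Sum>i<n. \<phi> (m i j) * b i)"
  shows "alg_norm \<phi> x = det (mat n n (\<lambda>(i,j). m i j))" and "alg_trace \<phi> x = (\<Sum>i<n. m i i)"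
proof -
  have c: "coord \<phi> {..<n} b (x * b j) i = m i j" if "i < n" "j < n" for i j
    using that by (intro coord_unique[OF hom fb m]) auto
  show "alg_norm \<phi> x = det (mat n n (\<lambda>(i,j). m i j))"
    unfolding alg_norm_trace_coord[OF hom fb] by (intro arg_cong[where f=det] cong_mat) (auto simp: c)
  show "alg_trace \<phi> x = (\<Sum>i<n. m i i)"
    unfolding alg_norm_trace_coord[OF hom fb] by (intro sum.cong) (auto simp: c)
qed

text \<open>
  A homomorphism that is semilinear over \<open>g\<close> and maps a basis to a basis maps the matrix of \<open>x\<close> to that
  of \<open>f x\<close>.  This covers base change, involutions and Galois automorphisms alike.
\<close>
lemma alg_norm_trace_hom:
  assumes hom: "comm_ring_hom \<phi>" "comm_ring_hom \<phi>'" "comm_ring_hom f" "comm_ring_hom g"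
    and comm: "\<And>a. f (\<phi> a) = \<phi>' (g a)"
    and fb: "free_basis \<phi> {..<n::nat} b" "free_basis \<phi>' {..<n} (\<lambda>i. f (b i))"
  shows "alg_norm \<phi>' (f x) = g (alg_norm \<phi> x)" "alg_trace \<phi>' (f x) = g (alg_trace \<phi> x)"
proof -
  interpret f: comm_ring_hom f by fact
  interpret g: comm_ring_hom g by fact
  define m where "m i j = coord \<phi> {..<n} b (x * b j) i" for i j
  have m: "x * b j = (\<Sum>i<n. \<phi> (m i j) * b i)" for j
    unfolding m_def using coord_sum[OF fb(1)] by simp
  have m': "f x * f (b j) = (\<Sum>i<n. \<phi>' (g (m i j)) * f (b i))" for j
    using arg_cong[OF m, of f j] by (simp add: f.hom_mult f.hom_sum comm)
  have "mat n n (\<lambda>(i,j). g (m i j)) = map_mat g (mat n n (\<lambda>(i,j). m i j))"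
    by (rule eq_matI) auto
  then show "alg_norm \<phi>' (f x) = g (alg_norm \<phi> x)"
    unfolding alg_norm_trace_eq(1)[OF hom(2) fb(2) m'] alg_norm_trace_eq(1)[OF hom(1) fb(1) m]
    by (simp add: g.hom_det)
  show "alg_trace \<phi>' (f x) = g (alg_trace \<phi> x)"
    unfolding alg_norm_trace_eq(2)[OF hom(2) fb(2) m'] alg_norm_trace_eq(2)[OF hom(1) fb(1) m]
    by (simp add: g.hom_sum)
qed

lemma alg_norm_mult:
  assumes hom: "comm_ring_hom \<phi>" and fb: "free_basis \<phi> {..<n::nat} b"
  shows "alg_norm \<phi> (x * y) = alg_norm \<phi> x * alg_norm \<phi> y"
proof -
  interpret comm_ring_hom \<phi> by fact
  define m where "m x i j = coord \<phi> {..<n} b (x * b j) i" for x i j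
  have m: "x * b j = (\<Sum>i<n. \<phi> (m x i j) * b i)" for x j
    unfolding m_def using coord_sum[OF fb(1)] by simp
  have xy: "x * y * b j = (\<Sum>i<n. \<phi> (\<Sum>k<n. m x i k * m y k j) * b i)" for j
  proof -
    have "x * y * b j = x * (\<Sum>i<n. \<phi> (m y i j) * b i)" using m[of y j] by (simp add: mult.assoc)
    also have "\<dots> = (\<Sum>k<n. \<phi> (m y k j) * (x * b k))" by (simp add: sum_distrib_left mult_ac)
    also have "\<dots> = (\<Sum>k<n. \<phi> (m y k j) * (\<Sum>i<n. \<phi> (m x i k) * b i))" by (simp only: m[of x])
    also have "\<dots> = (\<Sum>i<n. \<phi> (\<Sum>k<n. m x i k * m y k j) * b i)"
      by (simp add: sum_distrib_left sum_distrib_right hom_sum hom_mult mult_ac) (rule sum.swap)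
    finally show ?thesis .
  qed
  have "mat n n (\<lambda>(i,j). \<Sum>k<n. m x i k * m y k j) = mat n n (\<lambda>(i,j). m x i j) * mat n n (\<lambda>(i,j). m y i j)"
    by (rule eq_matI) (auto simp: scalar_prod_def atLeast0LessThan)
  moreover have "alg_norm \<phi> (x * y) = det (mat n n (\<lambda>(i,j). \<Sum>k<n. m x i k * m y k j))"
    by (rule alg_norm_trace_eq(1)[OF hom fb xy])
  moreover have "alg_norm \<phi> z = det (mat n n (\<lambda>(i,j). m z i j))" for z
    by (rule alg_norm_trace_eq(1)[OF hom fb m])
  ultimately show ?thesis by (simp add: det_mult[of _ n])
qed

lemma alg_norm_scalar:
  assumes hom: "comm_ring_hom \<phi>" and fb: "free_basis \<phi> {..<n::nat} b"
  shows "alg_norm \<phi> (\<phi> a) = a ^ n" "alg_trace \<phi> (\<phi> a) = of_nat n * a"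
proof -
  interpret comm_ring_hom \<phi> by fact
  have m: "\<phi> a * b j = (\<Sum>i<n. \<phi> (if i = j then a else 0) * b i)" if "j < n" for j
  proof -
    have "(\<Sum>i<n. \<phi> (if i = j then a else 0) * b i) = (\<Sum>i<n. if i = j then \<phi> a * b i else 0)"
      by (intro sum.cong) auto
    then show ?thesis using that by simp
  qed
  have e: "mat n n (\<lambda>(i,j). if i = j then a else 0) = a \<cdot>\<^sub>m 1\<^sub>m n" by (rule eq_matI) auto
  show "alg_norm \<phi> (\<phi> a) = a ^ n"
    using alg_norm_trace_eq(1)[OF hom fb m] by (simp add: e)
  show "alg_trace \<phi> (\<phi> a) = of_nat n * a"
    using alg_norm_trace_eq(2)[OF hom fb m] by simp
qed

lemma alg_norm_one:
  assumes hom: "comm_ring_hom \<phi>" and fb: "free_basis \<phi> {..<n::nat} b"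
  shows "alg_norm \<phi> 1 = 1"
proof -
  interpret comm_ring_hom \<phi> by fact
  show ?thesis using alg_norm_scalar(1)[OF hom fb, of 1] by simp
qed

lemma alg_trace_linear:
  assumes hom: "comm_ring_hom \<phi>" and fb: "free_basis \<phi> {..<n::nat} b"
  shows "alg_trace \<phi> (x + y) = alg_trace \<phi> x + alg_trace \<phi> y"
    and "alg_trace \<phi> (\<phi> a * x) = a * alg_trace \<phi> x"
  unfolding alg_norm_trace_coord(2)[OF hom fb]
  by (simp_all add: distrib_right coord_add[OF hom fb] sum.distrib mult.assoc coord_scale[OF hom fb] sum_distrib_left)

lemma det_mat_2:
  "det (mat 2 2 (\<lambda>(i,j). m i j)) = m 0 0 * m (Suc 0) (Suc 0) - m 0 (Suc 0) * m (Suc 0) (0::nat)"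
  (is "det ?A = _")
proof -
  have A: "?A \<in> carrier_mat 2 2" by simp
  have "det ?A = (\<Sum>i<2. ?A $$ (i, 0) * cofactor ?A i 0)"
    by (rule laplace_expansion_column[OF A]) simp
  then show ?thesis
    by (simp add: numeral_2_eq_2 cofactor_def mat_delete_def det_single algebra_simps)
qed

lemma det_mat_3:
  "det (mat 3 3 (\<lambda>(i,j). m i j)) = m 0 0 * m (Suc 0) (Suc 0) * m 2 2 + m 0 (Suc 0) * m (Suc 0) 2 * m 2 0
     + m 0 2 * m (Suc 0) 0 * m 2 (Suc 0) - m 0 0 * m (Suc 0) 2 * m 2 (Suc 0)
     - m 0 (Suc 0) * m (Suc 0) 0 * m 2 2 - m 0 2 * m (Suc 0) (Suc 0) * m 2 (0::nat)"
  (is "det ?A = _")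
proof -
  have A: "?A \<in> carrier_mat 3 3" by simp
  have d: "mat_delete ?A i 0 = mat 2 2 (\<lambda>(i',j'). m (if i' < i then i' else Suc i') (Suc j'))" if "i < 3" for i
    using that by (intro eq_matI) (auto simp: mat_delete_def)
  have "det ?A = (\<Sum>i<3. ?A $$ (i, 0) * cofactor ?A i 0)"
    by (rule laplace_expansion_column[OF A]) simp
  also have "\<dots> = (\<Sum>i<3. m i 0 * ((-1) ^ i * det (mat 2 2 (\<lambda>(i',j'). m (if i' < i then i' else Suc i') (Suc j')))))"
    by (intro sum.cong) (auto simp: cofactor_def d)
  finally show ?thesis unfolding det_mat_2
    by (simp add: numeral_3_eq_3 numeral_2_eq_2 algebra_simps)
qed

text \<open>
  Cramer's rule: the relations \<open>r\<close> say that the matrix \<open>x - m\<close> kills the vector \<open>(u, v, w)\<close>; the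
  multipliers of the relations in the proof are the entries of its adjugate.
\<close>
lemma cayley_hamilton_3_aux:
  fixes x a b c d e f g h i u v w :: "'a::comm_ring_1"
  assumes r: "x * u = a * u + d * v + g * w" "x * v = b * u + e * v + h * w" "x * w = c * u + f * v + i * w"
  defines "P \<equiv> x^3 - (a + e + i) * x^2 + (a * e + a * i + e * i - b * d - c * g - f * h) * x
             - (a * e * i + b * f * g + c * d * h - a * f * h - b * d * i - c * e * g)"
  shows "P * u = 0" "P * v = 0" "P * w = 0"
proof -
  have "P * u = ((x - e) * (x - i) - h * f) * (x * u - (a * u + d * v + g * w))
     + (d * (x - i) + g * f) * (x * v - (b * u + e * v + h * w))
     + (d * h + g * (x - e)) * (x * w - (c * u + f * v + i * w))"
    unfolding P_def by (simp add: algebra_simps power2_eq_square power3_eq_cube)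
  then show "P * u = 0" using r by simp
  have "P * v = (b * (x - i) + h * c) * (x * u - (a * u + d * v + g * w))
     + ((x - a) * (x - i) - g * c) * (x * v - (b * u + e * v + h * w))
     + ((x - a) * h + g * b) * (x * w - (c * u + f * v + i * w))"
    unfolding P_def by (simp add: algebra_simps power2_eq_square power3_eq_cube)
  then show "P * v = 0" using r by simp
  have "P * w = (b * f + (x - e) * c) * (x * u - (a * u + d * v + g * w))
     + ((x - a) * f + d * c) * (x * v - (b * u + e * v + h * w))
     + ((x - a) * (x - e) - d * b) * (x * w - (c * u + f * v + i * w))"
    unfolding P_def by (simp add: algebra_simps power2_eq_square power3_eq_cube)
  then show "P * w = 0" using r by simp
qed

text \<open>
  The second coefficient of the characteristic polynomial is \<open>(T(x)\<^sup>2 - T(x\<^sup>2)) / 2\<close>; the whole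
  identity is doubled to avoid the denominator.
\<close>
lemma cubic_cayley_hamilton:
  fixes x :: "'b::comm_ring_1" and \<phi> :: "'a::comm_ring_1 \<Rightarrow> 'b"
  assumes hom: "comm_ring_hom \<phi>" and fb: "free_basis \<phi> {..<3::nat} b"
  shows "2 * x^3 - 2 * \<phi> (alg_trace \<phi> x) * x^2 + \<phi> (alg_trace \<phi> x ^ 2 - alg_trace \<phi> (x^2)) * x
           - 2 * \<phi> (alg_norm \<phi> x) = 0" (is "?P = 0")
proof -
  interpret comm_ring_hom \<phi> by fact
  define m where "m i j = coord \<phi> {..<3} b (x * b j) i" for i j
  have s3: "(\<Sum>i<3. f i) = f 0 + f (Suc 0) + f 2" for f :: "nat \<Rightarrow> 'd::comm_monoid_add"
    by (simp add: numeral_3_eq_3 numeral_2_eq_2)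
  have m: "x * b j = (\<Sum>i<3. \<phi> (m i j) * b i)" for j
    unfolding m_def using coord_sum[OF fb(1)] by simp
  have m2: "x^2 * b j = (\<Sum>i<3. \<phi> (\<Sum>k<3. m i k * m k j) * b i)" for j
  proof -
    have "x^2 * b j = x * (\<Sum>i<3. \<phi> (m i j) * b i)" using m[of j] by (simp add: power2_eq_square mult.assoc)
    also have "\<dots> = (\<Sum>k<3. \<phi> (m k j) * (x * b k))" by (simp add: sum_distrib_left mult_ac)
    also have "\<dots> = (\<Sum>k<3. \<phi> (m k j) * (\<Sum>i<3. \<phi> (m i k) * b i))" by (simp only: m)
    also have "\<dots> = (\<Sum>i<3. \<phi> (\<Sum>k<3. m i k * m k j) * b i)"
      unfolding sum_distrib_left sum_distrib_right hom_sum hom_mult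
      by (subst sum.swap) (simp add: mult_ac)
    finally show ?thesis .
  qed
  have T: "alg_trace \<phi> x = m 0 0 + m (Suc 0) (Suc 0) + m 2 2"
    using alg_norm_trace_eq(2)[OF hom fb m] by (simp add: s3)
  have T2: "alg_trace \<phi> (x^2) = (\<Sum>i<3. \<Sum>k<3. m i k * m k i)"
    by (rule alg_norm_trace_eq(2)[OF hom fb m2])
  note N = alg_norm_trace_eq(1)[OF hom fb m, unfolded det_mat_3]
  define M where "M i j = \<phi> (m i j)" for i j
  have b: "x * b 0 = M 0 0 * b 0 + M (Suc 0) 0 * b (Suc 0) + M 2 0 * b 2"
    "x * b (Suc 0) = M 0 (Suc 0) * b 0 + M (Suc 0) (Suc 0) * b (Suc 0) + M 2 (Suc 0) * b 2"
    "x * b 2 = M 0 2 * b 0 + M (Suc 0) 2 * b (Suc 0) + M 2 2 * b 2"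
    unfolding m s3 M_def by simp_all
  have T': "\<phi> (alg_trace \<phi> x) = M 0 0 + M (Suc 0) (Suc 0) + M 2 2"
    unfolding T M_def by (simp add: hom_add)
  have S': "\<phi> (alg_trace \<phi> x ^ 2 - alg_trace \<phi> (x^2)) =
      2 * (M 0 0 * M (Suc 0) (Suc 0) + M 0 0 * M 2 2 + M (Suc 0) (Suc 0) * M 2 2
       - M 0 (Suc 0) * M (Suc 0) 0 - M 0 2 * M 2 0 - M (Suc 0) 2 * M 2 (Suc 0))"
    unfolding T T2 M_def s3 by (simp add: hom_distribs power2_eq_square algebra_simps)
  have N': "\<phi> (alg_norm \<phi> x) = M 0 0 * M (Suc 0) (Suc 0) * M 2 2 + M 0 (Suc 0) * M (Suc 0) 2 * M 2 0
     + M 0 2 * M (Suc 0) 0 * M 2 (Suc 0) - M 0 0 * M (Suc 0) 2 * M 2 (Suc 0)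
     - M 0 (Suc 0) * M (Suc 0) 0 * M 2 2 - M 0 2 * M (Suc 0) (Suc 0) * M 2 0"
    unfolding N M_def by (simp add: hom_distribs)
  have "?P * b j = 0" if "j < 3" for j
  proof -
    define Q where "Q = x^3 - (M 0 0 + M (Suc 0) (Suc 0) + M 2 2) * x^2 + (M 0 0 * M (Suc 0) (Suc 0)
        + M 0 0 * M 2 2 + M (Suc 0) (Suc 0) * M 2 2 - M 0 (Suc 0) * M (Suc 0) 0 - M 0 2 * M 2 0
        - M (Suc 0) 2 * M 2 (Suc 0)) * x - \<phi> (alg_norm \<phi> x)"
    have P2: "?P = 2 * Q"
      unfolding T' S' Q_def by (simp add: algebra_simps)
    have "Q * b 0 = 0" "Q * b (Suc 0) = 0" "Q * b 2 = 0"
      unfolding Q_def N' by (fact cayley_hamilton_3_aux[OF b])+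
    moreover have "?P * y = 2 * (Q * y)" for y unfolding P2 by (rule mult.assoc)
    ultimately have "?P * b 0 = 0" "?P * b (Suc 0) = 0" "?P * b 2 = 0"
      by (simp_all only: mult_zero_right)
    moreover have "j = 0 \<or> j = Suc 0 \<or> j = 2" using that by auto
    ultimately show ?thesis by auto
  qed
  then have "?P * (\<Sum>i<3. \<phi> (coord \<phi> {..<3} b 1 i) * b i) = 0"
    unfolding sum_distrib_left by (intro sum.neutral) (auto simp: mult.left_commute)
  then show ?thesis unfolding coord_sum[OF fb] by simp
qed

section \<open>Cubic algebras\<close>

definition polar :: "('b::ab_group_add \<Rightarrow> 'c::ab_group_add) \<Rightarrow> 'b \<Rightarrow> 'b \<Rightarrow> 'c" where
  "polar q x y = q (x + y) - q x - q y"

lemma polar_commute: "polar q x y = polar q y x"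
  by (simp add: polar_def add.commute)

lemma quadratic_mapI:
  assumes "\<And>c x. q (\<phi> c * x) = \<phi> c ^ 2 * q x"
    and "\<And>x y z. polar q (x + y) z = polar q x z + polar q y z"
    and "\<And>c x y. polar q (\<phi> c * x) y = \<phi> c * polar q x y"
  shows "quadratic_map \<phi> q"
  using assms polar_commute[of q] unfolding quadratic_map_def Let_def polar_def[symmetric] by metis

lemma quadratic_mapD:
  assumes "quadratic_map \<phi> q"
  shows "q (\<phi> c * x) = \<phi> c ^ 2 * q x"
    and "polar q (x + y) z = polar q x z + polar q y z"
    and "polar q z (x + y) = polar q z x + polar q z y"
    and "polar q (\<phi> c * x) y = \<phi> c * polar q x y"
    and "polar q y (\<phi> c * x) = \<phi> c * polar q y x"
  using assms unfolding quadratic_map_def Let_def polar_def[symmetric] by blast+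

lemma quadratic_map_diff:
  assumes "quadratic_map \<phi> q" "quadratic_map \<phi> r"
  shows "quadratic_map \<phi> (\<lambda>x. q x - r x)"
proof -
  have e: "polar (\<lambda>x. q x - r x) x y = polar q x y - polar r x y" for x y
    unfolding polar_def by simp
  show ?thesis by (rule quadratic_mapI)
    (simp_all add: e quadratic_mapD[OF assms(1)] quadratic_mapD[OF assms(2)] right_diff_distrib)
qed

lemma quadratic_map_cmult:
  fixes \<phi> :: "'a::comm_ring_1 \<Rightarrow> 'b::comm_ring_1"
  assumes "quadratic_map \<phi> q"
  shows "quadratic_map \<phi> (\<lambda>x. a * q x)"
proof -
  have e: "polar (\<lambda>x. a * q x) x y = a * polar q x y" for x y
    unfolding polar_def by (simp add: right_diff_distrib)
  show ?thesis
  proof (rule quadratic_mapI)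
    show "a * q (\<phi> c * x) = \<phi> c ^ 2 * (a * q x)" for c x
      unfolding quadratic_mapD(1)[OF assms] by (rule mult.left_commute)
    show "polar (\<lambda>x. a * q x) (x + y) z = polar (\<lambda>x. a * q x) x z + polar (\<lambda>x. a * q x) y z" for x y z
      unfolding e quadratic_mapD(2)[OF assms] by (rule distrib_left)
    show "polar (\<lambda>x. a * q x) (\<phi> c * x) y = \<phi> c * polar (\<lambda>x. a * q x) x y" for c x y
      unfolding e quadratic_mapD(4)[OF assms] by (rule mult.left_commute)
  qed
qed

lemma quadratic_map_comp_mult:
  fixes \<phi> :: "'a::comm_ring_1 \<Rightarrow> 'b::comm_ring_1"
  assumes "quadratic_map \<phi> q"
  shows "quadratic_map \<phi> (\<lambda>x. q (a * x))"
proof -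
  have e: "polar (\<lambda>x. q (a * x)) x y = polar q (a * x) (a * y)" for x y
    unfolding polar_def by (simp add: distrib_left)
  show ?thesis
  proof (rule quadratic_mapI)
    show "q (a * (\<phi> c * x)) = \<phi> c ^ 2 * q (a * x)" for c x
      unfolding mult.left_commute[of a "\<phi> c"] by (rule quadratic_mapD(1)[OF assms])
    show "polar (\<lambda>x. q (a * x)) (x + y) z = polar (\<lambda>x. q (a * x)) x z + polar (\<lambda>x. q (a * x)) y z" for x y z
      unfolding e distrib_left by (rule quadratic_mapD(2)[OF assms])
    show "polar (\<lambda>x. q (a * x)) (\<phi> c * x) y = \<phi> c * polar (\<lambda>x. q (a * x)) x y" for c x y
      unfolding e mult.left_commute[of a "\<phi> c"] by (rule quadratic_mapD(4)[OF assms])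
  qed
qed

locale cubic_algebra =
  fixes \<phi> :: "'a::comm_ring_1 \<Rightarrow> 'b::comm_ring_1" and bas :: "nat \<Rightarrow> 'b" and half :: 'a
  assumes hom: "comm_ring_hom \<phi>" and basis: "free_basis \<phi> {..<3} bas"
    and half: "2 * half = 1"
begin

sublocale comm_ring_hom \<phi> by (rule hom)

abbreviation T where "T \<equiv> alg_trace \<phi>"
abbreviation N where "N \<equiv> alg_norm \<phi>"

text \<open>
  The second coefficient of the characteristic polynomial.  By Cayley-Hamilton, \<open>adj x\<close> below is a
  quadratic map with \<open>x * adj x = N x\<close>.
\<close>
definition S where "S x = half * (T x ^ 2 - T (x^2))"

definition adj where "adj x = x^2 - \<phi> (T x) * x + \<phi> (S x)"

lemma half2: "half * 2 = 1" using half by (simp add: mult.commute)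

lemma two_cancel: "2 * (x::'b) = 0 \<Longrightarrow> x = 0"
proof -
  assume "2 * x = 0"
  then have "\<phi> half * (2 * x) = 0" by simp
  moreover have "\<phi> half * 2 = 1" using half by (metis hom_mult hom_numeral hom_one mult.commute)
  ultimately show "x = 0" by (simp add: mult.assoc[symmetric])
qed

lemma two_cancel_scalar: "2 * (x::'a) = 0 \<Longrightarrow> x = 0"
  by (metis half2 mult.assoc mult_1 mult_zero_right)

lemma two_eqD: "2 * (x::'b) = 2 * y \<Longrightarrow> x = y"
  using two_cancel[of "x - y"] by (simp add: algebra_simps)

lemmas T_add = alg_trace_linear(1)[OF hom basis]
lemmas T_scale = alg_trace_linear(2)[OF hom basis]
lemmas N_mult = alg_norm_mult[OF hom basis]
lemmas N_one = alg_norm_one[OF hom basis]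

lemma T_scalar: "T (\<phi> a) = 3 * a"
  using alg_norm_scalar(2)[OF hom basis, of a] by simp

lemma T_one: "T 1 = 3" using T_scalar[of 1] by simp
lemma T_zero [simp]: "T 0 = 0" using T_scalar[of 0] by simp
lemma T_minus: "T (- x) = - T x" using T_scale[of "-1" x] by (simp add: hom_uminus)
lemma T_diff: "T (x - y) = T x - T y" using T_add[of x "-y"] by (simp add: T_minus)
lemma T_sum: "T (sum f A) = (\<Sum>x\<in>A. T (f x))"
  by (induction A rule: infinite_finite_induct) (simp_all add: T_add)

lemma two_S: "2 * S x = T x ^ 2 - T (x^2)"
  unfolding S_def by (simp add: mult.assoc[symmetric] half)

lemma adj_mult_self: "x * adj x = \<phi> (N x)"
proof -
  have "2 * (x * adj x) = 2 * x^3 - 2 * \<phi> (T x) * x^2 + \<phi> (2 * S x) * x"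
    unfolding adj_def by (simp add: algebra_simps power2_eq_square power3_eq_cube hom_mult hom_numeral)
  also have "\<dots> = 2 * \<phi> (N x)"
    using cubic_cayley_hamilton[OF hom basis, of x] unfolding two_S by (simp add: algebra_simps)
  finally show ?thesis by (rule two_eqD)
qed

lemma S_polar: "S (x + y) = S x + S y + (T x * T y - T (x * y))"
proof -
  have "2 * (S (x + y) - S x - S y - (T x * T y - T (x * y))) = 0"
  proof -
    have "(x + y)^2 = x^2 + y^2 + (x * y + x * y)" by (simp add: power2_eq_square algebra_simps)
    then have "T ((x + y)^2) = T (x^2) + T (y^2) + 2 * T (x * y)" by (simp only: T_add mult_2)
    then show ?thesis unfolding right_diff_distrib two_S T_add
      by (simp add: algebra_simps power2_eq_square)
  qed
  then have "S (x + y) - S x - S y - (T x * T y - T (x * y)) = 0" by (rule two_cancel_scalar)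
  then show ?thesis by (simp add: algebra_simps)
qed

lemma adj_polar: "polar adj x y =
    2 * x * y - \<phi> (T x) * y - \<phi> (T y) * x + \<phi> (T x * T y - T (x * y))"
  unfolding polar_def adj_def S_polar T_add by (simp add: algebra_simps power2_eq_square hom_add hom_mult hom_minus hom_power)

lemma adj_scale: "adj (\<phi> c * x) = \<phi> c ^ 2 * adj x"
proof -
  have "T ((\<phi> c * x)^2) = c^2 * T (x^2)"
    using T_scale[of "c^2" "x^2"] by (simp add: power_mult_distrib hom_power)
  then have "S (\<phi> c * x) = c^2 * S x" unfolding S_def T_scale by (simp add: algebra_simps)
  then show ?thesis unfolding adj_def T_scale
    by (simp add: power_mult_distrib hom_mult hom_power algebra_simps power2_eq_square)
qed

lemma quadratic_map_adj: "quadratic_map \<phi> adj"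
proof (rule quadratic_mapI)
  fix c x y z
  show "adj (\<phi> c * x) = \<phi> c ^ 2 * adj x" by (rule adj_scale)
  show "polar adj (x + y) z = polar adj x z + polar adj y z"
    unfolding adj_polar distrib_right T_add
    by (simp add: hom_add hom_mult hom_minus algebra_simps)
  show "polar adj (\<phi> c * x) y = \<phi> c * polar adj x y"
    unfolding adj_polar mult.assoc[of "\<phi> c"] T_scale
    by (simp add: hom_mult hom_minus algebra_simps)
qed

text \<open>
  Comparing \<open>x + y\<close> with \<open>x - y\<close> splits \<open>(x + y) * q (x + y) = 0\<close> into its parts of degree \<open>(1, 2)\<close>
  and \<open>(2, 1)\<close>; at \<open>x = 1\<close> they give \<open>q = 0\<close>.  Hence the adjoint is determined by its defining equation
  (\<open>alg_adjoint_eq\<close>).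
\<close>
lemma quadratic_annihilated:
  assumes q: "quadratic_map \<phi> q" and z: "\<And>x. x * q x = 0"
  shows "q x = 0"
proof -
  define p where "p = polar q"
  note p = quadratic_mapD[OF q, folded p_def]
  have q1: "q (- x) = q x" for x using p(1)[of "-1" x] by (simp add: hom_uminus)
  have p1: "p x (- y) = - p x y" for x y
    using p(5)[of x "-1" y] by (simp add: hom_uminus)
  have e: "x * p x y + x * q y + y * q x + y * p x y = 0" for x y
  proof -
    have "(x + y) * q (x + y) = 0" by (rule z)
    moreover have "q (x + y) = p x y + q x + q y" by (simp add: p_def polar_def)
    ultimately show ?thesis using z[of x] z[of y] by (simp add: algebra_simps)
  qed
  have "2 * (x * q y + y * p x y) = 0" for x y
  proof -
    have "2 * (x * q y + y * p x y) = (x * p x y + x * q y + y * q x + y * p x y)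
        + (x * p x (- y) + x * q (- y) + (- y) * q x + (- y) * p x (- y))"
      by (simp add: p1 q1 algebra_simps)
    then show ?thesis unfolding e by simp
  qed
  then have e2: "x * q y + y * p x y = 0" for x y by (rule two_cancel)
  have "q 1 = 0" using z[of 1] by simp
  moreover have "x * p x y + y * q x = 0" for x y 
  proof -
    have "x * p x y + y * q x = (x * p x y + x * q y + y * q x + y * p x y) - (x * q y + y * p x y)"
      by simp
    then show ?thesis unfolding e e2 by simp
  qed
  from this[of 1] have "p 1 y + y * q 1 = 0" for y by simp
  ultimately have "p 1 y = 0" for y by simp
  then show ?thesis using e2[of 1 x] by simp
qed

lemma adjoint_unique:
  assumes "quadratic_map \<phi> q" "\<And>x. x * q x = \<phi> (N x)"
  shows "q = adj"
proof
  fix x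
  have "(\<lambda>x. q x - adj x) x = 0"
    by (rule quadratic_annihilated[OF quadratic_map_diff[OF assms(1) quadratic_map_adj]])
       (simp add: right_diff_distrib assms(2) adj_mult_self)
  then show "q x = adj x" by simp
qed

lemma alg_adjoint_eq: "alg_adjoint \<phi> = adj"
  unfolding alg_adjoint_def
proof (rule the_equality)
  show "quadratic_map \<phi> adj \<and> (\<forall>x. x * adj x = \<phi> (N x))"
    using quadratic_map_adj adj_mult_self by blast
  show "q = adj" if "quadratic_map \<phi> q \<and> (\<forall>x. x * q x = \<phi> (N x))" for q
    using that adjoint_unique by blast
qed

lemma adj_one: "adj 1 = 1"
proof -
  have "2 * S 1 = 2 * 3" unfolding two_S T_one power_one by simp
  then have "2 * (S 1 - 3) = 0" by simp
  then have "S 1 - 3 = 0" by (rule two_cancel_scalar)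
  then have "S 1 = 3" by simp
  then show ?thesis unfolding adj_def T_one by simp
qed

text \<open>
  Uniqueness of the adjoint again: \<open>x \<mapsto> (adj w)\<inverse> * adj (w * x)\<close> is quadratic and multiplies \<open>x\<close> into
  \<open>N x\<close>.  The inverse of \<open>adj w\<close> is \<open>N v * w\<close>.
\<close>
lemma adj_mult_unit:
  assumes "w * v = 1"
  shows "adj (w * x) = adj w * adj x"
proof -
  define q where "q x = (\<phi> (N v) * w) * adj (w * x)" for x
  have NN: "\<phi> (N w) * \<phi> (N v) = 1"
    using assms N_mult[of w v] N_one by (metis hom_mult hom_one)
  have wv: "w * (v * y) = y" "v * (w * y) = y" for y
    using assms by (metis mult.assoc mult.commute mult_1)+
  have "q = adj"
  proof (rule adjoint_unique)
    show "quadratic_map \<phi> q" unfolding q_def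
      by (intro quadratic_map_cmult quadratic_map_comp_mult quadratic_map_adj)
    fix x
    have "x * q x = \<phi> (N v) * (w * x * adj (w * x))"
      unfolding q_def by (simp add: mult_ac)
    also have "\<dots> = \<phi> (N v) * \<phi> (N w * N x)" unfolding adj_mult_self N_mult ..
    also have "\<dots> = \<phi> (N x)" by (metis NN hom_mult mult.assoc mult.commute mult_1)
    finally show "x * q x = \<phi> (N x)" .
  qed
  then have "adj x = \<phi> (N v) * w * adj (w * x)" unfolding q_def by metis
  then have "\<phi> (N w) * adj x = (\<phi> (N w) * \<phi> (N v)) * (w * adj (w * x))" by (simp add: mult_ac)
  then have "w * adj w * adj x = w * adj (w * x)" unfolding NN adj_mult_self by simp
  then have "v * (w * (adj w * adj x)) = v * (w * adj (w * x))" by (simp add: mult_ac)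
  then show ?thesis unfolding wv by simp
qed

end

lemma cubic_adj_hom:
  assumes c: "cubic_algebra \<phi> b h" "cubic_algebra \<phi>' b' h'"
    and hom: "comm_ring_hom f" "comm_ring_hom g"
    and comm: "\<And>a. f (\<phi> a) = \<phi>' (g a)"
    and fb: "free_basis \<phi>' {..<3} (\<lambda>i. f (b i))"
  shows "cubic_algebra.adj \<phi>' h' (f x) = f (cubic_algebra.adj \<phi> h x)"
proof -
  interpret A: cubic_algebra \<phi> b h by fact
  interpret B: cubic_algebra \<phi>' b' h' by fact
  interpret f: comm_ring_hom f by fact
  interpret g: comm_ring_hom g by fact
  note tr = alg_norm_trace_hom(2)[OF A.hom B.hom hom comm A.basis fb]
  have "2 * B.S (f x) = g (2 * A.S x)"
    unfolding A.two_S B.two_S f.hom_power[symmetric] tr by (simp add: g.hom_minus g.hom_power)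
  then have "2 * B.S (f x) = 2 * g (A.S x)" by (simp only: g.hom_mult g.hom_numeral)
  then have "2 * (B.S (f x) - g (A.S x)) = 0" by (simp only: right_diff_distrib) simp
  then have "B.S (f x) - g (A.S x) = 0" by (rule B.two_cancel_scalar)
  then have "B.S (f x) = g (A.S x)" by simp
  then show ?thesis unfolding A.adj_def B.adj_def tr by (simp add: comm f.hom_add f.hom_mult f.hom_minus f.hom_power)
qed

section \<open>Tensor products\<close>

lemma comm_ring_homI:
  fixes f :: "'a::comm_ring_1 \<Rightarrow> 'b::comm_ring_1"
  assumes "f 1 = 1" "\<And>x y. f (x + y) = f x + f y" "\<And>x y. f (x * y) = f x * f y"
  shows "comm_ring_hom f"
proof
  show "f 0 = 0" using assms(2)[of 0 0] by simp
qed (use assms in auto)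

lemma field_hom_eq_0_iff:
  fixes f :: "'k::field \<Rightarrow> 'a::comm_ring_1"
  assumes "comm_ring_hom f" shows "f x = 0 \<longleftrightarrow> x = 0"
proof -
  interpret comm_ring_hom f by fact
  show ?thesis by (metis hom_mult hom_one hom_zero mult_zero_left right_inverse zero_neq_one)
qed

lemma comm_ring_hom_id: "comm_ring_hom (id :: 'a::comm_ring_1 \<Rightarrow> 'a)"
  by (rule comm_ring_homI) auto

lemma comm_ring_hom_comp:
  assumes "comm_ring_hom f" "comm_ring_hom g"
  shows "comm_ring_hom (f \<circ> g)"
proof -
  interpret f: comm_ring_hom f by fact
  interpret g: comm_ring_hom g by fact
  show ?thesis by (rule comm_ring_homI) (simp_all add: f.hom_add g.hom_add f.hom_mult g.hom_mult)
qed

lemma additive_of_int: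
  fixes h :: "'a::comm_ring_1 \<Rightarrow> 'b::comm_ring_1"
  assumes "\<And>x y. h (x + y) = h x + h y"
  shows "h (of_int n * x) = of_int n * h x"
proof -
  have z: "h 0 = 0" using assms[of 0 0] by simp
  have m: "h (- x) = - h x" for x
  proof -
    have "h x + h (- x) = 0" using assms[of x "-x"] z by simp
    from minus_unique[OF this] show ?thesis by simp
  qed
  have n: "h (of_nat n * x) = of_nat n * h x" for n
    by (induction n) (simp_all add: z distrib_right assms)
  show ?thesis
    by (cases n rule: int_cases2) (use n m in simp_all)
qed

lemma additive_sum:
  fixes h :: "'a::comm_ring_1 \<Rightarrow> 'b::comm_ring_1"
  assumes "\<And>x y. h (x + y) = h x + h y"
  shows "h (sum f A) = (\<Sum>x\<in>A. h (f x))"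
proof -
  have z: "h 0 = 0" using assms[of 0 0] by simp
  show ?thesis by (induction A rule: infinite_finite_induct) (simp_all add: z assms)
qed

text \<open>
  The extension of \<open>G\<close> to the free abelian group.  Values in a ring suffice below, and there the
  integer multiples are products with \<open>of_int\<close>.
\<close>
definition free_abelian_ext :: "('x \<Rightarrow> 'g::comm_ring_1) \<Rightarrow> ('x \<Rightarrow>\<^sub>0 int) \<Rightarrow> 'g" where
  "free_abelian_ext G f = (\<Sum>x\<in>Poly_Mapping.keys f. of_int (Poly_Mapping.lookup f x) * G x)"

lemma free_abelian_ext_superset:
  assumes "finite X" "Poly_Mapping.keys f \<subseteq> X"
  shows "free_abelian_ext G f = (\<Sum>x\<in>X. of_int (Poly_Mapping.lookup f x) * G x)"
  unfolding free_abelian_ext_def using assms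
  by (intro sum.mono_neutral_left) (auto simp: in_keys_iff)

lemma free_abelian_ext_add: "free_abelian_ext G (f + g) = free_abelian_ext G f + free_abelian_ext G g"
proof -
  define X where "X = Poly_Mapping.keys f \<union> Poly_Mapping.keys g"
  have "finite X" "Poly_Mapping.keys f \<subseteq> X" "Poly_Mapping.keys g \<subseteq> X" "Poly_Mapping.keys (f + g) \<subseteq> X"
    unfolding X_def using Poly_Mapping.keys_add[of f g] by auto
  then show ?thesis
    by (simp add: free_abelian_ext_superset lookup_add distrib_right sum.distrib)
qed

lemma free_abelian_ext_diff: "free_abelian_ext G (f - g) = free_abelian_ext G f - free_abelian_ext G g"
  using free_abelian_ext_add[of G "f - g" g] by simp

lemma free_abelian_ext_single: "free_abelian_ext G (Poly_Mapping.single x 1) = G x"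
  unfolding free_abelian_ext_def by simp

lemma tensor_eval_eq: "tensor_eval i j = free_abelian_ext (\<lambda>x. i (fst x) * j (snd x))"
  unfolding tensor_eval_def free_abelian_ext_def by (rule refl)

text \<open>
  The universal property of \<open>A \<otimes> B\<close>: the extension of a balanced biadditive map to the free abelian group
  kills the relations, hence the kernel of the evaluation.
\<close>
lemma tensor_lift:
  fixes \<phi> :: "'k::comm_ring_1 \<Rightarrow> 'a::comm_ring_1" and \<psi> :: "'k \<Rightarrow> 'b::comm_ring_1"
    and i :: "'a \<Rightarrow> 'c::comm_ring_1" and j :: "'b \<Rightarrow> 'c" and G :: "'a \<Rightarrow> 'b \<Rightarrow> 'g::comm_ring_1"
  assumes tp: "tensor_product \<phi> \<psi> i j"
    and G: "\<And>a a' b. G (a + a') b = G a b + G a' b" "\<And>a b b'. G a (b + b') = G a b + G a b'"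
      "\<And>c a b. G (\<phi> c * a) b = G a (\<psi> c * b)"
  shows "\<exists>h. (\<forall>x y. h (x + y) = h x + h y) \<and> (\<forall>a b. h (i a * j b) = G a b)"
proof -
  let ?E = "free_abelian_ext (\<lambda>x. G (fst x) (snd x))"
  have kill: "?E f = 0" if "f \<in> group_closure (balanced_relations \<phi> \<psi>)" for f
    using that
  proof induction
    case (base s)
    then show ?case
      by (auto simp: balanced_relations_def Let_def free_abelian_ext_diff free_abelian_ext_single G
          free_abelian_ext_def[of _ 0])
  next
    case (diff s t)
    then show ?case by (simp add: free_abelian_ext_diff)
  qed
  define h where "h x = ?E (SOME f. tensor_eval i j f = x)" for x
  have h: "h (tensor_eval i j f) = ?E f" for f
  proof -
    define g where "g = (SOME g. tensor_eval i j g = tensor_eval i j f)"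
    have "tensor_eval i j g = tensor_eval i j f" unfolding g_def by (rule someI) (rule refl)
    then have "tensor_eval i j (g - f) = 0" by (simp add: tensor_eval_eq free_abelian_ext_diff)
    then have "?E (g - f) = 0" using tp kill unfolding tensor_product_def by blast
    then show ?thesis unfolding h_def g_def[symmetric] by (simp add: free_abelian_ext_diff)
  qed
  have surj: "\<exists>f. x = tensor_eval i j f" for x using tp unfolding tensor_product_def surj_def by blast
  show ?thesis
  proof (intro exI[of _ h] conjI allI)
    fix x y
    obtain f g where "x = tensor_eval i j f" "y = tensor_eval i j g" using surj by blast
    moreover from this have "x + y = tensor_eval i j (f + g)" by (simp add: tensor_eval_eq free_abelian_ext_add)
    ultimately show "h (x + y) = h x + h y" by (simp add: h free_abelian_ext_add)
  next
    fix a b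
    have "i a * j b = tensor_eval i j (Poly_Mapping.single (a, b) 1)"
      by (simp add: tensor_eval_eq free_abelian_ext_single)
    then show "h (i a * j b) = G a b" by (simp add: h free_abelian_ext_single)
  qed
qed

lemma tensor_ext:
  fixes h h' :: "'c::comm_ring_1 \<Rightarrow> 'g::comm_ring_1"
  assumes tp: "tensor_product \<phi> \<psi> i j"
    and add: "\<And>x y. h (x + y) = h x + h y" "\<And>x y. h' (x + y) = h' x + h' y"
    and eq: "\<And>a b. h (i a * j b) = h' (i a * j b)"
  shows "h x = h' x"
proof -
  obtain f where x: "x = tensor_eval i j f" using tp unfolding tensor_product_def surj_def by blast
  show ?thesis unfolding x tensor_eval_def
    by (simp only: additive_sum[of h, OF add(1)] additive_sum[of h', OF add(2)]
        additive_of_int[of h, OF add(1)] additive_of_int[of h', OF add(2)] eq)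
qed

lemma tensor_productD:
  assumes "tensor_product \<phi> \<psi> i j"
  shows "comm_ring_hom i" "comm_ring_hom j" "i (\<phi> c) = j (\<psi> c)"
  using assms unfolding tensor_product_def by auto

text \<open>
  The basis vectors of \<open>A\<close> stay free after base change, because \<open>a \<otimes> b \<mapsto> coordinate of a times b\<close> is
  well defined on the tensor product.  This form of the hypotheses is symmetric enough to serve both
  factors.
\<close>
lemma tensor_basis_aux:
  fixes \<phi> :: "'k::comm_ring_1 \<Rightarrow> 'a::comm_ring_1" and \<psi> :: "'k \<Rightarrow> 'b::comm_ring_1"
    and i :: "'a \<Rightarrow> 'c::comm_ring_1" and j :: "'b \<Rightarrow> 'c"
  assumes hom: "comm_ring_hom \<phi>" "comm_ring_hom i" "comm_ring_hom j" and ij: "\<And>c. i (\<phi> c) = j (\<psi> c)"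
    and \<psi>: "comm_ring_hom \<psi>" and fb: "free_basis \<phi> I b"
    and lift: "\<And>l. l \<in> I \<Longrightarrow> \<exists>h. (\<forall>x y. h (x + y) = h x + h y) \<and> (\<forall>a b'. h (i a * j b') = \<psi> (coord \<phi> I b a l) * b')"
    and ext: "\<And>h x. (\<And>x y. h (x + y) = h x + h y) \<Longrightarrow> (\<And>a b. h (i a * j b) = i a * j b) \<Longrightarrow> h x = (x::'c)"
  shows "free_basis j I (\<lambda>l. i (b l))"
proof -
  interpret i: comm_ring_hom i by fact
  interpret j: comm_ring_hom j by fact
  interpret \<psi>: comm_ring_hom \<psi> by fact
  obtain h where h: "\<And>l x y. l \<in> I \<Longrightarrow> h l (x + y) = h l x + h l y"
    "\<And>l a b'. l \<in> I \<Longrightarrow> h l (i a * j b') = \<psi> (coord \<phi> I b a l) * b'" using lift by metis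
  show ?thesis unfolding free_basis_def
  proof (intro conjI allI impI ballI)
    show "finite I" using free_basisD(1)[OF fb] .
    fix x
    have "(\<Sum>l\<in>I. j (h l x) * i (b l)) = x"
    proof (rule ext)
      fix a b'
      have "i a * j b' = i (\<Sum>l\<in>I. \<phi> (coord \<phi> I b a l) * b l) * j b'" by (simp add: coord_sum[OF fb])
      also have "\<dots> = (\<Sum>l\<in>I. j (h l (i a * j b')) * i (b l))"
        by (simp add: i.hom_sum i.hom_mult sum_distrib_right sum_distrib_left h(2) ij j.hom_mult mult_ac)
      finally show "(\<Sum>l\<in>I. j (h l (i a * j b')) * i (b l)) = i a * j b'" ..
    qed (simp add: h(1) j.hom_add distrib_right sum.distrib)
    then show "\<exists>c. x = (\<Sum>l\<in>I. j (c l) * i (b l))" by (intro exI[of _ "\<lambda>l. h l x"]) simp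
  next
    fix c l assume z: "(\<Sum>l\<in>I. j (c l) * i (b l)) = 0" and l: "l \<in> I"
    have "h l 0 = 0" using h(1)[OF l, of 0 0] by simp
    then have "0 = h l (\<Sum>m\<in>I. i (b m) * j (c m))" using z by (simp add: mult.commute)
    also have "\<dots> = (\<Sum>m\<in>I. \<psi> (coord \<phi> I b (b m) l) * c m)"
      by (simp add: additive_sum[of "h l", OF h(1)[OF l]] h(2)[OF l])
    also have "\<dots> = (\<Sum>m\<in>I. if l = m then c m else 0)"
      by (intro sum.cong) (auto simp: coord_basis[OF hom(1) fb l])
    also have "\<dots> = c l" using l free_basisD(1)[OF fb] by simp
    finally show "c l = 0" by simp
  qed
qed

lemma tensor_basis_left:
  assumes tp: "tensor_product \<phi> \<psi> i j" and hom: "comm_ring_hom \<phi>" "comm_ring_hom \<psi>"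
    and fb: "free_basis \<phi> I b"
  shows "free_basis j I (\<lambda>l. i (b l))"
proof -
  interpret \<psi>: comm_ring_hom \<psi> by fact
  have lift: "\<exists>h. (\<forall>x y. h (x + y) = h x + h y) \<and> (\<forall>a b'. h (i a * j b') = \<psi> (coord \<phi> I b a l) * b')"
    if l: "l \<in> I" for l
    by (rule tensor_lift[OF tp, where G = "\<lambda>a b'. \<psi> (coord \<phi> I b a l) * b'"])
       (simp_all add: coord_add[OF hom(1) fb l] coord_scale[OF hom(1) fb l] \<psi>.hom_add \<psi>.hom_mult
          distrib_left distrib_right mult.assoc mult.left_commute)
  have ext: "h x = x" if h: "\<And>x y. h (x + y) = h x + h y" "\<And>a b. h (i a * j b) = i a * j b" for h x
    by (rule tensor_ext[OF tp]) (rule h refl)+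
  show ?thesis
    by (rule tensor_basis_aux[OF hom(1) tensor_productD[OF tp] hom(2) fb]; (erule lift | rule ext; assumption))
qed

lemma tensor_basis_right:
  assumes tp: "tensor_product \<phi> \<psi> i j" and hom: "comm_ring_hom \<phi>" "comm_ring_hom \<psi>"
    and fb: "free_basis \<psi> I b"
  shows "free_basis i I (\<lambda>l. j (b l))"
proof -
  interpret \<phi>: comm_ring_hom \<phi> by fact
  have lift: "\<exists>h. (\<forall>x y. h (x + y) = h x + h y) \<and> (\<forall>b' a. h (j b' * i a) = \<phi> (coord \<psi> I b b' l) * a)"
    if l: "l \<in> I" for l
  proof -
    have "\<exists>h. (\<forall>x y. h (x + y) = h x + h y) \<and> (\<forall>a b'. h (i a * j b') = a * \<phi> (coord \<psi> I b b' l))"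
      by (rule tensor_lift[OF tp, where G = "\<lambda>a b'. a * \<phi> (coord \<psi> I b b' l)"])
         (simp_all add: coord_add[OF hom(2) fb l] coord_scale[OF hom(2) fb l] \<phi>.hom_add \<phi>.hom_mult
            distrib_left distrib_right mult.assoc mult.left_commute)
    then obtain h where h: "\<And>x y. h (x + y) = h x + h y" "\<And>a b'. h (i a * j b') = a * \<phi> (coord \<psi> I b b' l)"
      by metis
    have "h (j b' * i a) = \<phi> (coord \<psi> I b b' l) * a" for b' a
      unfolding mult.commute[of "j b'" "i a"] h(2) by (rule mult.commute)
    then show ?thesis using h(1) by (intro exI[of _ h]) simp
  qed
  have ext: "h x = x" if h: "\<And>x y. h (x + y) = h x + h y" "\<And>b a. h (j b * i a) = j b * i a" for h x
  proof (rule tensor_ext[OF tp])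
    show "h (i a * j b) = i a * j b" for a b using h(2)[of b a] unfolding mult.commute[of "j b" "i a"] .
  qed (simp_all add: h(1))
  show ?thesis
    by (rule tensor_basis_aux[OF hom(2) tensor_productD(2,1)[OF tp] tensor_productD(3)[OF tp, symmetric] hom(1) fb];
        (erule lift | rule ext; assumption))
qed

text \<open>
  The additive map given by the universal property is multiplicative since it is so on pure tensors.
\<close>
lemma tensor_map:
  assumes tp: "tensor_product \<phi> \<psi> i j"
    and hom: "comm_ring_hom f" "comm_ring_hom g" "comm_ring_hom i'" "comm_ring_hom j'"
    and compat: "\<And>c. i' (f (\<phi> c)) = j' (g (\<psi> c))"
  shows "comm_ring_hom (tensor_map i j i' j' f g)"
    and "tensor_map i j i' j' f g (i a * j b) = i' (f a) * j' (g b)"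
    and "tensor_map i j i' j' f g (i a) = i' (f a)"
    and "tensor_map i j i' j' f g (j b) = j' (g b)"
    and "\<lbrakk>comm_ring_hom h; \<And>a. h (i a) = i' (f a); \<And>b. h (j b) = j' (g b)\<rbrakk>
      \<Longrightarrow> tensor_map i j i' j' f g = h"
proof -
  interpret i: comm_ring_hom i by (rule tensor_productD[OF tp])
  interpret j: comm_ring_hom j by (rule tensor_productD[OF tp])
  interpret f: comm_ring_hom f by fact
  interpret g: comm_ring_hom g by fact
  interpret i': comm_ring_hom i' by fact
  interpret j': comm_ring_hom j' by fact
  have "\<exists>h. (\<forall>x y. h (x + y) = h x + h y) \<and> (\<forall>a b. h (i a * j b) = i' (f a) * j' (g b))"
    by (rule tensor_lift[OF tp, where G = "\<lambda>a b. i' (f a) * j' (g b)"])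
       (simp_all add: f.hom_add g.hom_add i'.hom_add j'.hom_add f.hom_mult g.hom_mult
         i'.hom_mult j'.hom_mult compat distrib_left distrib_right mult_ac)
  then obtain h where h: "\<And>x y. h (x + y) = h x + h y" "\<And>a b. h (i a * j b) = i' (f a) * j' (g b)"
    by blast
  have mult: "h (x * y) = h x * h y" for x y
  proof (rule tensor_ext[OF tp, of "\<lambda>x. h (x * y)" "\<lambda>x. h x * h y"])
    fix a b
    show "h (i a * j b * y) = h (i a * j b) * h y"
    proof (rule tensor_ext[OF tp, of "\<lambda>y. h (i a * j b * y)" "\<lambda>y. h (i a * j b) * h y"])
      fix a' b'
      have "i a * j b * (i a' * j b') = i (a * a') * j (b * b')"
        by (simp add: i.hom_mult j.hom_mult mult_ac)
      then show "h (i a * j b * (i a' * j b')) = h (i a * j b) * h (i a' * j b')"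
        by (simp add: h(2) f.hom_mult g.hom_mult i'.hom_mult j'.hom_mult mult_ac)
    qed (simp_all add: h(1) distrib_left)
  qed (simp_all add: h(1) distrib_right)
  have one: "h 1 = 1" using h(2)[of 1 1] by simp
  have hom: "comm_ring_hom h" by (rule comm_ring_homI) (fact one h(1) mult)+
  let ?P = "\<lambda>h. comm_ring_hom h \<and> (\<forall>a b. h (i a * j b) = i' (f a) * j' (g b))"
  have eq: "h' = h" if "?P h'" for h'
  proof
    fix x
    interpret h': comm_ring_hom h' using that by blast
    show "h' x = h x" by (rule tensor_ext[OF tp]) (use that h in \<open>auto simp: h'.hom_add\<close>)
  qed
  have tm: "tensor_map i j i' j' f g = h"
    unfolding tensor_map_def by (rule the_equality) (use hom h(2) eq in auto)
  show "comm_ring_hom (tensor_map i j i' j' f g)"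
    and "tensor_map i j i' j' f g (i a * j b) = i' (f a) * j' (g b)"
    unfolding tm by (fact hom, fact h(2))
  show "tensor_map i j i' j' f g (i a) = i' (f a)" "tensor_map i j i' j' f g (j b) = j' (g b)"
    unfolding tm using h(2)[of a 1] h(2)[of 1 b] by simp_all
  show "tensor_map i j i' j' f g = h'" if "comm_ring_hom h'" "\<And>a. h' (i a) = i' (f a)" "\<And>b. h' (j b) = j' (g b)" for h'
  proof -
    interpret h': comm_ring_hom h' by fact
    show ?thesis unfolding tm using eq[of h'] that by (simp add: h'.hom_mult h'.comm_ring_hom_axioms)
  qed
qed

section \<open>Towers of free extensions\<close>

lemma tower_sum:
  assumes "comm_ring_hom \<psi>"
  shows "(\<Sum>x\<in>I \<times> J. (\<psi> \<circ> \<phi>) (d x) * (case x of (l, m) \<Rightarrow> b l * \<psi> (c m)))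
      = (\<Sum>l\<in>I. \<psi> (\<Sum>m\<in>J. \<phi> (d (l, m)) * c m) * b l)"
proof -
  interpret \<psi>: comm_ring_hom \<psi> by fact
  have "(\<Sum>x\<in>I \<times> J. (\<psi> \<circ> \<phi>) (d x) * (case x of (l, m) \<Rightarrow> b l * \<psi> (c m)))
      = (\<Sum>(l, m)\<in>I \<times> J. \<psi> (\<phi> (d (l, m))) * (b l * \<psi> (c m)))" by (rule sum.cong) auto
  also have "\<dots> = (\<Sum>l\<in>I. \<Sum>m\<in>J. \<psi> (\<phi> (d (l, m))) * (b l * \<psi> (c m)))"
    by (rule sum.cartesian_product[symmetric])
  finally show ?thesis by (simp add: \<psi>.hom_sum \<psi>.hom_mult sum_distrib_right sum_distrib_left mult_ac)
qed

lemma free_basis_tower: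
  assumes hom: "comm_ring_hom \<phi>" "comm_ring_hom \<psi>"
    and b: "free_basis \<psi> I b" and c: "free_basis \<phi> J c"
  shows "free_basis (\<psi> \<circ> \<phi>) (I \<times> J) (\<lambda>(l, m). b l * \<psi> (c m))"
proof -
  interpret \<psi>: comm_ring_hom \<psi> by fact
  have fin: "finite I" "finite J" using free_basisD(1) b c by auto
  note e = tower_sum[OF hom(2)]
  show ?thesis unfolding free_basis_def e
  proof (intro conjI allI impI)
    show "finite (I \<times> J)" using fin by simp
    fix x
    have "x = (\<Sum>l\<in>I. \<psi> (\<Sum>m\<in>J. \<phi> (coord \<phi> J c (coord \<psi> I b x l) m) * c m) * b l)"
      by (simp add: coord_sum[OF b] coord_sum[OF c])
    then show "\<exists>d. x = (\<Sum>l\<in>I. \<psi> (\<Sum>m\<in>J. \<phi> (d (l, m)) * c m) * b l)"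
      by (intro exI[of _ "\<lambda>(l, m). coord \<phi> J c (coord \<psi> I b x l) m"]) simp
  next
    fix d assume "(\<Sum>l\<in>I. \<psi> (\<Sum>m\<in>J. \<phi> (d (l, m)) * c m) * b l) = 0"
    from free_basisD(3)[OF b this] have "(\<Sum>m\<in>J. \<phi> (d (l, m)) * c m) = 0" if "l \<in> I" for l using that by simp
    from free_basisD(3)[OF c this] show "\<forall>x\<in>I \<times> J. d x = 0" by auto
  qed
qed

text \<open>
  This gives a basis over a ring such as \<open>K \<otimes> S\<close> from bases over the field \<open>S\<close>.
\<close>
lemma free_basis_tower_cancel:
  assumes hom: "comm_ring_hom \<phi>" "comm_ring_hom \<psi>"
    and bc: "free_basis (\<psi> \<circ> \<phi>) (I \<times> J) (\<lambda>(l, m). b l * \<psi> (c m))" and c: "free_basis \<phi> J c"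
    and fin: "finite I"
  shows "free_basis \<psi> I b"
proof -
  interpret \<psi>: comm_ring_hom \<psi> by fact
  interpret \<phi>: comm_ring_hom \<phi> by fact
  note e = tower_sum[OF hom(2)]
  show ?thesis unfolding free_basis_def
  proof (intro conjI allI impI ballI fin)
    fix x
    obtain d where "x = (\<Sum>l\<in>I. \<psi> (\<Sum>m\<in>J. \<phi> (d (l, m)) * c m) * b l)"
      using free_basisD(2)[OF bc, of x] unfolding e by blast
    then show "\<exists>d. x = (\<Sum>l\<in>I. \<psi> (d l) * b l)"
      by (intro exI[of _ "\<lambda>l. \<Sum>m\<in>J. \<phi> (d (l, m)) * c m"])
  next
    fix d l assume z: "(\<Sum>l\<in>I. \<psi> (d l) * b l) = 0" and l: "l \<in> I"
    have "(\<Sum>l\<in>I. \<psi> (\<Sum>m\<in>J. \<phi> (coord \<phi> J c (d l) m) * c m) * b l) = 0"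
      using z by (simp add: coord_sum[OF c])
    then have *: "coord \<phi> J c (d l) m = 0" if "m \<in> J" for m
      using free_basisD(3)[OF bc, of "\<lambda>(l, m). coord \<phi> J c (d l) m" "(l, m)"] l that
      unfolding e by simp
    have "d l = (\<Sum>m\<in>J. \<phi> (coord \<phi> J c (d l) m) * c m)" by (simp add: coord_sum[OF c])
    also have "\<dots> = 0" by (intro sum.neutral) (simp add: *)
    finally show "d l = 0" .
  qed
qed

section \<open>Etale algebras\<close>

lemma etale_hom: "etale \<phi> \<Longrightarrow> comm_ring_hom \<phi>" unfolding etale_def by blast

text \<open>
  A product of fields is von Neumann regular: invert each non-zero component of \<open>x\<close> in its field
  \<open>e A\<close>.
\<close>
lemma etale_regular:
  fixes \<phi> :: "'k::field \<Rightarrow> 'a::comm_ring_1" and x :: 'a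
  assumes "etale \<phi>"
  obtains y where "x * x * y = x"
proof -
  obtain I where I0: "finite I \<and> (\<Sum>e\<in>I. e) = 1 \<and> (\<forall>e\<in>I. \<forall>f\<in>I. e * f = (if e = f then e else 0)) \<and>
      (\<forall>e\<in>I. e \<noteq> 0 \<and> (\<forall>x. e * x \<noteq> 0 \<longrightarrow> (\<exists>y. (e * x) * (e * y) = e)) \<and>
         (\<forall>x. \<exists>p. separable_poly p \<and> poly (map_poly (\<lambda>c. \<phi> c * e) p) (e * x) = 0))"
    by (rule exE[OF assms[unfolded etale_def, THEN conjunct2, THEN conjunct2]])
  have I: "finite I" "(\<Sum>e\<in>I. e) = 1" "e \<in> I \<Longrightarrow> f \<in> I \<Longrightarrow> e * f = (if e = f then e else 0)"
    "e \<in> I \<Longrightarrow> e * x \<noteq> 0 \<Longrightarrow> \<exists>y. (e * x) * (e * y) = e" for e f x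
    using I0 by simp_all
  have "\<forall>e. \<exists>y. e \<in> I \<longrightarrow> e * x \<noteq> 0 \<longrightarrow> (e * x) * (e * y) = e" using I(4) by blast
  then obtain y where y: "\<And>e. e \<in> I \<Longrightarrow> e * x \<noteq> 0 \<Longrightarrow> (e * x) * (e * y e) = e" by metis
  define z where "z = (\<Sum>e\<in>I. e * y e)"
  have ez: "e * z = e * y e" if "e \<in> I" for e
  proof -
    have "e * z = (\<Sum>f\<in>I. if e = f then e * y f else 0)"
      unfolding z_def sum_distrib_left using I(3)[OF that]
      by (intro sum.cong) (auto simp: mult.assoc[symmetric])
    then show ?thesis using that I(1) by simp
  qed
  have "e * (x * x * z) = e * x" if "e \<in> I" for e
  proof (cases "e * x = 0")
    case True then show ?thesis by (simp add: mult.assoc[symmetric])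
  next
    case False
    have ee: "e * e = e" using I(3)[OF that that] by simp
    have "e * (x * x * z) = x * ((e * x) * (e * z))" using ee by (simp add: mult_ac) (metis ee mult.assoc mult.commute)
    also have "\<dots> = x * e" using y[OF that False] ez[OF that] by simp
    finally show ?thesis by (simp add: mult.commute)
  qed
  then have "(\<Sum>e\<in>I. e * (x * x * z)) = (\<Sum>e\<in>I. e * x)" by (intro sum.cong) auto
  then have "x * x * z = x" unfolding sum_distrib_right[symmetric] I(2) by simp
  then show thesis by (rule that)
qed

lemma free_basis_of_dim:
  fixes \<phi> :: "'k::field \<Rightarrow> 'a::comm_ring_1"
  assumes hom: "comm_ring_hom \<phi>" and dim: "vector_space.dim (alg_scale \<phi>) UNIV = n" and n: "n \<noteq> 0"
  obtains b where "free_basis \<phi> {..<n} b"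
proof -
  interpret V: vector_space "alg_scale \<phi>" by (rule vector_space_alg_scale[OF hom])
  obtain B where B: "V.independent B" "UNIV \<subseteq> V.span B" "card B = n"
    using V.basis_exists[of UNIV] dim by metis
  have fin: "finite B" using B(3) n card.infinite by fastforce
  have "free_basis \<phi> B id" using B by (intro free_basis_set[OF hom fin]) auto
  moreover obtain h where "bij_betw h {..<n} B"
    using ex_bij_betw_nat_finite[OF fin] B(3) by (auto simp: atLeast0LessThan)
  ultimately show thesis using that free_basis_reindex by blast
qed

lemma quadratic_basis:
  fixes \<phi> :: "'k::field \<Rightarrow> 'a::comm_ring_1"
  assumes hom: "comm_ring_hom \<phi>" and dim: "vector_space.dim (alg_scale \<phi>) UNIV = 2"
    and \<theta>: "\<theta> \<notin> range \<phi>"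
  shows "free_basis \<phi> {..<2::nat} (\<lambda>i. if i = 0 then 1 else \<theta>)"
proof -
  interpret comm_ring_hom \<phi> by fact
  interpret V: vector_space "alg_scale \<phi>" by (rule vector_space_alg_scale[OF hom])
  obtain B where B: "V.independent B" "UNIV \<subseteq> V.span B" "card B = 2"
    using V.basis_exists[of UNIV] dim by metis
  have fin: "finite B" using B(3) card.infinite by fastforce
  interpret F: finite_dimensional_vector_space "alg_scale \<phi>" B
    by unfold_locales (use B fin in auto)
  have ne: "\<theta> \<noteq> 1" using \<theta> hom_one by (metis rangeI)
  have ind: "V.independent {1, \<theta>}"
  proof (rule V.independent_if_scalars_zero)
    show "finite {1, \<theta>}" by simp
    fix f x assume z: "(\<Sum>x\<in>{1, \<theta>}. alg_scale \<phi> (f x) x) = 0" and x: "x \<in> {1, \<theta>}"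
    have z: "\<phi> (f 1) + \<phi> (f \<theta>) * \<theta> = 0" using z ne by (simp add: alg_scale_def)
    have "f \<theta> = 0"
    proof (rule ccontr)
      assume n: "f \<theta> \<noteq> 0"
      then have "\<phi> (inverse (f \<theta>)) * \<phi> (f \<theta>) = 1" by (metis hom_mult hom_one left_inverse)
      then have "\<theta> = \<phi> (inverse (f \<theta>)) * (\<phi> (f \<theta>) * \<theta>)" by (simp add: mult.assoc[symmetric])
      also have "\<phi> (f \<theta>) * \<theta> = - \<phi> (f 1)" using z by (simp add: eq_neg_iff_add_eq_0 add.commute)
      finally have "\<theta> = \<phi> (inverse (f \<theta>) * (- f 1))" by (simp add: hom_mult hom_uminus)
      then show False using \<theta> by blast
    qed
    moreover from this z have "\<phi> (f 1) = 0" by simp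
    then have "f 1 = 0" by (simp add: field_hom_eq_0_iff[OF hom])
    ultimately show "f x = 0" using x by auto
  qed
  have "UNIV \<subseteq> V.span {1, \<theta>}"
    by (rule F.card_ge_dim_independent) (use ind dim ne in auto)
  then have "free_basis \<phi> {1, \<theta>} id" using ind by (intro free_basis_set[OF hom]) auto
  moreover have "bij_betw (\<lambda>i. if i = 0 then 1 else \<theta>) {..<2::nat} {1, \<theta>}"
    using ne by (auto simp: bij_betw_def inj_on_def less_2_cases_iff image_def)
  ultimately show ?thesis using free_basis_reindex[of "\<lambda>i. if i = 0 then 1 else \<theta>" "{..<2::nat}" "{1, \<theta>}" \<phi> id]
    unfolding o_def id_def by blast
qed

text \<open>
  Complete the square in the minimal polynomial of an element \<open>\<kappa>\<close> moved by \<open>\<iota>\<close>.  That the resulting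
  \<open>d\<close> is not \<open>0\<close> uses that there are no nilpotent elements.  The equation \<open>(\<iota> \<theta>)\<^sup>2 = d\<close> leaves only
  \<open>\<iota> \<theta> = \<theta>\<close> and \<open>\<iota> \<theta> = - \<theta>\<close>, and \<open>\<iota>\<close> moves \<open>\<kappa>\<close>.
\<close>
lemma quadratic_etale_generator:
  fixes \<phi> :: "'k::field \<Rightarrow> 'a::comm_ring_1"
  assumes et: "etale \<phi>" and dim: "vector_space.dim (alg_scale \<phi>) UNIV = 2"
    and two: "(2::'k) \<noteq> 0" and aut: "nontrivial_automorphism \<phi> \<iota>"
  obtains \<theta> d where "free_basis \<phi> {..<2::nat} (\<lambda>i. if i = 0 then 1 else \<theta>)"
    "\<theta> * \<theta> = \<phi> d" "d \<noteq> 0" "\<iota> \<theta> = - \<theta>"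
proof -
  have hom: "comm_ring_hom \<phi>" by (rule etale_hom[OF et])
  interpret comm_ring_hom \<phi> by fact
  interpret \<iota>: comm_ring_hom \<iota> using aut unfolding nontrivial_automorphism_def by blast
  have \<iota>\<phi>: "\<iota> (\<phi> c) = \<phi> c" for c using aut unfolding nontrivial_automorphism_def by blast
  have inj: "inj \<iota>" using aut unfolding nontrivial_automorphism_def bij_def by blast
  obtain \<kappa> where \<kappa>: "\<iota> \<kappa> \<noteq> \<kappa>" using aut unfolding nontrivial_automorphism_def by fastforce
  have s2: "(\<Sum>i<2. f i) = f 0 + f (1::nat)" for f :: "nat \<Rightarrow> 'a" by (simp add: numeral_2_eq_2)
  have rep: "\<exists>p q. x = \<phi> p + \<phi> q * t" if t: "t \<notin> range \<phi>" for x t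
  proof -
    obtain c where "x = (\<Sum>i<2. \<phi> (c i) * (if i = (0::nat) then 1 else t))"
      using free_basisD(2)[OF quadratic_basis[OF hom dim t]] by blast
    then show ?thesis by (auto simp: s2)
  qed
  have uniq: "p = 0 \<and> q = 0" if t: "t \<notin> range \<phi>" and z: "\<phi> p + \<phi> q * t = 0" for p q t
  proof -
    have "(\<Sum>i<2. \<phi> ((\<lambda>i. if i = 0 then p else q) i) * (if i = (0::nat) then 1 else t)) = 0"
      using z by (simp add: s2)
    from free_basisD(3)[OF quadratic_basis[OF hom dim t] this, of 0]
      free_basisD(3)[OF quadratic_basis[OF hom dim t] this, of 1]
    show ?thesis by simp
  qed
  have \<kappa>r: "\<kappa> \<notin> range \<phi>" using \<kappa> \<iota>\<phi> by auto
  obtain p q where pq: "\<kappa> * \<kappa> = \<phi> p + \<phi> q * \<kappa>" using rep[OF \<kappa>r] by blast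
  define h where "h = q / 2"
  define \<theta> where "\<theta> = \<kappa> - \<phi> h"
  define d where "d = p + h * h"
  have q2: "\<phi> q = \<phi> h + \<phi> h" using two by (simp add: h_def hom_add[symmetric])
  have \<theta>2: "\<theta> * \<theta> = \<phi> d"
  proof -
    have "\<theta> * \<theta> = \<kappa> * \<kappa> - (\<phi> h + \<phi> h) * \<kappa> + \<phi> h * \<phi> h"
      unfolding \<theta>_def by (simp add: algebra_simps)
    also have "\<dots> = \<phi> d" unfolding pq q2 d_def by (simp add: hom_add hom_mult)
    finally show ?thesis .
  qed
  have \<theta>r: "\<theta> \<notin> range \<phi>"
  proof
    assume "\<theta> \<in> range \<phi>"
    then obtain c where "\<theta> = \<phi> c" by auto
    then have "\<kappa> = \<phi> (c + h)" unfolding \<theta>_def by (simp add: hom_add algebra_simps)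
    then show False using \<kappa>r by blast
  qed
  have d0: "d \<noteq> 0"
  proof
    assume "d = 0"
    then have "\<theta> * \<theta> = 0" using \<theta>2 by simp
    moreover obtain y where "\<theta> * \<theta> * y = \<theta>" using etale_regular[OF et] by blast
    ultimately have "\<theta> = \<phi> 0" by simp
    then show False using \<theta>r by blast
  qed
  obtain r s where rs: "\<iota> \<theta> = \<phi> r + \<phi> s * \<theta>" using rep[OF \<theta>r] by blast
  have "\<iota> \<theta> * \<iota> \<theta> = \<phi> d" using \<theta>2 \<iota>\<phi> by (metis \<iota>.hom_mult)
  moreover have "\<iota> \<theta> * \<iota> \<theta> = \<phi> (r * r + s * s * d) + \<phi> (2 * r * s) * \<theta>"
  proof -
    have "\<iota> \<theta> * \<iota> \<theta> = \<phi> r * \<phi> r + \<phi> s * \<phi> s * (\<theta> * \<theta>) + 2 * \<phi> r * \<phi> s * \<theta>"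
      unfolding rs by (simp add: algebra_simps)
    then show ?thesis unfolding \<theta>2 by (simp add: hom_add hom_mult hom_numeral mult_ac)
  qed
  ultimately have "\<phi> (r * r + s * s * d - d) + \<phi> (2 * r * s) * \<theta> = 0" by (simp add: hom_minus hom_add algebra_simps)
  from uniq[OF \<theta>r this] have e: "r * r + s * s * d = d" "r * s = 0" using two by auto
  have s0: "s \<noteq> 0"
  proof
    assume "s = 0"
    then have "\<iota> \<theta> = \<iota> (\<phi> r)" using rs \<iota>\<phi> by simp
    then have "\<theta> = \<phi> r" using inj by (simp add: inj_eq)
    then show False using \<theta>r by blast
  qed
  then have r0: "r = 0" using e by simp
  then have "(s - 1) * (s + 1) = 0" using e(1) d0 by (simp add: algebra_simps)
  moreover have "s \<noteq> 1"
  proof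
    assume "s = 1"
    then have i\<theta>: "\<iota> \<theta> = \<theta>" using rs r0 by simp
    have "\<kappa> = \<theta> + \<phi> h" unfolding \<theta>_def by simp
    then have "\<iota> \<kappa> = \<kappa>" using i\<theta> \<iota>\<phi> by (simp add: \<iota>.hom_add)
    then show False using \<kappa> by simp
  qed
  ultimately have "s + 1 = 0" by simp
  then have "s = - 1" by (rule eq_neg_iff_add_eq_0[THEN iffD2])
  then have "\<iota> \<theta> = - \<theta>" using rs r0 by (simp add: hom_uminus)
  then show thesis using that quadratic_basis[OF hom dim \<theta>r] \<theta>2 d0 by blast
qed

section \<open>Separable closures and their automorphisms\<close>

text \<open>
  A non-zero element of least degree in the ideal generated by \<open>p\<close> and \<open>q\<close> divides both.
\<close>
lemma coprime_field_poly_bezout: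
  fixes p q :: "'a::field poly"
  assumes "coprime p q"
  obtains a b where "a * p + b * q = 1"
proof -
  define I where "I = {a * p + b * q | a b. True}"
  have I: "u * x + v * y \<in> I" if xy: "x \<in> I" "y \<in> I" for u v x y
  proof -
    obtain a b a' b' where "x = a * p + b * q" "y = a' * p + b' * q" using xy unfolding I_def by blast
    then have "u * x + v * y = (u * a + v * a') * p + (u * b + v * b') * q" by (simp add: algebra_simps)
    then show ?thesis unfolding I_def by blast
  qed
  have "p = 1 * p + 0 * q" "q = 0 * p + 1 * q" by simp_all
  then have pq: "p \<in> I" "q \<in> I" unfolding I_def by blast+
  have "p \<noteq> 0 \<or> q \<noteq> 0" using assms by auto
  then have "\<exists>d. d \<in> I \<and> d \<noteq> 0" using pq by blast
  then obtain d where d: "d \<in> I" "d \<noteq> 0" and min: "\<And>e. e \<in> I \<Longrightarrow> e \<noteq> 0 \<Longrightarrow> degree d \<le> degree e"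
    using ex_has_least_nat[of "\<lambda>d. d \<in> I \<and> d \<noteq> 0" _ degree] by blast
  have dvd: "d dvd x" if "x \<in> I" for x
  proof -
    have "x mod d = 1 * x + (- (x div d)) * d" by (simp add: minus_div_mult_eq_mod)
    then have "x mod d \<in> I" using I[OF that d(1)] by metis
    then have "x mod d = 0" using min[of "x mod d"] degree_mod_less[OF d(2), of x] by fastforce
    then show ?thesis by (rule mod_0_imp_dvd)
  qed
  have "is_unit d" using assms dvd pq by (meson coprime_def)
  then obtain e where "1 = d * e" by (rule dvdE)
  moreover obtain a b where "d = a * p + b * q" using d(1) unfolding I_def by blast
  ultimately have "(e * a) * p + (e * b) * q = 1" by (simp add: algebra_simps)
  then show thesis by (rule that)
qed

lemma separable_dvd:
  fixes p q :: "'a::field poly"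
  assumes "separable_poly p" "q dvd p"
  shows "separable_poly q"
proof -
  obtain r where r: "p = q * r" using assms(2) by (rule dvdE)
  obtain a b where "a * p + b * pderiv p = 1"
    using coprime_field_poly_bezout assms(1) unfolding separable_poly_def by blast
  then have 1: "(a * r + b * pderiv r) * q + (b * r) * pderiv q = 1"
    unfolding r pderiv_mult by (simp add: algebra_simps)
  show ?thesis unfolding separable_poly_def
  proof (rule coprimeI)
    fix c assume "c dvd q" "c dvd pderiv q"
    then have "c dvd (a * r + b * pderiv r) * q + (b * r) * pderiv q" by simp
    then show "is_unit c" unfolding 1 .
  qed
qed

context
  fixes \<phi> :: "'k::field \<Rightarrow> 's::field"
  assumes \<phi>: "comm_ring_hom \<phi>"
begin

interpretation comm_ring_hom \<phi> by (rule \<phi>)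

lemma coeff_map_poly_hom: "coeff (map_poly \<phi> p) i = \<phi> (coeff p i)"
  by (simp add: coeff_map_poly)

lemma map_poly_hom_add: "map_poly \<phi> (p + q) = map_poly \<phi> p + map_poly \<phi> q"
  by (rule poly_eqI) (simp add: coeff_map_poly_hom hom_add)

lemma map_poly_hom_mult: "map_poly \<phi> (p * q) = map_poly \<phi> p * map_poly \<phi> q"
  by (rule poly_eqI) (simp add: coeff_map_poly_hom coeff_mult hom_sum hom_mult)

lemma map_poly_hom_one: "map_poly \<phi> 1 = 1"
  by (rule poly_eqI) (simp add: coeff_map_poly_hom coeff_1)

lemma map_poly_hom_pderiv: "map_poly \<phi> (pderiv p) = pderiv (map_poly \<phi> p)"
  by (rule poly_eqI) (simp add: coeff_map_poly_hom coeff_pderiv hom_mult hom_add hom_of_nat)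

lemma map_poly_hom_eq_0: "map_poly \<phi> p = 0 \<longleftrightarrow> p = 0"
  by (simp add: poly_eq_iff coeff_map_poly_hom field_hom_eq_0_iff[OF \<phi>])

lemma map_poly_hom_pCons: "map_poly \<phi> (pCons c p) = pCons (\<phi> c) (map_poly \<phi> p)"
  by (rule poly_eqI) (simp add: coeff_map_poly_hom coeff_pCons split: nat.split)

lemma separable_map_poly:
  assumes "separable_poly p"
  shows "separable_poly (map_poly \<phi> p)"
proof -
  obtain a b where "a * p + b * pderiv p = 1"
    using coprime_field_poly_bezout assms(1) unfolding separable_poly_def by blast
  from arg_cong[OF this, of "map_poly \<phi>"]
  have 1: "map_poly \<phi> a * map_poly \<phi> p + map_poly \<phi> b * pderiv (map_poly \<phi> p) = 1"
    by (simp add: map_poly_hom_add map_poly_hom_mult map_poly_hom_one map_poly_hom_pderiv)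
  show ?thesis unfolding separable_poly_def
  proof (rule coprimeI)
    fix c assume "c dvd map_poly \<phi> p" "c dvd pderiv (map_poly \<phi> p)"
    then have "c dvd map_poly \<phi> a * map_poly \<phi> p + map_poly \<phi> b * pderiv (map_poly \<phi> p)" by simp
    then show "is_unit c" unfolding 1 .
  qed
qed

lemma separable_nonzero: "separable_poly (p :: 'a::field poly) \<Longrightarrow> p \<noteq> 0"
  unfolding separable_poly_def by auto

text \<open>
  A polynomial \<open>c + X q\<close> of least degree that vanishes at \<open>a\<close> has \<open>c \<noteq> 0\<close>, and then \<open>a\<inverse> = - q(a) / c\<close>.
\<close>
lemma algebraic_inverse:
  assumes "p \<noteq> 0" "poly (map_poly \<phi> p) a = 0" "a \<noteq> 0"
  obtains q where "a * poly (map_poly \<phi> q) a = 1"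
proof -
  let ?P = "\<lambda>p. p \<noteq> 0 \<and> poly (map_poly \<phi> p) a = 0"
  obtain r where r: "?P r" and min: "\<And>e. ?P e \<Longrightarrow> degree r \<le> degree e"
    using ex_has_least_nat[of ?P p degree] assms(1,2) by blast
  obtain c q where cq: "r = pCons c q" by (cases r)
  have e: "\<phi> c + a * poly (map_poly \<phi> q) a = 0" using r unfolding cq map_poly_hom_pCons by simp
  have c: "c \<noteq> 0"
  proof
    assume c0: "c = 0"
    then have "?P q" using r e assms(3) cq by auto
    then have "degree r \<le> degree q" "q \<noteq> 0" using min by auto
    then show False unfolding cq by simp
  qed
  have "a * poly (map_poly \<phi> (Polynomial.smult (- inverse c) q)) a = 1"
  proof -
    have "map_poly \<phi> (Polynomial.smult (- inverse c) q) = Polynomial.smult (- inverse (\<phi> c)) (map_poly \<phi> q)"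
    proof -
      have "\<phi> (inverse c) = inverse (\<phi> c)" using c
        by (metis hom_mult hom_one inverse_unique right_inverse)
      then show ?thesis by (intro poly_eqI) (simp add: coeff_map_poly_hom hom_mult hom_uminus)
    qed
    then have 1: "a * poly (map_poly \<phi> (Polynomial.smult (- inverse c) q)) a
        = - inverse (\<phi> c) * (a * poly (map_poly \<phi> q) a)"
      by (simp only: poly_smult mult.left_commute)
    have 2: "a * poly (map_poly \<phi> q) a = - \<phi> c"
      using e by (simp add: eq_neg_iff_add_eq_0 add.commute)
    show ?thesis unfolding 1 2 using c by (simp add: field_hom_eq_0_iff[OF \<phi>])
  qed
  then show thesis by (rule that)
qed

text \<open>
  The graph of a homomorphism over \<open>k\<close> from a subring of \<open>S\<close> to \<open>S\<close>.  As a set of pairs it can be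
  enlarged by Zorn's lemma.  Since \<open>S\<close> is algebraic over \<open>k\<close>, its domain is a field and it is injective
  without further conditions (\<open>ph_inverse\<close>).
\<close>
definition partial_hom :: "('s \<times> 's) set \<Rightarrow> bool" where
  "partial_hom G \<longleftrightarrow> (\<forall>c. (\<phi> c, \<phi> c) \<in> G) \<and>
     (\<forall>a b c d. (a, b) \<in> G \<longrightarrow> (c, d) \<in> G \<longrightarrow> (a + c, b + d) \<in> G \<and> (a * c, b * d) \<in> G) \<and>
     (\<forall>b. (0, b) \<in> G \<longrightarrow> b = 0)"

text \<open>
  Pairs of a polynomial over the domain of \<open>G\<close> and its image under the homomorphism.
\<close>
definition poly_pairs :: "('s \<times> 's) set \<Rightarrow> ('s poly \<times> 's poly) set" where
  "poly_pairs G = {(A, B). \<forall>i. (coeff A i, coeff B i) \<in> G}"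

context
  fixes G assumes G: "partial_hom G"
begin

lemma ph_const: "(\<phi> k, \<phi> k) \<in> G"
  and ph_add: "(a, b) \<in> G \<Longrightarrow> (c, d) \<in> G \<Longrightarrow> (a + c, b + d) \<in> G"
  and ph_mult: "(a, b) \<in> G \<Longrightarrow> (c, d) \<in> G \<Longrightarrow> (a * c, b * d) \<in> G"
  and ph_zero: "(0, b) \<in> G \<Longrightarrow> b = 0"
  using G unfolding partial_hom_def by blast+

lemma ph_0: "(0, 0) \<in> G" and ph_1: "(1, 1) \<in> G"
  using ph_const[of 0] ph_const[of 1] by simp_all

lemma ph_uminus: "(a, b) \<in> G \<Longrightarrow> (- a, - b) \<in> G"
  using ph_mult[OF ph_const[of "-1"], of a b] by (simp add: hom_uminus)

lemma ph_diff: "(a, b) \<in> G \<Longrightarrow> (c, d) \<in> G \<Longrightarrow> (a - c, b - d) \<in> G"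
  using ph_add[OF _ ph_uminus, of a b c d] by simp

lemma ph_unique: "(a, b) \<in> G \<Longrightarrow> (a, b') \<in> G \<Longrightarrow> b = b'"
  using ph_zero[of "b - b'"] ph_diff[of a b a b'] by simp

lemma ph_sum: "(\<And>x. x \<in> X \<Longrightarrow> (f x, g x) \<in> G) \<Longrightarrow> (sum f X, sum g X) \<in> G"
  by (induction X rule: infinite_finite_induct) (auto simp: ph_0 intro: ph_add)

lemma ph_poly: "(a, b) \<in> G \<Longrightarrow> (poly (map_poly \<phi> q) a, poly (map_poly \<phi> q) b) \<in> G"
  by (induction q) (auto simp: ph_0 map_poly_hom_pCons intro!: ph_add ph_const ph_mult)

lemma pp_add: "(A, B) \<in> poly_pairs G \<Longrightarrow> (C, D) \<in> poly_pairs G \<Longrightarrow> (A + C, B + D) \<in> poly_pairs G"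
  unfolding poly_pairs_def by (simp add: ph_add)

lemma pp_diff: "(A, B) \<in> poly_pairs G \<Longrightarrow> (C, D) \<in> poly_pairs G \<Longrightarrow> (A - C, B - D) \<in> poly_pairs G"
  unfolding poly_pairs_def by (simp add: ph_diff)

lemma pp_mult: "(A, B) \<in> poly_pairs G \<Longrightarrow> (C, D) \<in> poly_pairs G \<Longrightarrow> (A * C, B * D) \<in> poly_pairs G"
  unfolding poly_pairs_def by (auto simp: coeff_mult intro!: ph_sum ph_mult)

lemma pp_monom: "(a, b) \<in> G \<Longrightarrow> (monom a n, monom b n) \<in> poly_pairs G"
  unfolding poly_pairs_def by (simp add: ph_0)

lemma pp_0: "(0, 0) \<in> poly_pairs G"
  unfolding poly_pairs_def by (simp add: ph_0)

lemma pp_map: "(map_poly \<phi> p, map_poly \<phi> p) \<in> poly_pairs G"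
  unfolding poly_pairs_def by (simp add: coeff_map_poly_hom ph_const)

end

context
  assumes sc: "separable_closure \<phi>"
begin

lemma sc_algebraic:
  obtains p where "separable_poly p" "p \<noteq> 0" "poly (map_poly \<phi> p) x = 0"
  using sc separable_nonzero unfolding separable_closure_def by blast

context
  fixes G assumes G: "partial_hom G"
begin

lemmas G_mult = ph_mult[OF G] and G_const = ph_const[OF G] and G_zero = ph_zero[OF G]

lemma ph_inverse:
  assumes "(a, b) \<in> G" "a \<noteq> 0"
  shows "(inverse a, inverse b) \<in> G" "b \<noteq> 0"
proof -
  obtain p where p: "p \<noteq> 0" "poly (map_poly \<phi> p) a = 0" using sc_algebraic by blast
  obtain q where q: "a * poly (map_poly \<phi> q) a = 1" by (rule algebraic_inverse[OF p assms(2)])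
  have 1: "(poly (map_poly \<phi> q) a, poly (map_poly \<phi> q) b) \<in> G" by (rule ph_poly[OF G assms(1)])
  have "(1, b * poly (map_poly \<phi> q) b) \<in> G" using G_mult[OF assms(1) 1] q by simp
  then have b: "b * poly (map_poly \<phi> q) b = 1" using ph_unique[OF G _ ph_1[OF G]] by blast
  then show "b \<noteq> 0" by auto
  show "(inverse a, inverse b) \<in> G" using 1 inverse_unique[OF q] inverse_unique[OF b] by simp
qed

lemma pp_degree:
  assumes "(A, B) \<in> poly_pairs G"
  shows "degree A = degree B" "A = 0 \<longleftrightarrow> B = 0"
proof -
  have c: "coeff A i = 0 \<longleftrightarrow> coeff B i = 0" for i
  proof -
    have AB: "(coeff A i, coeff B i) \<in> G" using assms unfolding poly_pairs_def by simp
    show ?thesis using G_zero[of "coeff B i"] ph_inverse(2)[OF AB] AB by (cases "coeff A i = 0") auto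
  qed
  then show "A = 0 \<longleftrightarrow> B = 0" by (simp add: poly_eq_iff)
  show "degree A = degree B" unfolding degree_def c ..
qed

lemma pp_division:
  assumes P: "(P, Q) \<in> poly_pairs G" "P \<noteq> 0" and "(A, B) \<in> poly_pairs G"
  shows "\<exists>C D R R'. (C, D) \<in> poly_pairs G \<and> (R, R') \<in> poly_pairs G \<and> A = P * C + R \<and> B = Q * D + R' \<and>
    (R = 0 \<or> degree R < degree P)"
  using assms(3)
proof (induction "degree A" arbitrary: A B rule: less_induct)
  case less
  show ?case
  proof (cases "A = 0 \<or> degree A < degree P")
    case True
    then show ?thesis using less.prems pp_0[OF G] by (intro exI[of _ 0] exI[of _ A] exI[of _ B]) auto
  next
    case False
    define n where "n = degree A - degree P"
    have lcG: "(lead_coeff P, lead_coeff Q) \<in> G" "(lead_coeff A, lead_coeff B) \<in> G"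
      using P less.prems pp_degree[OF P(1)] pp_degree[OF less.prems] unfolding poly_pairs_def by auto
    have lcP: "lead_coeff P \<noteq> 0" using P(2) by simp
    define a b where "a = lead_coeff A * inverse (lead_coeff P)" and "b = lead_coeff B * inverse (lead_coeff Q)"
    have ab: "(a, b) \<in> G" unfolding a_def b_def using lcG ph_inverse[OF lcG(1) lcP] G_mult by blast
    define A' B' where "A' = A - P * monom a n" and "B' = B - Q * monom b n"
    have AB': "(A', B') \<in> poly_pairs G" unfolding A'_def B'_def
      by (intro pp_diff[OF G less.prems] pp_mult[OF G P(1)] pp_monom[OF G ab])
    have a0: "a \<noteq> 0" using False lcP unfolding a_def by simp
    have dm: "degree (monom a n) = n" "lead_coeff (monom a n) = a" using a0 by (simp_all add: degree_monom_eq)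
    have "degree (P * monom a n) = degree A"
    proof -
      have "degree (P * monom a n) = degree P + degree (monom a n)"
        by (rule degree_mult_eq[OF P(2)]) (use a0 in simp)
      also have "\<dots> = degree A" unfolding dm(1) using False unfolding n_def by simp
      finally show ?thesis .
    qed
    moreover have "lead_coeff (P * monom a n) = lead_coeff A"
    proof -
      have "lead_coeff (P * monom a n) = lead_coeff P * a" by (simp only: lead_coeff_mult dm(2))
      also have "\<dots> = lead_coeff A" unfolding a_def using lcP by simp
      finally show ?thesis .
    qed
    ultimately have "coeff A' (degree A) = 0" "degree A' \<le> degree A"
      unfolding A'_def by (simp, simp add: degree_diff_le)
    then have "A' = 0 \<or> degree A' < degree A" using eq_zero_or_degree_less by blast
    then have "\<exists>C D R R'. (C, D) \<in> poly_pairs G \<and> (R, R') \<in> poly_pairs G \<and> A' = P * C + R \<and> B' = Q * D + R' \<and>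
      (R = 0 \<or> degree R < degree P)"
    proof
      assume "A' = 0"
      moreover from this have "B' = 0" using pp_degree(2)[OF AB'] by simp
      ultimately show ?thesis using pp_0[OF G] by (intro exI[of _ 0]) auto
    next
      assume "degree A' < degree A"
      then show ?thesis using less.hyps AB' by blast
    qed
    then obtain C D R R' where *: "(C, D) \<in> poly_pairs G" "(R, R') \<in> poly_pairs G" "A' = P * C + R"
      "B' = Q * D + R'" "R = 0 \<or> degree R < degree P" by blast
    have "(C + monom a n, D + monom b n) \<in> poly_pairs G" by (rule pp_add[OF G *(1) pp_monom[OF G ab]])
    moreover have "A = P * (C + monom a n) + R" "B = Q * (D + monom b n) + R'"
      using *(3,4) unfolding A'_def B'_def by (simp_all add: algebra_simps)
    ultimately show ?thesis using *(2,5) by blast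
  qed
qed

text \<open>
  \<open>P\<close> is the minimal polynomial of \<open>y\<close> over the domain of \<open>G\<close>, and \<open>Q\<close> is its image.  Division with
  remainder inside \<open>poly_pairs\<close> shows that \<open>Q\<close> divides the image of every polynomial vanishing at \<open>y\<close>.
  In particular it divides a separable polynomial over \<open>k\<close>.
\<close>
lemma ph_minimal_poly:
  obtains P Q where "(P, Q) \<in> poly_pairs G" "poly P y = 0" "P \<noteq> 0" "degree P > 0" "degree Q > 0" "separable_poly Q"
    "\<forall>A B. (A, B) \<in> poly_pairs G \<longrightarrow> poly A y = 0 \<longrightarrow> Q dvd B"
proof -
  let ?M = "\<lambda>(P, Q). (P, Q) \<in> poly_pairs G \<and> P \<noteq> 0 \<and> poly P y = 0"
  obtain p where p: "separable_poly p" "p \<noteq> 0" "poly (map_poly \<phi> p) y = 0" by (rule sc_algebraic)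
  have ex: "?M (map_poly \<phi> p, map_poly \<phi> p)" using p(2,3) pp_map[OF G] by (simp add: map_poly_hom_eq_0)
  obtain PQ where PQ: "?M PQ" and minPQ: "\<And>e. ?M e \<Longrightarrow> degree (fst PQ) \<le> degree (fst e)"
    using ex_has_least_nat[of ?M "(map_poly \<phi> p, map_poly \<phi> p)" "\<lambda>e. degree (fst e)"] ex by blast
  obtain P Q where PQ': "PQ = (P, Q)" by (cases PQ)
  have M: "(P, Q) \<in> poly_pairs G" "P \<noteq> 0" "poly P y = 0" using PQ unfolding PQ' by auto
  have min: "degree P \<le> degree A" if "(A, B) \<in> poly_pairs G" "A \<noteq> 0" "poly A y = 0" for A B
    using minPQ[of "(A, B)"] that unfolding PQ' by simp
  have dvd: "Q dvd B" if AB: "(A, B) \<in> poly_pairs G" "poly A y = 0" for A B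
  proof -
    obtain C D R R' where *: "(C, D) \<in> poly_pairs G" "(R, R') \<in> poly_pairs G" "A = P * C + R"
      "B = Q * D + R'" "R = 0 \<or> degree R < degree P" using pp_division[OF M(1,2) AB(1)] by blast
    have "poly R y = 0" using AB(2) M(3) unfolding *(3) by simp
    then have "R = 0" using min[OF *(2)] *(5) by fastforce
    then have "R' = 0" using pp_degree(2)[OF *(2)] by simp
    then show ?thesis using *(4) by simp
  qed
  have "degree P > 0"
  proof (rule ccontr)
    assume "\<not> degree P > 0"
    then obtain c where "P = [:c:]" using degree_eq_zeroE by blast
    then show False using M by simp
  qed
  moreover have "Q dvd map_poly \<phi> p" by (rule dvd[OF pp_map[OF G] p(3)])
  then have "separable_poly Q" using separable_dvd separable_map_poly[OF p(1)] by blast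
  ultimately show thesis using that[OF M(1,3,2)] dvd pp_degree(1)[OF M(1)] by simp
qed

text \<open>
  The extension sends \<open>A(y)\<close> to \<open>B(y')\<close> for all \<open>(A, B)\<close> in \<open>poly_pairs\<close>; divisibility by \<open>Q\<close> makes it
  well defined.
\<close>
lemma ph_adjoin:
  assumes dvd: "\<forall>A B. (A, B) \<in> poly_pairs G \<longrightarrow> poly A y = 0 \<longrightarrow> Q dvd B" and root: "poly Q y' = 0"
  obtains H where "partial_hom H" "G \<subseteq> H" "(y, y') \<in> H"
proof -
  define H where "H = {(poly A y, poly B y') | A B. (A, B) \<in> poly_pairs G}"
  have in_H: "(poly A y, poly B y') \<in> H" if "(A, B) \<in> poly_pairs G" for A B using that unfolding H_def by blast
  have GH: "G \<subseteq> H"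
  proof
    fix z assume "z \<in> G"
    then have "(monom (fst z) 0, monom (snd z) 0) \<in> poly_pairs G" by (intro pp_monom[OF G]) simp
    from in_H[OF this] show "z \<in> H" by (simp add: poly_monom)
  qed
  have "partial_hom H" unfolding partial_hom_def
  proof (intro conjI allI impI)
    show "(\<phi> c, \<phi> c) \<in> H" for c using G_const GH by blast
    fix a b c d assume "(a, b) \<in> H" "(c, d) \<in> H"
    then obtain A B C D where *: "(A, B) \<in> poly_pairs G" "a = poly A y" "b = poly B y'"
      "(C, D) \<in> poly_pairs G" "c = poly C y" "d = poly D y'" unfolding H_def by blast
    show "(a + c, b + d) \<in> H" using in_H[OF pp_add[OF G *(1,4)]] * by simp
    show "(a * c, b * d) \<in> H" using in_H[OF pp_mult[OF G *(1,4)]] * by simp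
  next
    fix b assume "(0, b) \<in> H"
    then obtain A B where *: "(A, B) \<in> poly_pairs G" "poly A y = 0" "b = poly B y'" unfolding H_def by force
    then show "b = 0" using dvd[rule_format, OF *(1,2)] root by (auto elim!: dvdE)
  qed
  moreover have "(y, y') \<in> H"
    using in_H[OF pp_monom[OF G ph_1[OF G]], of 1] by (simp add: poly_monom)
  ultimately show thesis using that GH by blast
qed

end

text \<open>
  A maximal extension is defined everywhere, since images of minimal polynomials are separable and have
  roots in \<open>S\<close>.  It is surjective because it permutes the finite set of roots of each polynomial over
  \<open>k\<close>.
\<close>
lemma partial_hom_extends:
  assumes "partial_hom G\<^sub>0"
  obtains \<sigma> where "\<sigma> \<in> galois_group \<phi>" "\<And>a b. (a, b) \<in> G\<^sub>0 \<Longrightarrow> \<sigma> a = b"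
proof -
  let ?\<A> = "{G. partial_hom G \<and> G\<^sub>0 \<subseteq> G}"
  have "\<exists>M\<in>?\<A>. \<forall>X\<in>?\<A>. M \<subseteq> X \<longrightarrow> X = M"
  proof (rule subset_Zorn_nonempty)
    show "?\<A> \<noteq> {}" using assms by blast
    fix \<C> assume ne: "\<C> \<noteq> {}" and ch: "subset.chain ?\<A> \<C>"
    have sub: "\<C> \<subseteq> ?\<A>" and tot: "\<And>X Y. X \<in> \<C> \<Longrightarrow> Y \<in> \<C> \<Longrightarrow> X \<subseteq> Y \<or> Y \<subseteq> X"
      using ch unfolding subset_chain_def by blast+
    have "partial_hom (\<Union>\<C>)" unfolding partial_hom_def
    proof (intro conjI allI impI)
      show "(\<phi> c, \<phi> c) \<in> \<Union>\<C>" for c using ne sub ph_const by blast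
      fix a b c d assume "(a, b) \<in> \<Union>\<C>" "(c, d) \<in> \<Union>\<C>"
      then obtain X where X: "X \<in> \<C>" "(a, b) \<in> X" "(c, d) \<in> X" using tot by blast
      then have "partial_hom X" using sub by blast
      then show "(a + c, b + d) \<in> \<Union>\<C>" "(a * c, b * d) \<in> \<Union>\<C>" using X ph_add ph_mult by blast+
    next
      fix b assume "(0, b) \<in> \<Union>\<C>"
      then show "b = 0" using sub ph_zero by blast
    qed
    then show "\<Union>\<C> \<in> ?\<A>" using ne sub by blast
  qed
  then obtain M where M0: "M \<in> ?\<A>" "\<forall>X\<in>?\<A>. M \<subseteq> X \<longrightarrow> X = M" by (rule bexE)
  from M0(1) have M: "partial_hom M" "G\<^sub>0 \<subseteq> M" by simp_all
  have max: "X = M" if "partial_hom X" "M \<subseteq> X" for X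
  proof -
    have "X \<in> ?\<A>" using that M(2) by simp
    from bspec[OF M0(2) this] show ?thesis using that(2) by (rule mp)
  qed
  have dom: "\<exists>b. (a, b) \<in> M" for a
  proof -
    obtain P Q where PQ: "degree Q > 0" "separable_poly Q"
      "\<forall>A B. (A, B) \<in> poly_pairs M \<longrightarrow> poly A a = 0 \<longrightarrow> Q dvd B"
      by (rule ph_minimal_poly[OF M(1), of a]) blast
    obtain a' where "poly Q a' = 0" using sc PQ(1,2) unfolding separable_closure_def by blast
    then obtain H where "partial_hom H" "M \<subseteq> H" "(a, a') \<in> H" by (rule ph_adjoin[OF M(1) PQ(3)])
    then show ?thesis using max by blast
  qed
  define \<sigma> where "\<sigma> a = (THE b. (a, b) \<in> M)" for a
  have \<sigma>: "\<sigma> a = b" if "(a, b) \<in> M" for a b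
    unfolding \<sigma>_def using that ph_unique[OF M(1)] by blast
  have \<sigma>M: "(a, \<sigma> a) \<in> M" for a using dom \<sigma> by metis
  have hom: "comm_ring_hom \<sigma>"
    by (rule comm_ring_homI) (auto intro!: \<sigma> ph_1[OF M(1)] ph_add[OF M(1)] ph_mult[OF M(1)] \<sigma>M)
  interpret \<sigma>: comm_ring_hom \<sigma> by (rule hom)
  have \<sigma>\<phi>: "\<sigma> (\<phi> c) = \<phi> c" for c by (rule \<sigma>[OF ph_const[OF M(1)]])
  have inj: "inj \<sigma>"
  proof (rule injI)
    fix x y assume "\<sigma> x = \<sigma> y"
    then have "(x - y, 0) \<in> M" using \<sigma>M[of "x - y"] by (simp add: \<sigma>.hom_minus)
    then show "x = y" using ph_inverse(2)[OF M(1)] by fastforce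
  qed
  have \<sigma>poly: "\<sigma> (poly (map_poly \<phi> p) x) = poly (map_poly \<phi> p) (\<sigma> x)" for p x
    by (rule \<sigma>[OF ph_poly[OF M(1) \<sigma>M]])
  have "\<exists>x. y = \<sigma> x" for y
  proof -
    obtain p where p: "p \<noteq> 0" "poly (map_poly \<phi> p) y = 0" using sc_algebraic by blast
    define R where "R = {x. poly (map_poly \<phi> p) x = 0}"
    have "finite R" unfolding R_def using p(1) by (intro poly_roots_finite) (simp add: map_poly_hom_eq_0)
    moreover have "\<sigma> ` R \<subseteq> R" unfolding R_def using \<sigma>poly by (auto simp flip: \<sigma>poly)
    ultimately have "\<sigma> ` R = R" using inj by (meson endo_inj_surj inj_on_subset subset_UNIV)
    then show ?thesis using p(2) unfolding R_def by blast
  qed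
  then have "surj \<sigma>" unfolding surj_def by blast
  then have "\<sigma> \<in> galois_group \<phi>" using inj hom \<sigma>\<phi> unfolding galois_group_def bij_def by blast
  then show thesis using that \<sigma> M(2) by blast
qed

text \<open>
  An element \<open>x\<close> outside \<open>k\<close> has a minimal polynomial over \<open>k\<close> of degree at least \<open>2\<close>.  It is separable,
  so it has a second root \<open>x'\<close>, and \<open>x \<mapsto> x'\<close> extends to an automorphism of \<open>S\<close>.
\<close>
lemma galois_fixed:
  assumes fixed: "\<And>\<sigma>. \<sigma> \<in> galois_group \<phi> \<Longrightarrow> \<sigma> x = x"
  shows "x \<in> range \<phi>"
proof (rule ccontr)
  assume x: "x \<notin> range \<phi>"
  define G where "G = range (\<lambda>c. (\<phi> c, \<phi> c))"
  have in_G: "(a, b) \<in> G \<longleftrightarrow> a = b \<and> b \<in> range \<phi>" for a b unfolding G_def by auto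
  have G: "partial_hom G" unfolding partial_hom_def in_G
    by (auto simp: hom_add[symmetric] hom_mult[symmetric])
  obtain P Q where PQ: "(P, Q) \<in> poly_pairs G" "poly P x = 0" "P \<noteq> 0" "degree P > 0" "separable_poly Q"
      "\<forall>A B. (A, B) \<in> poly_pairs G \<longrightarrow> poly A x = 0 \<longrightarrow> Q dvd B"
    by (rule ph_minimal_poly[OF G, of x]) blast
  have QP: "Q = P" and cP: "coeff P i \<in> range \<phi>" for i
    using PQ(1) unfolding poly_pairs_def in_G by (auto simp: poly_eq_iff)
  obtain R where R: "P = [:- x, 1:] * R" using PQ(2) unfolding poly_eq_0_iff_dvd by (rule dvdE)
  have R0: "R \<noteq> 0" using R PQ(3) by auto
  have "degree R > 0"
  proof (rule ccontr)
    assume "\<not> degree R > 0"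
    then obtain r where r: "R = [:r:]" using degree_eq_zeroE by blast
    have "P = [:- x * r, r:]" unfolding R r by simp
    then have c: "coeff P 0 = - x * r" "coeff P 1 = r" by simp_all
    obtain u v where uv: "coeff P 0 = \<phi> u" "coeff P 1 = \<phi> v" using cP by (metis rangeE)
    have "r \<noteq> 0" using r R0 by simp
    have "\<phi> (inverse v) = inverse (\<phi> v)" using \<open>r \<noteq> 0\<close> c uv
      by (metis field_hom_eq_0_iff[OF \<phi>] hom_mult hom_one inverse_unique right_inverse)
    then have "x = \<phi> (- u * inverse v)"
      using c uv \<open>r \<noteq> 0\<close> by (simp add: hom_mult hom_uminus)
    then show False using x by blast
  qed
  moreover have "R dvd Q" unfolding QP R by (rule dvd_triv_right)
  then have "separable_poly R" by (rule separable_dvd[OF PQ(5)])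
  ultimately obtain x' where x': "poly R x' = 0" using sc unfolding separable_closure_def by blast
  have "x' \<noteq> x"
  proof
    assume "x' = x"
    then have d: "[:- x, 1:] dvd R" using x' by (simp add: poly_eq_0_iff_dvd)
    have "pderiv P = R * pderiv [:- x, 1:] + [:- x, 1:] * pderiv R" unfolding R pderiv_mult by simp
    then have "[:- x, 1:] dvd pderiv P" using d by (metis dvd_add dvd_mult2 dvd_triv_left)
    moreover have "[:- x, 1:] dvd P" unfolding R by (rule dvd_triv_left)
    ultimately have "is_unit [:- x, 1:]" using PQ(5) unfolding QP separable_poly_def by (meson coprime_def)
    then show False by (simp add: is_unit_pCons_iff)
  qed
  moreover have "poly Q x' = 0" unfolding QP R using x' by simp
  then obtain H where H: "partial_hom H" "(x, x') \<in> H" by (rule ph_adjoin[OF G PQ(6)])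
  obtain \<sigma> where "\<sigma> \<in> galois_group \<phi>" "\<sigma> x = x'" using partial_hom_extends[OF H(1)] H(2) by metis
  ultimately show False using fixed by metis
qed

text \<open>
  In place of finite Galois subextensions: an automorphism maps each element of \<open>X\<close> to one of finitely
  many roots.
\<close>
lemma galois_restrictions_finite:
  assumes "finite X"
  shows "finite ((\<lambda>\<sigma>. restrict \<sigma> X) ` galois_group \<phi>)"
proof -
  have "\<forall>x. \<exists>p. p \<noteq> 0 \<and> poly (map_poly \<phi> p) x = 0" using sc_algebraic by metis
  then obtain p where p: "\<And>x. p x \<noteq> 0" "\<And>x. poly (map_poly \<phi> (p x)) x = 0" by metis
  define R where "R x = {y. poly (map_poly \<phi> (p x)) y = 0}" for x
  have "restrict \<sigma> X \<in> Pi\<^sub>E X R" if "\<sigma> \<in> galois_group \<phi>" for \<sigma>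
  proof -
    interpret \<sigma>: comm_ring_hom \<sigma> using that unfolding galois_group_def by blast
    have \<sigma>\<phi>: "\<sigma> (\<phi> c) = \<phi> c" for c using that unfolding galois_group_def by blast
    have "\<sigma> (poly (map_poly \<phi> q) x) = poly (map_poly \<phi> q) (\<sigma> x)" for q x
      by (induction q) (simp_all add: map_poly_hom_pCons \<sigma>.hom_add \<sigma>.hom_mult \<sigma>\<phi>)
    then show ?thesis unfolding R_def using p(2) by (metis (mono_tags, lifting) \<sigma>.hom_zero mem_Collect_eq restrict_PiE_iff)
  qed
  moreover have "finite (Pi\<^sub>E X R)"
    unfolding R_def using assms p(1) by (intro finite_PiE poly_roots_finite) (simp_all add: map_poly_hom_eq_0)
  ultimately show ?thesis by (meson finite_subset image_subsetI)
qed

end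
end

section \<open>Hilbert 90 for the unit group of an etale algebra\<close>

lemma galois_group_id: "id \<in> galois_group \<phi>"
  unfolding galois_group_def using comm_ring_hom_id by auto

lemma galois_group_comp:
  assumes "\<sigma> \<in> galois_group \<phi>" "\<rho> \<in> galois_group \<phi>"
  shows "\<sigma> \<circ> \<rho> \<in> galois_group \<phi>"
  using assms unfolding galois_group_def by (auto intro: comm_ring_hom_comp bij_comp)

lemma galois_group_hom: "\<sigma> \<in> galois_group \<phi> \<Longrightarrow> comm_ring_hom \<sigma>"
  unfolding galois_group_def by blast

lemma comm_ring_hom_inv:
  fixes f :: "'a::comm_ring_1 \<Rightarrow> 'b::comm_ring_1"
  assumes "comm_ring_hom f" "bij f"
  shows "comm_ring_hom (inv_into UNIV f)"
proof -
  interpret f: comm_ring_hom f by fact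
  have i: "inv_into UNIV f (f x) = x" "f (inv_into UNIV f y) = y" for x y
    using assms(2) by (simp_all add: bij_is_inj bij_is_surj surj_f_inv_f)
  show ?thesis
  proof (rule comm_ring_homI)
    show "inv_into UNIV f 1 = 1" using i(1)[of 1] by simp
    show "inv_into UNIV f (x + y) = inv_into UNIV f x + inv_into UNIV f y" for x y
      using i(1)[of "inv_into UNIV f x + inv_into UNIV f y"] by (simp add: f.hom_add i)
    show "inv_into UNIV f (x * y) = inv_into UNIV f x * inv_into UNIV f y" for x y
      using i(1)[of "inv_into UNIV f x * inv_into UNIV f y"] by (simp add: f.hom_mult i)
  qed
qed

lemma galois_group_inv:
  assumes "\<sigma> \<in> galois_group \<phi>"
  shows "inv_into UNIV \<sigma> \<in> galois_group \<phi>" "inv_into UNIV \<sigma> (\<sigma> x) = x" "\<sigma> (inv_into UNIV \<sigma> x) = x"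
proof -
  have b: "bij \<sigma>" and h: "comm_ring_hom \<sigma>" and f: "\<And>c. \<sigma> (\<phi> c) = \<phi> c"
    using assms unfolding galois_group_def by auto
  show i: "inv_into UNIV \<sigma> (\<sigma> x) = x" "\<sigma> (inv_into UNIV \<sigma> x) = x" for x
    using b by (simp_all add: bij_is_inj bij_is_surj surj_f_inv_f)
  have "inv_into UNIV \<sigma> (\<phi> c) = \<phi> c" for c using i(1)[of "\<phi> c"] f by simp
  then show "inv_into UNIV \<sigma> \<in> galois_group \<phi>"
    unfolding galois_group_def using b h by (simp add: bij_imp_bij_inv comm_ring_hom_inv)
qed

text \<open>
  Dedekind's independence of characters, for characters of a multiplicatively closed set \<open>D\<close>.
\<close>
lemma dedekind_independence:
  fixes a :: "'x \<Rightarrow> 's::field"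
  assumes "finite R" and D: "1 \<in> D" "\<And>s t. s \<in> D \<Longrightarrow> t \<in> D \<Longrightarrow> s * t \<in> D"
    and mult: "\<And>r s t. r \<in> R \<Longrightarrow> s \<in> D \<Longrightarrow> t \<in> D \<Longrightarrow> \<chi> r (s * t) = \<chi> r s * \<chi> r t"
    and one: "\<And>r. r \<in> R \<Longrightarrow> \<chi> r 1 = 1"
    and distinct: "\<And>r r'. r \<in> R \<Longrightarrow> r' \<in> R \<Longrightarrow> r \<noteq> r' \<Longrightarrow> \<exists>t\<in>D. \<chi> r t \<noteq> \<chi> r' t"
    and zero: "\<And>s. s \<in> D \<Longrightarrow> (\<Sum>r\<in>R. a r * \<chi> r s) = 0"
    and "r \<in> R"
  shows "a r = 0"
  using assms(1) mult one distinct zero assms(8)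
proof (induction R arbitrary: a r rule: finite_induct)
  case empty then show ?case by simp
next
  case (insert q R)
  have R0: "a r = 0" if r: "r \<in> R" for r
  proof -
    obtain t where t: "t \<in> D" "\<chi> r t \<noteq> \<chi> q t" using insert.prems(3)[of r q] r insert.hyps by blast
    have "(\<Sum>r\<in>R. (a r * (\<chi> r t - \<chi> q t)) * \<chi> r s) = 0" if s: "s \<in> D" for s
    proof -
      have "(\<Sum>r\<in>insert q R. a r * (\<chi> r t * \<chi> r s)) = 0"
        using insert.prems(4)[OF D(2)[OF t(1) s]] insert.prems(1)[OF _ t(1) s]
        by (metis (no_types, lifting) sum.cong)
      moreover have "(\<Sum>r\<in>insert q R. \<chi> q t * (a r * \<chi> r s)) = 0"
        using insert.prems(4)[OF s] by (simp only: sum_distrib_left[symmetric] mult_zero_right)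
      ultimately have "(\<Sum>r\<in>insert q R. a r * (\<chi> r t * \<chi> r s) - \<chi> q t * (a r * \<chi> r s)) = 0"
        by (simp only: sum_subtractf diff_zero)
      then show ?thesis using insert.hyps by (simp add: algebra_simps)
    qed
    then have "a r * (\<chi> r t - \<chi> q t) = 0"
      using insert.IH[of "\<lambda>r. a r * (\<chi> r t - \<chi> q t)" r] insert.prems(1-3) r by blast
    then show ?thesis using t(2) by simp
  qed
  then have "a q = 0"
    using insert.prems(4)[OF D(1)] insert.prems(2) insert.hyps by simp
  then show ?case using R0 insert.prems(5) by blast
qed

lemma free_basis_finite_dimensional:
  fixes \<phi> :: "'k::field \<Rightarrow> 'a::comm_ring_1"
  assumes hom: "comm_ring_hom \<phi>" and fb: "free_basis \<phi> I b"
  obtains B where "finite_dimensional_vector_space (alg_scale \<phi>) B"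
proof -
  interpret V: vector_space "alg_scale \<phi>" by (rule vector_space_alg_scale[OF hom])
  obtain B where B: "B \<subseteq> b ` I" "V.independent B" "b ` I \<subseteq> V.span B"
    using V.basis_exists[of "b ` I"] by metis
  have "x \<in> V.span B" for x
  proof -
    have "(\<Sum>i\<in>I. alg_scale \<phi> (coord \<phi> I b x i) (b i)) \<in> V.span B"
      using B(3) by (intro V.span_sum V.span_scale) auto
    then show ?thesis by (simp add: alg_scale_def coord_sum[OF fb])
  qed
  then have "V.span B = UNIV" by blast
  moreover have "finite B" using B(1) free_basisD(1)[OF fb] finite_subset by blast
  ultimately have "finite_dimensional_vector_space (alg_scale \<phi>) B"
    by unfold_locales (use B(2) in auto)
  then show thesis by (rule that)
qed

text \<open>
  Multiplication by \<open>x\<close> is an injective, hence surjective, endomorphism of a finite-dimensional space.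
\<close>
lemma non_zero_divisor_unit:
  fixes \<phi> :: "'k::field \<Rightarrow> 'a::comm_ring_1" and x :: 'a
  assumes hom: "comm_ring_hom \<phi>" and fb: "free_basis \<phi> I b" and nzd: "\<And>y. y * x = 0 \<Longrightarrow> y = 0"
  obtains v where "x * v = 1"
proof -
  obtain B where "finite_dimensional_vector_space (alg_scale \<phi>) B"
    by (rule free_basis_finite_dimensional[OF hom fb])
  then interpret V: finite_dimensional_vector_space "alg_scale \<phi>" B .
  have lin: "Vector_Spaces.linear (alg_scale \<phi>) (alg_scale \<phi>) (\<lambda>y. y * x)"
    by unfold_locales (simp_all add: alg_scale_def algebra_simps)
  have "inj (\<lambda>y. y * x)"
  proof (rule injI)
    fix y z assume "y * x = z * x"
    then have "(y - z) * x = 0" by (simp add: algebra_simps)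
    from nzd[OF this] show "y = z" by simp
  qed
  from V.linear_inj_imp_surj[OF lin this] obtain v where "1 = v * x" unfolding surj_def by blast
  then show thesis using that by (simp add: mult.commute)
qed

locale galois_tensor =
  fixes \<phi>E :: "'k::field \<Rightarrow> 'e::comm_ring_1" and \<phi>S :: "'k \<Rightarrow> 's::field"
    and iE :: "'e \<Rightarrow> 'f::comm_ring_1" and iS :: "'s \<Rightarrow> 'f" and I :: "'i set" and e :: "'i \<Rightarrow> 'e"
  assumes E_hom: "comm_ring_hom \<phi>E" and sc: "separable_closure \<phi>S"
    and tp: "tensor_product \<phi>E \<phi>S iE iS" and fb: "free_basis \<phi>E I e"
begin

abbreviation \<Gamma> where "\<Gamma> \<equiv> galois_group \<phi>S"

definition act :: "('s \<Rightarrow> 's) \<Rightarrow> 'f \<Rightarrow> 'f" where "act \<sigma> = tensor_map iE iS iE iS id \<sigma>"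

lemma S_hom: "comm_ring_hom \<phi>S" using sc unfolding separable_closure_def by blast

sublocale iE: comm_ring_hom iE by (rule tensor_productD[OF tp])
sublocale iS: comm_ring_hom iS by (rule tensor_productD[OF tp])
sublocale \<phi>S: comm_ring_hom \<phi>S by (rule S_hom)
sublocale \<phi>E: comm_ring_hom \<phi>E by (rule E_hom)

lemma F_basis: "free_basis iS I (\<lambda>i. iE (e i))"
  by (rule tensor_basis_left[OF tp E_hom S_hom fb])

abbreviation co where "co \<equiv> coord iS I (\<lambda>i. iE (e i))"

lemmas co_add = coord_add[OF iS.comm_ring_hom_axioms F_basis]
lemmas co_scale = coord_scale[OF iS.comm_ring_hom_axioms F_basis]

lemma co_sum: "(\<Sum>i\<in>I. iS (co x i) * iE (e i)) = x" by (rule coord_sum[OF F_basis])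

lemma co_eqI: "(\<And>i. i \<in> I \<Longrightarrow> co x i = co y i) \<Longrightarrow> x = y"
  by (metis (no_types, lifting) co_sum sum.cong)

lemma co_zero: "i \<in> I \<Longrightarrow> co 0 i = 0"
  using co_scale[of i 0 0] by simp

lemma co_diff: "i \<in> I \<Longrightarrow> co (x - y) i = co x i - co y i"
  using co_add[of i "x - y" y] by simp

lemma co_setsum: "i \<in> I \<Longrightarrow> co (sum f A) i = (\<Sum>x\<in>A. co (f x) i)"
  by (induction A rule: infinite_finite_induct) (simp_all add: co_zero co_add)

lemma iE_eq_0: "iE a = 0 \<longleftrightarrow> a = 0"
proof
  assume "iE a = 0"
  have "iE a = iE (\<Sum>i\<in>I. \<phi>E (coord \<phi>E I e a i) * e i)" by (simp add: coord_sum[OF fb])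
  also have "\<dots> = (\<Sum>i\<in>I. iS (\<phi>S (coord \<phi>E I e a i)) * iE (e i))"
    by (simp add: iE.hom_sum iE.hom_mult tensor_productD(3)[OF tp])
  finally have "\<phi>S (coord \<phi>E I e a i) = 0" if "i \<in> I" for i
    using free_basisD(3)[OF F_basis _ that, of "\<lambda>i. \<phi>S (coord \<phi>E I e a i)"] \<open>iE a = 0\<close> by simp
  then have "coord \<phi>E I e a i = 0" if "i \<in> I" for i
    using that by (simp add: field_hom_eq_0_iff[OF S_hom])
  then have "(\<Sum>i\<in>I. \<phi>E (coord \<phi>E I e a i) * e i) = 0" by (intro sum.neutral) simp
  then show "a = 0" by (simp add: coord_sum[OF fb])
qed simp

lemma iE_inj: "iE a = iE b \<longleftrightarrow> a = b"
  using iE_eq_0[of "a - b"] by (simp add: iE.hom_minus)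

context
  fixes \<sigma> assumes \<sigma>: "\<sigma> \<in> \<Gamma>"
begin

lemma \<sigma>_const: "\<sigma> (\<phi>S c) = \<phi>S c" using \<sigma> unfolding galois_group_def by blast

lemma act_hom: "comm_ring_hom (act \<sigma>)" and act_iE: "act \<sigma> (iE a) = iE a" and act_iS: "act \<sigma> (iS s) = iS (\<sigma> s)"
proof -
  have *: "iE (id (\<phi>E c)) = iS (\<sigma> (\<phi>S c))" for c by (simp add: \<sigma>_const tensor_productD(3)[OF tp])
  note tm = tensor_map[where f = id and g = \<sigma>, OF tp comm_ring_hom_id galois_group_hom[OF \<sigma>] iE.comm_ring_hom_axioms iS.comm_ring_hom_axioms *]
  show "comm_ring_hom (act \<sigma>)" "act \<sigma> (iE a) = iE a" "act \<sigma> (iS s) = iS (\<sigma> s)"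
    unfolding act_def using tm(1) tm(3)[of a] tm(4)[of s] by simp_all
qed

lemma act_coord:
  assumes i: "i \<in> I" shows "co (act \<sigma> x) i = \<sigma> (co x i)"
proof -
  interpret a: comm_ring_hom "act \<sigma>" by (rule act_hom)
  have "act \<sigma> x = act \<sigma> (\<Sum>i\<in>I. iS (co x i) * iE (e i))" by (simp add: co_sum)
  also have "\<dots> = (\<Sum>i\<in>I. iS (\<sigma> (co x i)) * iE (e i))"
    by (simp add: a.hom_sum a.hom_mult act_iE act_iS)
  finally show ?thesis by (rule coord_unique[OF iS.comm_ring_hom_axioms F_basis _ i])
qed

end

lemma act_comp: "\<sigma> \<in> \<Gamma> \<Longrightarrow> \<rho> \<in> \<Gamma> \<Longrightarrow> act (\<sigma> \<circ> \<rho>) x = act \<sigma> (act \<rho> x)"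
  by (rule co_eqI) (simp add: act_coord galois_group_comp)

lemma act_id: "act id x = x"
  by (rule co_eqI) (simp add: act_coord galois_group_id)

lemma act_fixed:
  assumes "\<And>\<sigma>. \<sigma> \<in> \<Gamma> \<Longrightarrow> act \<sigma> x = x"
  obtains a where "x = iE a"
proof -
  have "co x i \<in> range \<phi>S" if "i \<in> I" for i
    by (rule galois_fixed[OF S_hom sc]) (metis act_coord assms that)
  then obtain c where c: "\<And>i. i \<in> I \<Longrightarrow> co x i = \<phi>S (c i)" unfolding image_def by simp metis
  have "x = (\<Sum>i\<in>I. iS (co x i) * iE (e i))" by (simp add: co_sum)
  also have "\<dots> = iE (\<Sum>i\<in>I. \<phi>E (c i) * e i)"
    by (simp add: c iE.hom_sum iE.hom_mult tensor_productD(3)[OF tp])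
  finally show thesis by (rule that)
qed

text \<open>
  Galois descent.  Take \<open>v\<close> in \<open>V\<close> with the fewest non-zero coordinates, one of them equal to \<open>1\<close>.  Then
  \<open>\<sigma> v - v\<close> has fewer non-zero coordinates, so it is \<open>0\<close>, and \<open>v\<close> has coordinates in \<open>k\<close>.
\<close>
lemma stable_subspace_descends:
  assumes add: "\<And>x y. x \<in> V \<Longrightarrow> y \<in> V \<Longrightarrow> x - y \<in> V" and scale: "\<And>s x. x \<in> V \<Longrightarrow> iS s * x \<in> V"
    and stable: "\<And>\<sigma> x. \<sigma> \<in> \<Gamma> \<Longrightarrow> x \<in> V \<Longrightarrow> act \<sigma> x \<in> V" and nz: "v\<^sub>0 \<in> V" "v\<^sub>0 \<noteq> 0"
  obtains a where "a \<noteq> 0" "iE a \<in> V"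
proof -
  have finI: "finite I" by (rule free_basisD(1)[OF fb])
  define supp where "supp x = {i \<in> I. co x i \<noteq> 0}" for x
  let ?P = "\<lambda>x. x \<in> V \<and> x \<noteq> 0"
  obtain u where u: "?P u" and min: "\<And>y. ?P y \<Longrightarrow> card (supp u) \<le> card (supp y)"
    using ex_has_least_nat[of ?P v\<^sub>0 "\<lambda>x. card (supp x)"] nz by blast
  have "\<exists>i\<in>I. co u i \<noteq> 0"
  proof (rule ccontr)
    assume "\<not> ?thesis"
    then have "u = 0" by (intro co_eqI) (simp add: co_zero)
    then show False using u by simp
  qed
  then obtain i where i: "i \<in> I" "co u i \<noteq> 0" by blast
  define v where "v = iS (inverse (co u i)) * u"
  have cov: "co v j = inverse (co u i) * co u j" if "j \<in> I" for j unfolding v_def by (rule co_scale[OF that])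
  have supp_v: "supp v = supp u" unfolding supp_def using cov i(2) by auto
  have vV: "v \<in> V" unfolding v_def using scale u by blast
  have v1: "co v i = 1" using cov[OF i(1)] i(2) by simp
  have v0: "v \<noteq> 0" using v1 co_zero[OF i(1)] by auto
  have fixed: "act \<sigma> v = v" if \<sigma>: "\<sigma> \<in> \<Gamma>" for \<sigma>
  proof (rule ccontr)
    assume ne: "act \<sigma> v \<noteq> v"
    interpret \<sigma>: comm_ring_hom \<sigma> by (rule galois_group_hom[OF \<sigma>])
    define w where "w = act \<sigma> v - v"
    have cow: "co w j = \<sigma> (co v j) - co v j" if "j \<in> I" for j
      unfolding w_def by (simp add: co_diff[OF that] act_coord[OF \<sigma> that])
    have "supp w \<subseteq> supp v - {i}" unfolding supp_def using cow v1 by auto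
    moreover have "i \<in> supp v" unfolding supp_def using i(1) v1 by simp
    ultimately have "supp w \<subset> supp v" by blast
    moreover have "finite (supp v)" unfolding supp_def using finI by simp
    ultimately have "card (supp w) < card (supp u)" unfolding supp_v[symmetric] by (simp add: psubset_card_mono)
    moreover have "?P w" unfolding w_def using add stable[OF \<sigma> vV] vV ne by simp
    ultimately show False using min[of w] by simp
  qed
  obtain a where a: "v = iE a" by (rule act_fixed[OF fixed])
  have "a \<noteq> 0" using a v0 by auto
  then show thesis using that[of a] a vV by simp
qed

context
  fixes c :: "('s \<Rightarrow> 's) \<Rightarrow> 'f"
  assumes unit: "\<And>\<sigma>. \<sigma> \<in> \<Gamma> \<Longrightarrow> \<exists>d. c \<sigma> * d = 1"
    and cocycle: "\<And>\<sigma> \<rho>. \<sigma> \<in> \<Gamma> \<Longrightarrow> \<rho> \<in> \<Gamma> \<Longrightarrow> c (\<sigma> \<circ> \<rho>) = c \<sigma> * act \<sigma> (c \<rho>)"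
    and cont: "galois_continuous \<phi>S c"
begin

lemma cocycle_id: "c id = 1"
proof -
  have "c id = c id * c id" using cocycle[OF galois_group_id galois_group_id] by (simp add: act_id)
  moreover obtain d where "c id * d = 1" using unit[OF galois_group_id] by blast
  ultimately show ?thesis by (metis mult.assoc mult.commute mult_1)
qed

text \<open>
  The fixed points of the action \<open>x \<mapsto> c \<sigma> * \<sigma> x\<close>, an \<open>E\<close>-submodule of \<open>E \<otimes> S\<close>.
\<close>
definition twisted_fixed :: "'f set" where
  "twisted_fixed = {x. \<forall>\<sigma>\<in>\<Gamma>. c \<sigma> * act \<sigma> x = x}"

text \<open>
  By continuity \<open>c \<sigma>\<close> depends only on the restriction of \<open>\<sigma>\<close> to a finite set \<open>X\<close>.  For \<open>s\<close> in the fixed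
  field \<open>D\<close> of the stabiliser of \<open>X\<close> the Poincare sum of \<open>c \<sigma> * \<sigma> s\<close> over these finitely many
  restrictions is a fixed point.  If \<open>f\<close> killed all of these sums, independence of characters would give
  \<open>f * c \<sigma> = 0\<close>, although \<open>c \<sigma>\<close> is a unit.
\<close>
lemma twisted_fixed_nonzero:
  assumes f: "f \<noteq> 0"
  shows "\<exists>x\<in>twisted_fixed. iE f * x \<noteq> 0"
proof -
  obtain X where X: "finite X" "\<And>\<rho>. \<rho> \<in> \<Gamma> \<Longrightarrow> (\<And>x. x \<in> X \<Longrightarrow> \<rho> x = x) \<Longrightarrow> c \<rho> = 1"
    using cont galois_group_id[of \<phi>S] cocycle_id unfolding galois_continuous_def by (metis id_apply)
  define D where "D = {s. \<forall>\<rho>\<in>\<Gamma>. (\<forall>x\<in>X. \<rho> x = x) \<longrightarrow> \<rho> s = s}"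
  have XD: "X \<subseteq> D" unfolding D_def by blast
  define agree where "agree \<sigma> \<rho> \<longleftrightarrow> (\<forall>x\<in>X. \<sigma> x = \<rho> x)" for \<sigma> \<rho> :: "'s \<Rightarrow> 's"
  have agree_D: "c \<sigma>' = c \<sigma> \<and> (\<forall>s\<in>D. \<sigma>' s = \<sigma> s)"
    if \<sigma>: "\<sigma> \<in> \<Gamma>" and \<sigma>': "\<sigma>' \<in> \<Gamma>" and ag: "agree \<sigma> \<sigma>'" for \<sigma> \<sigma>'
  proof -
    define \<rho> where "\<rho> = inv_into UNIV \<sigma> \<circ> \<sigma>'"
    have \<rho>: "\<rho> \<in> \<Gamma>" unfolding \<rho>_def using galois_group_inv(1)[OF \<sigma>] \<sigma>' by (rule galois_group_comp)
    have \<rho>X: "\<rho> x = x" if "x \<in> X" for x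
      using ag that galois_group_inv(2)[OF \<sigma>] unfolding agree_def \<rho>_def by (metis comp_apply)
    have s: "\<sigma>' = \<sigma> \<circ> \<rho>" unfolding \<rho>_def by (rule ext) (simp add: galois_group_inv(3)[OF \<sigma>])
    interpret a: comm_ring_hom "act \<sigma>" by (rule act_hom[OF \<sigma>])
    have "c \<sigma>' = c \<sigma>" unfolding s cocycle[OF \<sigma> \<rho>] using X(2)[OF \<rho> \<rho>X] by simp
    moreover have "\<sigma>' t = \<sigma> t" if "t \<in> D" for t
    proof -
      have "\<rho> t = t" using that \<rho> \<rho>X unfolding D_def by blast
      then show ?thesis unfolding s by simp
    qed
    ultimately show ?thesis by blast
  qed
  \<comment> \<open>One representative for each restriction to \<open>X\<close>.\<close>
  define rep where "rep r = (SOME \<sigma>. \<sigma> \<in> \<Gamma> \<and> restrict \<sigma> X = r)" for r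
  define R where "R = rep ` ((\<lambda>\<sigma>. restrict \<sigma> X) ` \<Gamma>)"
  have finR: "finite R" unfolding R_def by (intro finite_imageI galois_restrictions_finite[OF S_hom sc X(1)])
  have agree_restrict: "agree \<sigma> \<rho> \<longleftrightarrow> restrict \<sigma> X = restrict \<rho> X" for \<sigma> \<rho> :: "'s \<Rightarrow> 's"
    unfolding agree_def by (metis restrict_apply' restrict_ext)
  have rep: "rep (restrict \<sigma> X) \<in> \<Gamma>" "agree (rep (restrict \<sigma> X)) \<sigma>" if "\<sigma> \<in> \<Gamma>" for \<sigma>
    unfolding agree_restrict rep_def
    using someI[of "\<lambda>\<rho>. \<rho> \<in> \<Gamma> \<and> restrict \<rho> X = restrict \<sigma> X" \<sigma>] that by auto
  have R\<Gamma>: "R \<subseteq> \<Gamma>" unfolding R_def using rep(1) by blast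
  have rep_R: "rep (restrict \<sigma> X) = \<sigma>" if "\<sigma> \<in> R" for \<sigma>
    using that rep(2) unfolding R_def agree_restrict by auto
  define g where "g s \<tau> = c \<tau> * iS (\<tau> s)" for s \<tau>
  define x where "x s = (\<Sum>\<sigma>\<in>R. g s \<sigma>)" for s
  have xM: "x s \<in> twisted_fixed" if s: "s \<in> D" for s
    unfolding twisted_fixed_def
  proof (clarify)
    fix \<rho> assume \<rho>: "\<rho> \<in> \<Gamma>"
    interpret a: comm_ring_hom "act \<rho>" by (rule act_hom[OF \<rho>])
    \<comment> \<open>Left translation by \<open>\<rho>\<close> permutes the restrictions, and thus the representatives.\<close>
    define \<pi> where "\<pi> \<sigma> = rep (restrict (\<rho> \<circ> \<sigma>) X)" for \<sigma>
    have \<rho>R: "\<rho> \<circ> \<sigma> \<in> \<Gamma>" if "\<sigma> \<in> R" for \<sigma> using galois_group_comp[OF \<rho>] R\<Gamma> that by blast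
    have g\<pi>: "g s (\<rho> \<circ> \<sigma>) = g s (\<pi> \<sigma>)" if "\<sigma> \<in> R" for \<sigma>
      using agree_D[OF rep(1)[OF \<rho>R[OF that]] \<rho>R[OF that] rep(2)[OF \<rho>R[OF that]]] s
      unfolding g_def \<pi>_def by simp
    have "inj_on \<pi> R"
    proof (rule inj_onI)
      fix \<sigma> \<tau> assume *: "\<sigma> \<in> R" "\<tau> \<in> R" "\<pi> \<sigma> = \<pi> \<tau>"
      have "agree (\<rho> \<circ> \<sigma>) (\<rho> \<circ> \<tau>)"
        using rep(2)[OF \<rho>R[OF *(1)]] rep(2)[OF \<rho>R[OF *(2)]] *(3) unfolding \<pi>_def agree_def by simp
      then have "agree \<sigma> \<tau>" unfolding agree_def comp_apply by (metis galois_group_inv(2)[OF \<rho>])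
      then have "rep (restrict \<sigma> X) = rep (restrict \<tau> X)" unfolding agree_restrict by (rule arg_cong)
      then show "\<sigma> = \<tau>" unfolding rep_R[OF *(1)] rep_R[OF *(2)] .
    qed
    moreover have "\<pi> ` R \<subseteq> R" unfolding \<pi>_def using \<rho>R unfolding R_def by blast
    ultimately have bij: "bij_betw \<pi> R R" using endo_inj_surj[OF finR] unfolding bij_betw_def by blast
    have "c \<rho> * act \<rho> (x s) = (\<Sum>\<sigma>\<in>R. g s (\<rho> \<circ> \<sigma>))"
      unfolding x_def a.hom_sum sum_distrib_left
    proof (rule sum.cong)
      fix \<sigma> assume "\<sigma> \<in> R"
      then have "\<sigma> \<in> \<Gamma>" using R\<Gamma> by blast
      then show "c \<rho> * act \<rho> (g s \<sigma>) = g s (\<rho> \<circ> \<sigma>)"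
        unfolding g_def by (simp add: cocycle[OF \<rho>] a.hom_mult act_iS[OF \<rho>] mult.assoc)
    qed simp
    also have "\<dots> = (\<Sum>\<sigma>\<in>R. g s (\<pi> \<sigma>))" by (rule sum.cong) (simp_all add: g\<pi>)
    also have "\<dots> = x s" unfolding x_def by (rule sum.reindex_bij_betw[OF bij])
    finally show "c \<rho> * act \<rho> (x s) = x s" .
  qed
  have "\<exists>s\<in>D. iE f * x s \<noteq> 0"
  proof (rule ccontr)
    assume "\<not> ?thesis"
    then have z: "iE f * x s = 0" if "s \<in> D" for s using that by blast
    define \<sigma> where "\<sigma> = rep (restrict id X)"
    have \<sigma>: "\<sigma> \<in> R" "\<sigma> \<in> \<Gamma>" unfolding \<sigma>_def R_def using galois_group_id rep(1) by blast+
    have "co (iE f * c \<sigma>) i = 0" if i: "i \<in> I" for i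
    proof (rule dedekind_independence[where R = R and D = D and \<chi> = "\<lambda>\<sigma>. \<sigma>" and a = "\<lambda>\<sigma>. co (iE f * c \<sigma>) i", OF finR])
      have "\<rho> 1 = 1" if "\<rho> \<in> \<Gamma>" for \<rho>
      proof -
        interpret \<rho>: comm_ring_hom \<rho> by (rule galois_group_hom[OF that])
        show ?thesis by (rule \<rho>.hom_one)
      qed
      then show "1 \<in> D" unfolding D_def by simp
      show "s * t \<in> D" if st: "s \<in> D" "t \<in> D" for s t
        unfolding D_def
      proof (intro CollectI ballI impI)
        fix \<rho> assume \<rho>: "\<rho> \<in> \<Gamma>" and \<rho>X: "\<forall>x\<in>X. \<rho> x = x"
        interpret \<rho>: comm_ring_hom \<rho> by (rule galois_group_hom[OF \<rho>])
        have "\<rho> s = s" "\<rho> t = t" using st \<rho> \<rho>X unfolding D_def by blast+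
        then show "\<rho> (s * t) = s * t" by (simp add: \<rho>.hom_mult)
      qed
      show "r (s * t) = r s * r t" if "r \<in> R" for r s t
      proof -
        interpret r: comm_ring_hom r using galois_group_hom that R\<Gamma> by blast
        show ?thesis by (rule r.hom_mult)
      qed
      show "r 1 = 1" if "r \<in> R" for r
      proof -
        interpret r: comm_ring_hom r using galois_group_hom that R\<Gamma> by blast
        show ?thesis by (rule r.hom_one)
      qed
      show "\<exists>t\<in>D. r t \<noteq> r' t" if "r \<in> R" "r' \<in> R" "r \<noteq> r'" for r r'
      proof (rule ccontr)
        assume "\<not> ?thesis"
        then have "agree r r'" using XD unfolding agree_def by blast
        then show False using rep_R that unfolding agree_restrict by metis
      qed
      show "(\<Sum>r\<in>R. co (iE f * c r) i * r s) = 0" if "s \<in> D" for s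
      proof -
        have "0 = co (iE f * x s) i" using z[OF that] co_zero[OF i] by simp
        also have "iE f * x s = (\<Sum>r\<in>R. iS (r s) * (iE f * c r))"
          unfolding x_def g_def sum_distrib_left by (intro sum.cong) (simp_all add: mult_ac)
        also have "co \<dots> i = (\<Sum>r\<in>R. r s * co (iE f * c r) i)"
          unfolding co_setsum[OF i] co_scale[OF i] ..
        finally show ?thesis by (simp add: mult.commute)
      qed
    qed (fact \<sigma>(1))
    then have "iE f * c \<sigma> = 0" by (intro co_eqI) (simp add: co_zero)
    moreover obtain d where "c \<sigma> * d = 1" using unit[OF \<sigma>(2)] by blast
    ultimately have "iE f = 0" by (metis mult.assoc mult.right_neutral mult_zero_left)
    then show False using f iE_eq_0 by simp
  qed
  then show ?thesis using xM by blast
qed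

text \<open>
  Let \<open>x\<close> be a fixed point whose annihilator in \<open>E\<close> has least dimension.  An element \<open>a \<noteq> 0\<close> of the
  annihilator generates an idempotent \<open>\<epsilon>\<close>, and adding to \<open>x\<close> a fixed point that is non-zero on \<open>\<epsilon>\<close> would
  make the annihilator smaller.  So it is \<open>0\<close>, and by descent no element of \<open>E \<otimes> S\<close> kills \<open>x\<close>.
\<close>
lemma hilbert_90:
  assumes regular: "\<And>x::'e. \<exists>y. x * x * y = x"
  obtains z v where "z * v = 1" "\<And>\<sigma>. \<sigma> \<in> \<Gamma> \<Longrightarrow> c \<sigma> * act \<sigma> z = z"
proof -
  obtain B where "finite_dimensional_vector_space (alg_scale \<phi>E) B"
    by (rule free_basis_finite_dimensional[OF E_hom fb])
  then interpret V: finite_dimensional_vector_space "alg_scale \<phi>E" B .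
  define Ann where "Ann x = {a. iE a * x = 0}" for x
  have sub: "V.subspace (Ann x)" for x
    unfolding V.subspace_def Ann_def alg_scale_def
    by (simp add: iE.hom_add iE.hom_mult distrib_right mult.assoc)
  have "0 \<in> twisted_fixed"
  proof -
    have "act \<sigma> 0 = 0" if "\<sigma> \<in> \<Gamma>" for \<sigma>
    proof -
      interpret a: comm_ring_hom "act \<sigma>" by (rule act_hom[OF that])
      show ?thesis by simp
    qed
    then show ?thesis unfolding twisted_fixed_def by simp
  qed
  then obtain x where x: "x \<in> twisted_fixed" and
    min: "\<And>y. y \<in> twisted_fixed \<Longrightarrow> V.dim (Ann x) \<le> V.dim (Ann y)"
    using ex_has_least_nat[of "\<lambda>x. x \<in> twisted_fixed" 0 "\<lambda>x. V.dim (Ann x)"] by blast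
  have Ann0: "a = 0" if "iE a * x = 0" for a
  proof (rule ccontr)
    assume a: "a \<noteq> 0"
    obtain b where b: "a * a * b = a" using regular by blast
    define \<epsilon> where "\<epsilon> = a * b"
    have idem: "\<epsilon> * \<epsilon> = \<epsilon>" unfolding \<epsilon>_def using b by (metis mult.assoc mult.commute)
    have "\<epsilon> \<noteq> 0" using a b unfolding \<epsilon>_def by (metis mult.assoc mult_zero_right)
    then obtain x' where x': "x' \<in> twisted_fixed" "iE \<epsilon> * x' \<noteq> 0" using twisted_fixed_nonzero by blast
    have \<epsilon>x: "iE \<epsilon> * x = 0" unfolding \<epsilon>_def iE.hom_mult using that
      by (metis mult.assoc mult.commute mult_zero_right)
    define y where "y = x + iE \<epsilon> * x'"
    have "y \<in> twisted_fixed" unfolding twisted_fixed_def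
    proof clarify
      fix \<sigma> assume \<sigma>: "\<sigma> \<in> \<Gamma>"
      interpret s: comm_ring_hom "act \<sigma>" by (rule act_hom[OF \<sigma>])
      have *: "c \<sigma> * act \<sigma> x = x" "c \<sigma> * act \<sigma> x' = x'" using x x'(1) \<sigma> unfolding twisted_fixed_def by auto
      have "c \<sigma> * act \<sigma> y = c \<sigma> * act \<sigma> x + iE \<epsilon> * (c \<sigma> * act \<sigma> x')"
        unfolding y_def by (simp add: s.hom_add s.hom_mult act_iE[OF \<sigma>] algebra_simps)
      then show "c \<sigma> * act \<sigma> y = y" unfolding * y_def .
    qed
    then have le: "V.dim (Ann x) \<le> V.dim (Ann y)" by (rule min)
    have \<epsilon>y: "iE \<epsilon> * y = iE \<epsilon> * x'"
      unfolding y_def by (simp add: distrib_left \<epsilon>x mult.assoc[symmetric] iE.hom_mult[symmetric] idem)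
    have "Ann y \<subseteq> Ann x"
    proof
      fix t assume "t \<in> Ann y"
      then have ty: "iE t * y = 0" unfolding Ann_def by simp
      have "y - iE \<epsilon> * y = x" unfolding \<epsilon>y by (simp add: y_def)
      then have "iE t * x = iE t * (y - iE \<epsilon> * y)" by simp
      also have "\<dots> = iE t * y - iE \<epsilon> * (iE t * y)" by (simp add: algebra_simps)
      finally show "t \<in> Ann x" unfolding Ann_def using ty by simp
    qed
    moreover have "\<epsilon> \<in> Ann x" "\<epsilon> \<notin> Ann y" unfolding Ann_def using \<epsilon>x \<epsilon>y x'(2) by simp_all
    ultimately have "Ann y \<subset> Ann x" by blast
    then have "V.dim (Ann y) < V.dim (Ann x)"
      by (intro V.dim_psubset) (simp add: V.span_eq_iff[THEN iffD2, OF sub])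
    then show False using le by simp
  qed
  have nzd: "y = 0" if yx: "y * x = 0" for y
  proof (rule ccontr)
    assume y: "y \<noteq> 0"
    obtain a where a: "a \<noteq> 0" "iE a \<in> {y. y * x = 0}"
    proof (rule stable_subspace_descends[of "{y. y * x = 0}" y])
      show "act \<sigma> y \<in> {y. y * x = 0}" if \<sigma>: "\<sigma> \<in> \<Gamma>" and y: "y \<in> {y. y * x = 0}" for \<sigma> y
      proof -
        interpret s: comm_ring_hom "act \<sigma>" by (rule act_hom[OF \<sigma>])
        have "act \<sigma> y * act \<sigma> x = 0" using y by (simp flip: s.hom_mult)
        moreover have "act \<sigma> y * x = act \<sigma> y * (c \<sigma> * act \<sigma> x)" using x \<sigma> unfolding twisted_fixed_def by simp
        ultimately show ?thesis by (simp add: mult.left_commute)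
      qed
    qed (use that yx y in \<open>auto simp: left_diff_distrib mult.assoc\<close>)
    then show False using Ann0 by simp
  qed
  obtain v where "x * v = 1" by (rule non_zero_divisor_unit[OF iS.comm_ring_hom_axioms F_basis nzd])
  then show thesis using that x unfolding twisted_fixed_def by blast
qed

end
end

section \<open>Triviality of the first Galois cohomology group\<close>

text \<open>
  A quotient group is trivial exactly if the subgroup is everything.  Most of the proof checks that
  the continuous cocycles form an abelian group.
\<close>
lemma galois_H1_trivial_iff:
  fixes \<phi> :: "'k::field \<Rightarrow> 's::field" and M :: "'m monoid"
  assumes M: "comm_group M"
    and act_closed: "\<And>\<sigma> x. \<sigma> \<in> galois_group \<phi> \<Longrightarrow> x \<in> carrier M \<Longrightarrow> act \<sigma> x \<in> carrier M"
    and act_mult: "\<And>\<sigma> x y. \<sigma> \<in> galois_group \<phi> \<Longrightarrow> x \<in> carrier M \<Longrightarrow> y \<in> carrier M \<Longrightarrow>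
      act \<sigma> (x \<otimes>\<^bsub>M\<^esub> y) = act \<sigma> x \<otimes>\<^bsub>M\<^esub> act \<sigma> y"
  shows "trivial_group (galois_H1 \<phi> M act) \<longleftrightarrow>
    (\<forall>c \<in> carrier (galois_Z1 \<phi> M act). \<exists>a\<in>carrier M. \<forall>\<sigma>\<in>galois_group \<phi>. c \<sigma> = inv\<^bsub>M\<^esub> a \<otimes>\<^bsub>M\<^esub> act \<sigma> a)"
    (is "_ \<longleftrightarrow> ?R")
proof -
  interpret M: comm_group M by fact
  let ?\<Gamma> = "galois_group \<phi>"
  define Z where "Z = galois_Z1 \<phi> M act"
  have Zc: "c \<in> carrier Z \<longleftrightarrow> c \<in> ?\<Gamma> \<rightarrow>\<^sub>E carrier M \<and> galois_continuous \<phi> c \<and>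
        (\<forall>\<sigma>\<in>?\<Gamma>. \<forall>\<rho>\<in>?\<Gamma>. c (\<sigma> \<circ> \<rho>) = c \<sigma> \<otimes>\<^bsub>M\<^esub> act \<sigma> (c \<rho>))" for c
    unfolding Z_def galois_Z1_def by simp
  have Zm: "c \<otimes>\<^bsub>Z\<^esub> d = (\<lambda>\<sigma>\<in>?\<Gamma>. c \<sigma> \<otimes>\<^bsub>M\<^esub> d \<sigma>)" for c d unfolding Z_def galois_Z1_def by simp
  have Z1: "\<one>\<^bsub>Z\<^esub> = (\<lambda>\<sigma>\<in>?\<Gamma>. \<one>\<^bsub>M\<^esub>)" unfolding Z_def galois_Z1_def by simp
  have cM: "c \<sigma> \<in> carrier M" if "c \<in> carrier Z" "\<sigma> \<in> ?\<Gamma>" for c \<sigma> using that unfolding Zc by auto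
  have cZ: "c (\<sigma> \<circ> \<rho>) = c \<sigma> \<otimes>\<^bsub>M\<^esub> act \<sigma> (c \<rho>)" if "c \<in> carrier Z" "\<sigma> \<in> ?\<Gamma>" "\<rho> \<in> ?\<Gamma>" for c \<sigma> \<rho>
    using that unfolding Zc by auto
  have cont: "\<exists>F. finite F \<and> (\<forall>\<rho>\<in>?\<Gamma>. (\<forall>x\<in>F. \<rho> x = \<sigma> x) \<longrightarrow> c \<rho> = c \<sigma>)" if "c \<in> carrier Z" "\<sigma> \<in> ?\<Gamma>" for c \<sigma>
    using that unfolding Zc galois_continuous_def by blast
  have act_one: "act \<sigma> \<one>\<^bsub>M\<^esub> = \<one>\<^bsub>M\<^esub>" if "\<sigma> \<in> ?\<Gamma>" for \<sigma>
  proof -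
    have a: "act \<sigma> \<one>\<^bsub>M\<^esub> \<in> carrier M" using act_closed[OF that M.one_closed] .
    have "act \<sigma> \<one>\<^bsub>M\<^esub> \<otimes>\<^bsub>M\<^esub> act \<sigma> \<one>\<^bsub>M\<^esub> = act \<sigma> \<one>\<^bsub>M\<^esub>"
      using act_mult[OF that M.one_closed M.one_closed] by simp
    then show ?thesis using M.l_cancel_one[OF a a] by blast
  qed
  have act_inv: "act \<sigma> (inv\<^bsub>M\<^esub> x) = inv\<^bsub>M\<^esub> (act \<sigma> x)" if "\<sigma> \<in> ?\<Gamma>" "x \<in> carrier M" for \<sigma> x
  proof -
    have "act \<sigma> (inv\<^bsub>M\<^esub> x) \<otimes>\<^bsub>M\<^esub> act \<sigma> x = \<one>\<^bsub>M\<^esub>"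
      using act_mult[of \<sigma> "inv\<^bsub>M\<^esub> x" x] act_one that by simp
    then show ?thesis using act_closed that by (intro M.inv_equality[symmetric]) auto
  qed
  have ext_eq: "c = d" if "c \<in> carrier Z" "d \<in> carrier Z" "\<And>\<sigma>. \<sigma> \<in> ?\<Gamma> \<Longrightarrow> c \<sigma> = d \<sigma>" for c d
    using that unfolding Zc by (meson PiE_ext)
  have Z_one: "\<one>\<^bsub>Z\<^esub> \<in> carrier Z"
    unfolding Zc Z1 by (auto simp: act_one galois_group_comp galois_continuous_def)
  have Z_mult: "c \<otimes>\<^bsub>Z\<^esub> d \<in> carrier Z" if c: "c \<in> carrier Z" and d: "d \<in> carrier Z" for c d
    unfolding Zc
  proof (intro conjI ballI)
    show "c \<otimes>\<^bsub>Z\<^esub> d \<in> ?\<Gamma> \<rightarrow>\<^sub>E carrier M" unfolding Zm using cM c d by auto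
    show "galois_continuous \<phi> (c \<otimes>\<^bsub>Z\<^esub> d)" unfolding galois_continuous_def
    proof
      fix \<sigma> assume \<sigma>: "\<sigma> \<in> ?\<Gamma>"
      obtain F where F: "finite F" "\<forall>\<rho>\<in>?\<Gamma>. (\<forall>x\<in>F. \<rho> x = \<sigma> x) \<longrightarrow> c \<rho> = c \<sigma>"
        using cont[OF c \<sigma>] by (elim exE conjE)
      obtain G where G: "finite G" "\<forall>\<rho>\<in>?\<Gamma>. (\<forall>x\<in>G. \<rho> x = \<sigma> x) \<longrightarrow> d \<rho> = d \<sigma>"
        using cont[OF d \<sigma>] by (elim exE conjE)
      show "\<exists>F. finite F \<and> (\<forall>\<rho>\<in>?\<Gamma>. (\<forall>x\<in>F. \<rho> x = \<sigma> x) \<longrightarrow> (c \<otimes>\<^bsub>Z\<^esub> d) \<rho> = (c \<otimes>\<^bsub>Z\<^esub> d) \<sigma>)"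
      proof (intro exI[of _ "F \<union> G"] conjI ballI impI)
        fix \<rho> assume \<rho>: "\<rho> \<in> ?\<Gamma>" and eq: "\<forall>x\<in>F \<union> G. \<rho> x = \<sigma> x"
        have "c \<rho> = c \<sigma>" by (rule F(2)[rule_format, OF \<rho>]) (use eq in simp)
        moreover have "d \<rho> = d \<sigma>" by (rule G(2)[rule_format, OF \<rho>]) (use eq in simp)
        ultimately show "(c \<otimes>\<^bsub>Z\<^esub> d) \<rho> = (c \<otimes>\<^bsub>Z\<^esub> d) \<sigma>" unfolding Zm using \<sigma> \<rho> by simp
      qed (use F(1) G(1) in simp)
    qed
    fix \<sigma> \<rho> assume \<sigma>: "\<sigma> \<in> ?\<Gamma>" and \<rho>: "\<rho> \<in> ?\<Gamma>"
    show "(c \<otimes>\<^bsub>Z\<^esub> d) (\<sigma> \<circ> \<rho>) = (c \<otimes>\<^bsub>Z\<^esub> d) \<sigma> \<otimes>\<^bsub>M\<^esub> act \<sigma> ((c \<otimes>\<^bsub>Z\<^esub> d) \<rho>)"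
      unfolding Zm using \<sigma> \<rho> galois_group_comp[OF \<sigma> \<rho>]
      by (simp add: cZ[OF c \<sigma> \<rho>] cZ[OF d \<sigma> \<rho>] act_mult[OF \<sigma> cM[OF c \<rho>] cM[OF d \<rho>]]
          M.m_ac cM[OF c] cM[OF d] act_closed)
  qed
  have Z_inv: "(\<lambda>\<sigma>\<in>?\<Gamma>. inv\<^bsub>M\<^esub> c \<sigma>) \<in> carrier Z" if c: "c \<in> carrier Z" for c
    unfolding Zc
  proof (intro conjI ballI)
    show "(\<lambda>\<sigma>\<in>?\<Gamma>. inv\<^bsub>M\<^esub> c \<sigma>) \<in> ?\<Gamma> \<rightarrow>\<^sub>E carrier M" using cM c by auto
    show "galois_continuous \<phi> (\<lambda>\<sigma>\<in>?\<Gamma>. inv\<^bsub>M\<^esub> c \<sigma>)" unfolding galois_continuous_def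
    proof
      fix \<sigma> assume \<sigma>: "\<sigma> \<in> ?\<Gamma>"
      obtain F where F: "finite F" "\<forall>\<rho>\<in>?\<Gamma>. (\<forall>x\<in>F. \<rho> x = \<sigma> x) \<longrightarrow> c \<rho> = c \<sigma>"
        using cont[OF c \<sigma>] by (elim exE conjE)
      show "\<exists>F. finite F \<and> (\<forall>\<rho>\<in>?\<Gamma>. (\<forall>x\<in>F. \<rho> x = \<sigma> x) \<longrightarrow>
          (\<lambda>\<sigma>\<in>?\<Gamma>. inv\<^bsub>M\<^esub> c \<sigma>) \<rho> = (\<lambda>\<sigma>\<in>?\<Gamma>. inv\<^bsub>M\<^esub> c \<sigma>) \<sigma>)"
      proof (intro exI[of _ F] conjI ballI impI)
        fix \<rho> assume \<rho>: "\<rho> \<in> ?\<Gamma>" and eq: "\<forall>x\<in>F. \<rho> x = \<sigma> x"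
        have "c \<rho> = c \<sigma>" by (rule F(2)[rule_format, OF \<rho>]) (use eq in simp)
        then show "(\<lambda>\<sigma>\<in>?\<Gamma>. inv\<^bsub>M\<^esub> c \<sigma>) \<rho> = (\<lambda>\<sigma>\<in>?\<Gamma>. inv\<^bsub>M\<^esub> c \<sigma>) \<sigma>" using \<sigma> \<rho> by simp
      qed (rule F(1))
    qed
    fix \<sigma> \<rho> assume \<sigma>: "\<sigma> \<in> ?\<Gamma>" and \<rho>: "\<rho> \<in> ?\<Gamma>"
    show "(\<lambda>\<sigma>\<in>?\<Gamma>. inv\<^bsub>M\<^esub> c \<sigma>) (\<sigma> \<circ> \<rho>) = (\<lambda>\<sigma>\<in>?\<Gamma>. inv\<^bsub>M\<^esub> c \<sigma>) \<sigma> \<otimes>\<^bsub>M\<^esub> act \<sigma> ((\<lambda>\<sigma>\<in>?\<Gamma>. inv\<^bsub>M\<^esub> c \<sigma>) \<rho>)"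
      using \<sigma> \<rho> galois_group_comp[OF \<sigma> \<rho>]
      by (simp add: cZ[OF c \<sigma> \<rho>] act_inv[OF \<sigma> cM[OF c \<rho>]] M.inv_mult cM[OF c] act_closed)
  qed
  interpret Z: comm_group Z
  proof (rule comm_groupI)
    show "\<one>\<^bsub>Z\<^esub> \<otimes>\<^bsub>Z\<^esub> c = c" if "c \<in> carrier Z" for c
      by (rule ext_eq[OF Z_mult[OF Z_one that] that]) (simp add: Zm Z1 cM[OF that])
    show "\<exists>d\<in>carrier Z. d \<otimes>\<^bsub>Z\<^esub> c = \<one>\<^bsub>Z\<^esub>" if c: "c \<in> carrier Z" for c
      by (rule bexI[OF _ Z_inv[OF c]], rule ext_eq[OF Z_mult[OF Z_inv[OF c] c] Z_one])
         (simp add: Zm Z1 cM[OF c])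
    show "c \<otimes>\<^bsub>Z\<^esub> d \<otimes>\<^bsub>Z\<^esub> e = c \<otimes>\<^bsub>Z\<^esub> (d \<otimes>\<^bsub>Z\<^esub> e)"
      if *: "c \<in> carrier Z" "d \<in> carrier Z" "e \<in> carrier Z" for c d e
      by (rule ext_eq[OF Z_mult[OF Z_mult[OF *(1,2)] *(3)] Z_mult[OF *(1) Z_mult[OF *(2,3)]]])
         (simp add: Zm M.m_assoc cM *)
    show "c \<otimes>\<^bsub>Z\<^esub> d = d \<otimes>\<^bsub>Z\<^esub> c" if *: "c \<in> carrier Z" "d \<in> carrier Z" for c d
      by (rule ext_eq[OF Z_mult[OF *] Z_mult[OF *(2,1)]]) (simp add: Zm M.m_comm cM *)
  qed (fact Z_mult Z_one)+
  define B where "B = galois_B1 \<phi> M act"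
  have B: "c \<in> B \<longleftrightarrow> c \<in> carrier Z \<and> (\<exists>a\<in>carrier M. \<forall>\<sigma>\<in>?\<Gamma>. c \<sigma> = inv\<^bsub>M\<^esub> a \<otimes>\<^bsub>M\<^esub> act \<sigma> a)" for c
    unfolding B_def galois_B1_def Z_def by simp
  have H: "galois_H1 \<phi> M act = Z Mod B" unfolding galois_H1_def Z_def B_def ..
  have one_B: "\<one>\<^bsub>Z\<^esub> \<in> B" unfolding B
    by (intro conjI Z.one_closed bexI[of _ "\<one>\<^bsub>M\<^esub>"]) (simp_all add: Z1 act_one)
  have "trivial_group (galois_H1 \<phi> M act) \<longleftrightarrow> carrier Z \<subseteq> B"
  proof
    assume "trivial_group (galois_H1 \<phi> M act)"
    then have *: "rcosets\<^bsub>Z\<^esub> B = {B}" unfolding H trivial_group_def FactGroup_def by simp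
    show "carrier Z \<subseteq> B"
    proof
      fix c assume c: "c \<in> carrier Z"
      have "B #>\<^bsub>Z\<^esub> c \<in> rcosets\<^bsub>Z\<^esub> B" unfolding RCOSETS_def using c by blast
      then have "B #>\<^bsub>Z\<^esub> c = B" using * by simp
      moreover have "\<one>\<^bsub>Z\<^esub> \<otimes>\<^bsub>Z\<^esub> c \<in> B #>\<^bsub>Z\<^esub> c" unfolding r_coset_def using one_B by blast
      ultimately show "c \<in> B" using c by simp
    qed
  next
    assume "carrier Z \<subseteq> B"
    then have BZ: "B = carrier Z" using B by blast
    have "group (Z Mod B)" unfolding BZ by (rule normal.factorgroup_is_group[OF Z.normal_self])
    moreover have "carrier (Z Mod B) = {\<one>\<^bsub>Z Mod B\<^esub>}"
      unfolding BZ FactGroup_def RCOSETS_def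
      using Z.coset_join2[OF _ Z.subgroup_self] Z.one_closed by auto
    ultimately show "trivial_group (galois_H1 \<phi> M act)" unfolding H trivial_group_def by blast
  qed
  also have "\<dots> \<longleftrightarrow> ?R" unfolding subset_iff B unfolding Z_def by blast
  finally show ?thesis .
qed

section \<open>The algebra with involution\<close>

text \<open>
  \<open>K\<close> is written as \<open>k + k \<theta>\<close> with \<open>\<theta>\<^sup>2 = d\<close>, and \<open>\<iota>\<close> changes the sign of \<open>\<theta>\<close>.  That \<open>L\<close> is a
  product of fields appears as von Neumann regularity.
\<close>
locale unitary_algebra =
  fixes \<phi>L :: "'k::field \<Rightarrow> 'l::comm_ring_1" and \<phi>K :: "'k \<Rightarrow> 'c::comm_ring_1" and \<iota> :: "'c \<Rightarrow> 'c"
    and iL :: "'l \<Rightarrow> 'e::comm_ring_1" and iK :: "'c \<Rightarrow> 'e"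
    and bL :: "nat \<Rightarrow> 'l" and \<theta> :: 'c and d :: 'k
  assumes two: "(2::'k) \<noteq> 0" and three: "(3::'k) \<noteq> 0"
    and L_hom: "comm_ring_hom \<phi>L" and L_basis: "free_basis \<phi>L {..<3} bL"
    and L_regular: "\<And>x::'l. \<exists>y. x * x * y = x"
    and K_hom: "comm_ring_hom \<phi>K"
    and K_basis: "free_basis \<phi>K {..<2::nat} (\<lambda>i. if i = 0 then 1 else \<theta>)"
    and \<theta>_square: "\<theta> * \<theta> = \<phi>K d" and d_nonzero: "d \<noteq> 0"
    and \<iota>_hom: "comm_ring_hom \<iota>" and \<iota>_scalar: "\<iota> (\<phi>K a) = \<phi>K a" and \<iota>_\<theta>: "\<iota> \<theta> = - \<theta>"
    and tp: "tensor_product \<phi>L \<phi>K iL iK"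
begin

sublocale \<phi>L: comm_ring_hom \<phi>L by (rule L_hom)
sublocale \<phi>K: comm_ring_hom \<phi>K by (rule K_hom)
sublocale \<iota>: comm_ring_hom \<iota> by (rule \<iota>_hom)
sublocale iL: comm_ring_hom iL by (rule tensor_productD[OF tp])
sublocale iK: comm_ring_hom iK by (rule tensor_productD[OF tp])

lemma iLK: "iL (\<phi>L c) = iK (\<phi>K c)" by (rule tensor_productD[OF tp])

abbreviation bK :: "nat \<Rightarrow> 'c" where "bK \<equiv> \<lambda>i. if i = 0 then 1 else \<theta>"

lemma sum_lessThan_2: "(\<Sum>i<2. f i) = f 0 + f (1::nat)" for f :: "nat \<Rightarrow> 'z::comm_monoid_add"
  by (simp add: numeral_2_eq_2)

lemma K_decomp: obtains m n where "x = \<phi>K m + \<phi>K n * \<theta>"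
proof -
  obtain c where "x = (\<Sum>i<2. \<phi>K (c i) * bK i)" using free_basisD(2)[OF K_basis] by blast
  then show thesis using that[of "c 0" "c 1"] by (simp add: sum_lessThan_2)
qed

lemma \<iota>_decomp: "\<iota> (\<phi>K m + \<phi>K n * \<theta>) = \<phi>K m - \<phi>K n * \<theta>"
  by (simp add: \<iota>.hom_add \<iota>.hom_mult \<iota>_scalar \<iota>_\<theta>)

lemma \<iota>_invol: "\<iota> (\<iota> x) = x"
proof -
  obtain m n where "x = \<phi>K m + \<phi>K n * \<theta>" by (rule K_decomp)
  then show ?thesis by (simp add: \<iota>_decomp \<iota>.hom_minus \<iota>.hom_mult \<iota>_scalar \<iota>_\<theta>)
qed

lemma \<phi>K_eq_0: "\<phi>K x = 0 \<longleftrightarrow> x = 0"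
  by (rule field_hom_eq_0_iff[OF K_hom])

lemma \<phi>L_eq_0: "\<phi>L x = 0 \<longleftrightarrow> x = 0"
  by (rule field_hom_eq_0_iff[OF L_hom])

text \<open>
  Multiplication by \<open>m + n \<theta>\<close> has the matrix \<open>A\<close> with determinant \<open>m\<^sup>2 - d n\<^sup>2\<close>.
\<close>
lemma K_norm: "\<phi>K (alg_norm \<phi>K \<mu>) = \<mu> * \<iota> \<mu>"
proof -
  obtain m n where \<mu>: "\<mu> = \<phi>K m + \<phi>K n * \<theta>" by (rule K_decomp)
  define A where "A i j = (if i = j then m else if i = 0 then d * n else n)" for i j :: nat
  have "\<mu> * bK j = (\<Sum>i<2. \<phi>K (A i j) * bK i)" if "j < 2" for j
  proof -
    have j: "j = 0 \<or> j = 1" using that by auto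
    have t: "\<theta> * (\<theta> * z) = \<phi>K d * z" for z by (simp add: mult.assoc[symmetric] \<theta>_square)
    show ?thesis using j unfolding \<mu> sum_lessThan_2 A_def by (auto simp: algebra_simps \<phi>K.hom_mult t)
  qed
  from alg_norm_trace_eq(1)[OF K_hom K_basis this]
  have N: "alg_norm \<phi>K \<mu> = m * m - d * n * n" by (simp add: det_mat_2 A_def)
  have "\<mu> * \<iota> \<mu> = \<phi>K m * \<phi>K m - \<phi>K n * \<phi>K n * (\<theta> * \<theta>)"
    unfolding \<mu> \<iota>_decomp by (simp add: algebra_simps)
  then show ?thesis unfolding N \<theta>_square by (simp add: \<phi>K.hom_minus \<phi>K.hom_mult mult_ac)
qed

lemma EK_basis: "free_basis iK {..<3} (\<lambda>l. iL (bL l))"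
  by (rule tensor_basis_left[OF tp L_hom K_hom L_basis])

lemma EL_basis: "free_basis iL {..<2} (\<lambda>m. iK (bK m))"
  by (rule tensor_basis_right[OF tp L_hom K_hom K_basis])

text \<open>
  The image of \<open>\<theta>\<close> in \<open>E\<close>, so that \<open>E\<close> is \<open>L + L \<omega>\<close> with \<open>\<omega>\<^sup>2 = d\<close>.
\<close>
definition \<omega> where "\<omega> = iK \<theta>"

lemma E_decomp: obtains a b where "x = iL a + iL b * \<omega>"
proof -
  obtain c where "x = (\<Sum>i<2. iL (c i) * iK (bK i))" using free_basisD(2)[OF EL_basis] by blast
  then show thesis using that[of "c 0" "c 1"] by (simp add: sum_lessThan_2 \<omega>_def)
qed

lemma E_decomp_0: "iL a + iL b * \<omega> = 0 \<Longrightarrow> a = 0 \<and> b = 0"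
  using free_basisD(3)[OF EL_basis, of "\<lambda>i. if i = 0 then a else b" 0]
    free_basisD(3)[OF EL_basis, of "\<lambda>i. if i = 0 then a else b" 1]
  by (simp add: sum_lessThan_2 \<omega>_def)

lemma E_decomp_unique: "iL a + iL b * \<omega> = iL a' + iL b' * \<omega> \<Longrightarrow> a = a' \<and> b = b'"
  using E_decomp_0[of "a - a'" "b - b'"] by (simp add: iL.hom_minus algebra_simps)

lemma iL_inj: "iL a = iL b \<longleftrightarrow> a = b"
  using E_decomp_unique[of a 0 b 0] by auto

lemma iL_eq_0: "iL a = 0 \<longleftrightarrow> a = 0"
  using iL_inj[of a 0] by simp

lemma the_inv_iL: "the_inv iL (iL a) = a"
  by (rule the_inv_f_f) (simp add: inj_def iL_inj)

lemma \<omega>_square: "\<omega> * \<omega> = iL (\<phi>L d)"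
  unfolding \<omega>_def by (simp add: iK.hom_mult[symmetric] \<theta>_square iLK)

definition \<tau> where "\<tau> = unitary_inv \<iota> iL iK"

lemma \<tau>_hom: "comm_ring_hom \<tau>" and \<tau>_iL: "\<tau> (iL a) = iL a" and \<tau>_iK: "\<tau> (iK c) = iK (\<iota> c)"
proof -
  have *: "iL (id (\<phi>L c)) = iK (\<iota> (\<phi>K c))" for c by (simp add: \<iota>_scalar iLK)
  note tm = tensor_map[where f = id and g = \<iota>, OF tp comm_ring_hom_id \<iota>_hom iL.comm_ring_hom_axioms iK.comm_ring_hom_axioms *]
  show "comm_ring_hom \<tau>" "\<tau> (iL a) = iL a" "\<tau> (iK c) = iK (\<iota> c)"
    unfolding \<tau>_def unitary_inv_def using tm(1) tm(3)[of a] tm(4)[of c] by simp_all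
qed

sublocale \<tau>: comm_ring_hom \<tau> by (rule \<tau>_hom)

lemma \<tau>_decomp: "\<tau> (iL a + iL b * \<omega>) = iL a - iL b * \<omega>"
  by (simp add: \<tau>.hom_add \<tau>.hom_mult \<tau>_iL \<tau>_iK \<omega>_def \<iota>_\<theta> iK.hom_uminus)

lemma \<tau>_invol: "\<tau> (\<tau> x) = x"
proof -
  obtain a b where "x = iL a + iL b * \<omega>" by (rule E_decomp)
  moreover from this have "\<tau> x = iL a + iL (- b) * \<omega>" by (simp add: \<tau>_decomp iL.hom_uminus)
  ultimately show ?thesis by (simp only: \<tau>_decomp) (simp add: iL.hom_uminus)
qed

lemma half_L: "2 * (1/2) = (1::'k)" using two by simp

sublocale L: cubic_algebra \<phi>L bL "1/2" by unfold_locales (fact L_basis half_L)+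

lemma two_cancel_L: "2 * (x::'l) = 0 \<Longrightarrow> x = 0" by (rule L.two_cancel)

lemma half_K: "2 * \<phi>K (1/2) = 1" using half_L by (metis \<phi>K.hom_mult \<phi>K.hom_numeral \<phi>K.hom_one)

sublocale EK: cubic_algebra iK "\<lambda>l. iL (bL l)" "\<phi>K (1/2)" by unfold_locales (fact EK_basis half_K)+

lemma \<tau>_fixed:
  assumes "\<tau> x = x" obtains a where "x = iL a"
proof -
  obtain a b where x: "x = iL a + iL b * \<omega>" by (rule E_decomp)
  then have "2 * (iL b * \<omega>) = 0" using assms by (simp add: \<tau>_decomp eq_iff_diff_eq_0[of "_ - _"])
  then have "iL b * \<omega> = 0" by (rule EK.two_cancel)
  then show thesis using that x by simp
qed

lemma NE_iL: "alg_norm iK (iL x) = \<phi>K (alg_norm \<phi>L x)"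
  by (rule alg_norm_trace_hom(1)[OF L_hom iK.comm_ring_hom_axioms iL.comm_ring_hom_axioms K_hom iLK L_basis EK_basis])

lemma EK_basis_\<tau>: "free_basis iK {..<3} (\<lambda>l. \<tau> (iL (bL l)))"
  using EK_basis by (simp add: \<tau>_iL)

lemma NE_\<tau>: "alg_norm iK (\<tau> x) = \<iota> (alg_norm iK x)"
  by (rule alg_norm_trace_hom(1)[OF iK.comm_ring_hom_axioms iK.comm_ring_hom_axioms \<tau>_hom \<iota>_hom \<tau>_iK EK_basis EK_basis_\<tau>])

text \<open>
  Let \<open>x = a + b \<omega>\<close> have norm \<open>n = x * \<tau> x\<close> in \<open>L\<close>.  On the support of \<open>n\<close>, \<open>x\<close> is invertible.  On its
  complement, cut out by the idempotent \<open>e\<close>, we have \<open>x\<^sup>2 = 2 a x\<close>, which handles the support \<open>f\<close> of \<open>a\<close>.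
  Where both \<open>n\<close> and \<open>a\<close> vanish, so does \<open>b\<close>.
\<close>
lemma E_regular: "\<exists>y. x * x * y = (x::'e)"
proof -
  obtain a b where x: "x = iL a + iL b * \<omega>" by (rule E_decomp)
  define n where "n = a * a - \<phi>L d * b * b"
  have xx: "x * \<tau> x = iL n"
  proof -
    have "x * \<tau> x = iL a * iL a - iL b * iL b * (\<omega> * \<omega>)" unfolding x \<tau>_decomp by (simp add: algebra_simps)
    then show ?thesis unfolding \<omega>_square n_def by (simp add: iL.hom_minus iL.hom_mult mult_ac)
  qed
  obtain n' where n': "n * n * n' = n" using L_regular by blast
  obtain a' where a': "a * a * a' = a" using L_regular by blast
  define e where "e = 1 - n * n'"
  define f where "f = a * a'"
  have en: "e * n = 0" unfolding e_def using n' by (simp add: algebra_simps)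
  have xa: "x * x = iL (2 * a) * x - iL n"
  proof -
    have "\<tau> x = iL (2 * a) - x" unfolding x \<tau>_decomp by (simp add: iL.hom_mult iL.hom_numeral)
    then have "x * (iL (2 * a) - x) = iL n" using xx by simp
    then show ?thesis by (simp add: algebra_simps)
  qed
  have ff: "f * a = a" unfolding f_def using a' by (simp add: mult_ac)
  have b0: "e * (1 - f) * b = 0"
  proof -
    have "e * (1 - f) * (\<phi>L d * b * b) = 0"
    proof -
      have "\<phi>L d * b * b = a * a - n" unfolding n_def by simp
      moreover have "e * (1 - f) * (a * a - n) = e * ((1 - f) * a) * a - (1 - f) * (e * n)"
        by (simp add: algebra_simps)
      moreover have "(1 - f) * a = 0" using ff by (simp add: algebra_simps)
      ultimately show ?thesis using en by simp
    qed
    then have "\<phi>L (inverse d) * (e * (1 - f) * (\<phi>L d * b * b)) = 0" by simp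
    moreover have "\<phi>L (inverse d) * \<phi>L d = 1" using d_nonzero by (metis \<phi>L.hom_mult \<phi>L.hom_one left_inverse)
    moreover have "\<phi>L (inverse d) * (e * (1 - f) * (\<phi>L d * b * b)) = (\<phi>L (inverse d) * \<phi>L d) * (e * (1 - f) * b * b)"
      by (simp add: algebra_simps)
    ultimately have 1: "e * (1 - f) * b * b = 0" by simp
    obtain b' where "b * b * b' = b" using L_regular by blast
    then have "e * (1 - f) * b = e * (1 - f) * b * b * b'" by (simp add: mult.assoc)
    then show ?thesis unfolding 1 by simp
  qed
  have x0: "iL (e * (1 - f)) * x = 0"
  proof -
    have "e * (1 - f) * a = e * (a - f * a)" by (simp add: algebra_simps)
    then have a0: "e * (1 - f) * a = 0" unfolding ff by simp
    have "iL (e * (1 - f)) * x = iL (e * (1 - f) * a) + iL (e * (1 - f) * b) * \<omega>"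
      unfolding x by (simp add: iL.hom_mult distrib_left mult.assoc)
    then show ?thesis unfolding a0 b0 by simp
  qed
  define h where "h = \<phi>L (1/2)"
  have h2: "2 * h = 1" unfolding h_def by (metis half_L \<phi>L.hom_mult \<phi>L.hom_numeral \<phi>L.hom_one)
  define y where "y = iL n' * \<tau> x + iL (e * h * a')"
  have "x * x * y = x"
  proof -
    have 1: "x * x * (iL n' * \<tau> x) = iL (n * n') * x"
    proof -
      have "x * x * (iL n' * \<tau> x) = (x * \<tau> x) * iL n' * x" by (simp add: mult_ac)
      then show ?thesis unfolding xx iL.hom_mult .
    qed
    have 2: "x * x * iL (e * h * a') = iL (e * f) * x"
    proof -
      have "x * x * iL (e * h * a') = iL (2 * h * (e * (a * a'))) * x - iL (h * a' * (e * n))"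
        unfolding xa by (simp add: iL.hom_mult algebra_simps)
      then show ?thesis unfolding h2 en f_def by simp
    qed
    have "x * x * y = iL (n * n') * x + iL (e * f) * x" unfolding y_def distrib_left 1 2 ..
    also have "\<dots> = iL (n * n' + e * f) * x" by (simp add: iL.hom_add distrib_right)
    also have "n * n' + e * f = 1 - e * (1 - f)" unfolding e_def by (simp add: algebra_simps)
    also have "iL (1 - e * (1 - f)) * x = x - iL (e * (1 - f)) * x"
      by (simp only: iL.hom_minus iL.hom_one left_diff_distrib mult_1)
    also have "\<dots> = x" unfolding x0 by simp
    finally show ?thesis .
  qed
  then show ?thesis by blast
qed

end

section \<open>The cohomology of the unitary torus\<close>

text \<open>
  If \<open>n\<close> and \<open>a\<close> are not \<open>0\<close> then \<open>X\<^sup>n - a\<close> is separable: \<open>X\<close> times its derivative minus \<open>n\<close> times the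
  polynomial is the unit \<open>n a\<close>.
\<close>
lemma separably_closed_root:
  fixes \<phi> :: "'k::field \<Rightarrow> 's::field" and a :: 's
  assumes sc: "separable_closure \<phi>" and n: "of_nat n \<noteq> (0::'s)" and a: "a \<noteq> 0"
  obtains s where "s ^ n = a"
proof -
  define p where "p = monom 1 n - [:a:]"
  have n0: "n \<noteq> 0" using n by (cases n) auto
  have eval: "poly p x = x ^ n - a" for x unfolding p_def by (simp add: poly_monom)
  have "separable_poly p" unfolding separable_poly_def
  proof (rule coprimeI)
    fix c assume c: "c dvd p" "c dvd pderiv p"
    have "pderiv p = monom (of_nat n) (n - 1)" unfolding p_def by (simp add: pderiv_diff pderiv_monom)
    then have "monom 1 1 * pderiv p - Polynomial.smult (of_nat n) p = [:of_nat n * a:]"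
      unfolding p_def using n0 by (simp add: mult_monom smult_diff_right smult_monom)
    moreover have "c dvd monom 1 1 * pderiv p - Polynomial.smult (of_nat n) p"
      using c by (intro dvd_diff dvd_mult dvd_smult)
    ultimately have "c dvd [:of_nat n * a:]" by simp
    moreover have "is_unit [:of_nat n * a:]" using n a by (simp add: is_unit_pCons_iff)
    ultimately show "is_unit c" by (rule dvd_unit_imp_unit)
  qed
  moreover have "degree p > 0"
  proof -
    have "coeff p n = 1" unfolding p_def using n0 by (simp add: coeff_pCons split: nat.split)
    then have "n \<le> degree p" by (intro le_degree) simp
    then show ?thesis using n0 by simp
  qed
  ultimately obtain s where "poly p s = 0" using sc unfolding separable_closure_def by blast
  then show thesis using that eval by simp
qed

locale unitary_torus = unitary_algebra \<phi>L \<phi>K \<iota> iL iK bL \<theta> d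
  for \<phi>L :: "'k::field \<Rightarrow> 'l::comm_ring_1" and \<phi>K :: "'k \<Rightarrow> 'c::comm_ring_1" and \<iota> :: "'c \<Rightarrow> 'c"
    and iL :: "'l \<Rightarrow> 'e::comm_ring_1" and iK :: "'c \<Rightarrow> 'e" and bL \<theta> d +
  fixes \<phi>S :: "'k \<Rightarrow> 's::field" and jK :: "'c \<Rightarrow> 'd::comm_ring_1" and jS :: "'s \<Rightarrow> 'd"
    and iE :: "'e \<Rightarrow> 'f::comm_ring_1" and iS :: "'s \<Rightarrow> 'f"
  assumes sc: "separable_closure \<phi>S"
    and tpD: "tensor_product \<phi>K \<phi>S jK jS" and tpF: "tensor_product (iL \<circ> \<phi>L) \<phi>S iE iS"
begin

abbreviation \<phi>E where "\<phi>E \<equiv> iL \<circ> \<phi>L"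

lemma \<phi>E_eq: "\<phi>E = iK \<circ> \<phi>K" by (rule ext) (simp add: iLK)

text \<open>
  The factors are ordered so that the same basis exhibits \<open>E \<otimes> S\<close> as free over \<open>S\<close> and, by cancelling
  the basis of \<open>K\<close>, as free over \<open>K \<otimes> S\<close>.
\<close>
abbreviation bE :: "nat \<times> nat \<Rightarrow> 'e" where "bE \<equiv> \<lambda>(l, m). iL (bL l) * iK (bK m)"

lemma E_basis: "free_basis \<phi>E ({..<3} \<times> {..<2}) bE"
  unfolding \<phi>E_eq by (rule free_basis_tower[OF K_hom iK.comm_ring_hom_axioms EK_basis K_basis])

sublocale F: galois_tensor \<phi>E \<phi>S iE iS "{..<3} \<times> {..<2}" bE
  by (rule galois_tensor.intro[OF comm_ring_hom_comp[OF iL.comm_ring_hom_axioms L_hom] sc tpF E_basis])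

sublocale D: galois_tensor \<phi>K \<phi>S jK jS "{..<2}" bK
  by (rule galois_tensor.intro[OF K_hom sc tpD K_basis])

lemma jKS: "jK (\<phi>K c) = jS (\<phi>S c)" by (rule tensor_productD(3)[OF tpD])

lemma iES: "iE (iL (\<phi>L c)) = iS (\<phi>S c)" using tensor_productD(3)[OF tpF, of c] by simp

text \<open>
  The structure map of \<open>E \<otimes> S\<close> as an algebra over \<open>K \<otimes> S\<close>.
\<close>
definition \<kappa> where "\<kappa> = tensor_map jK jS iE iS iK id"

lemma \<kappa>_hom: "comm_ring_hom \<kappa>" and \<kappa>_jK: "\<kappa> (jK c) = iE (iK c)" and \<kappa>_jS: "\<kappa> (jS s) = iS s"
proof -
  have *: "iE (iK (\<phi>K c)) = iS (id (\<phi>S c))" for c using iES[of c] by (simp add: iLK)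
  note tm = tensor_map[where f = iK and g = id, OF tpD iK.comm_ring_hom_axioms comm_ring_hom_id F.iE.comm_ring_hom_axioms F.iS.comm_ring_hom_axioms *]
  show "comm_ring_hom \<kappa>" "\<kappa> (jK c) = iE (iK c)" "\<kappa> (jS s) = iS s"
    unfolding \<kappa>_def using tm(1) tm(3)[of c] tm(4)[of s] by simp_all
qed

sublocale \<kappa>: comm_ring_hom \<kappa> by (rule \<kappa>_hom)

lemma FD_basis: "free_basis \<kappa> {..<3} (\<lambda>l. iE (iL (bL l)))"
proof (rule free_basis_tower_cancel[OF D.iS.comm_ring_hom_axioms \<kappa>_hom _ D.F_basis])
  have "\<kappa> \<circ> jS = iS" by (rule ext) (simp add: \<kappa>_jS)
  moreover have "(\<lambda>x. iE (bE x)) = (\<lambda>(l, m). iE (iL (bL l)) * \<kappa> (jK (bK m)))"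
    by (rule ext) (auto simp: F.iE.hom_mult \<kappa>_jK)
  ultimately show "free_basis (\<kappa> \<circ> jS) ({..<3} \<times> {..<2}) (\<lambda>(l, m). iE (iL (bL l)) * \<kappa> (jK (bK m)))"
    using F.F_basis by simp
qed simp

abbreviation NF where "NF \<equiv> alg_norm \<kappa>"

lemmas NF_mult = alg_norm_mult[OF \<kappa>_hom FD_basis]
lemmas NF_one = alg_norm_one[OF \<kappa>_hom FD_basis]
lemmas NF_scalar = alg_norm_scalar(1)[OF \<kappa>_hom FD_basis]

lemma NF_iE: "NF (iE x) = jK (alg_norm iK x)"
  by (rule alg_norm_trace_hom(1)[OF iK.comm_ring_hom_axioms \<kappa>_hom F.iE.comm_ring_hom_axioms
        D.iE.comm_ring_hom_axioms \<kappa>_jK[symmetric] EK_basis FD_basis])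

lemma act_\<kappa>:
  assumes \<sigma>: "\<sigma> \<in> galois_group \<phi>S"
  shows "F.act \<sigma> (\<kappa> x) = \<kappa> (D.act \<sigma> x)"
proof -
  interpret f: comm_ring_hom "F.act \<sigma>" by (rule F.act_hom[OF \<sigma>])
  interpret d: comm_ring_hom "D.act \<sigma>" by (rule D.act_hom[OF \<sigma>])
  show ?thesis
    by (rule tensor_ext[OF tpD, of "\<lambda>x. F.act \<sigma> (\<kappa> x)" "\<lambda>x. \<kappa> (D.act \<sigma> x)"])
       (simp_all add: \<kappa>.hom_add f.hom_add d.hom_add \<kappa>.hom_mult f.hom_mult d.hom_mult
         \<kappa>_jK \<kappa>_jS F.act_iE[OF \<sigma>] F.act_iS[OF \<sigma>] D.act_iE[OF \<sigma>] D.act_iS[OF \<sigma>])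
qed

lemma NF_act:
  assumes \<sigma>: "\<sigma> \<in> galois_group \<phi>S"
  shows "NF (F.act \<sigma> x) = D.act \<sigma> (NF x)"
  by (rule alg_norm_trace_hom(1)[OF \<kappa>_hom \<kappa>_hom F.act_hom[OF \<sigma>] D.act_hom[OF \<sigma>] act_\<kappa>[OF \<sigma>] FD_basis])
     (simp add: F.act_iE[OF \<sigma>] FD_basis)

definition \<tau>F where "\<tau>F = tensor_map iE iS iE iS \<tau> id"
definition \<iota>D where "\<iota>D = tensor_map jK jS jK jS \<iota> id"

lemma \<tau>F_hom: "comm_ring_hom \<tau>F" and \<tau>F_iE: "\<tau>F (iE x) = iE (\<tau> x)" and \<tau>F_iS: "\<tau>F (iS s) = iS s"
proof -
  have *: "iE (\<tau> (\<phi>E c)) = iS (id (\<phi>S c))" for c using iES[of c] by (simp add: \<tau>_iL)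
  note tm = tensor_map[where f = \<tau> and g = id, OF tpF \<tau>_hom comm_ring_hom_id F.iE.comm_ring_hom_axioms F.iS.comm_ring_hom_axioms *]
  show "comm_ring_hom \<tau>F" "\<tau>F (iE x) = iE (\<tau> x)" "\<tau>F (iS s) = iS s"
    unfolding \<tau>F_def using tm(1) tm(3)[of x] tm(4)[of s] by simp_all
qed

lemma \<iota>D_hom: "comm_ring_hom \<iota>D" and \<iota>D_jK: "\<iota>D (jK c) = jK (\<iota> c)" and \<iota>D_jS: "\<iota>D (jS s) = jS s"
proof -
  have *: "jK (\<iota> (\<phi>K c)) = jS (id (\<phi>S c))" for c using jKS[of c] by (simp add: \<iota>_scalar)
  note tm = tensor_map[where f = \<iota> and g = id, OF tpD \<iota>_hom comm_ring_hom_id D.iE.comm_ring_hom_axioms D.iS.comm_ring_hom_axioms *]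
  show "comm_ring_hom \<iota>D" "\<iota>D (jK c) = jK (\<iota> c)" "\<iota>D (jS s) = jS s"
    unfolding \<iota>D_def using tm(1) tm(3)[of c] tm(4)[of s] by simp_all
qed

sublocale \<tau>F: comm_ring_hom \<tau>F by (rule \<tau>F_hom)
sublocale \<iota>D: comm_ring_hom \<iota>D by (rule \<iota>D_hom)

lemma \<tau>F_\<kappa>: "\<tau>F (\<kappa> x) = \<kappa> (\<iota>D x)"
  by (rule tensor_ext[OF tpD, of "\<lambda>x. \<tau>F (\<kappa> x)" "\<lambda>x. \<kappa> (\<iota>D x)"])
     (simp_all add: \<kappa>.hom_add \<tau>F.hom_add \<iota>D.hom_add \<kappa>.hom_mult \<tau>F.hom_mult \<iota>D.hom_mult
         \<kappa>_jK \<kappa>_jS \<tau>F_iE \<tau>F_iS \<iota>D_jK \<iota>D_jS \<tau>_iK)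

lemma NF_\<tau>F: "NF (\<tau>F x) = \<iota>D (NF x)"
  by (rule alg_norm_trace_hom(1)[OF \<kappa>_hom \<kappa>_hom \<tau>F_hom \<iota>D_hom \<tau>F_\<kappa> FD_basis])
     (simp add: \<tau>F_iE \<tau>_iL FD_basis)

lemma \<tau>F_act:
  assumes \<sigma>: "\<sigma> \<in> galois_group \<phi>S"
  shows "\<tau>F (F.act \<sigma> x) = F.act \<sigma> (\<tau>F x)"
proof -
  interpret f: comm_ring_hom "F.act \<sigma>" by (rule F.act_hom[OF \<sigma>])
  show ?thesis
    by (rule tensor_ext[OF tpF, of "\<lambda>x. \<tau>F (F.act \<sigma> x)" "\<lambda>x. F.act \<sigma> (\<tau>F x)"])
       (simp_all add: f.hom_add \<tau>F.hom_add f.hom_mult \<tau>F.hom_mult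
         \<tau>F_iE \<tau>F_iS F.act_iE[OF \<sigma>] F.act_iS[OF \<sigma>])
qed

lemma \<tau>F_invol: "\<tau>F (\<tau>F x) = x"
  by (rule tensor_ext[OF tpF, of "\<lambda>x. \<tau>F (\<tau>F x)" "\<lambda>x. x"])
     (simp_all add: \<tau>F.hom_add \<tau>F.hom_mult \<tau>F_iE \<tau>F_iS \<tau>_invol)

abbreviation \<Gamma> where "\<Gamma> \<equiv> galois_group \<phi>S"

text \<open>
  The points of the torus over \<open>S\<close>.  By the first condition defining them, inversion is \<open>\<tau>F\<close>.
\<close>
definition M where "M = SU_points iK \<tau> jK jS iE iS"

lemma M_carrier: "x \<in> carrier M \<longleftrightarrow> x * \<tau>F x = 1 \<and> NF x = 1"
  unfolding M_def SU_points_def \<tau>F_def \<kappa>_def by simp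

lemma M_mult: "x \<otimes>\<^bsub>M\<^esub> y = x * y" and M_one: "\<one>\<^bsub>M\<^esub> = 1"
  unfolding M_def SU_points_def by simp_all

lemma M_\<tau>F: "x \<in> carrier M \<Longrightarrow> \<tau>F x \<in> carrier M"
  unfolding M_carrier by (simp add: \<tau>F_invol NF_\<tau>F mult.commute)

lemma M_comm_group: "comm_group M"
proof (rule comm_groupI)
  fix x y assume xy: "x \<in> carrier M" "y \<in> carrier M"
  have "x * y * \<tau>F (x * y) = (x * \<tau>F x) * (y * \<tau>F y)" by (simp add: \<tau>F.hom_mult mult_ac)
  then show "x \<otimes>\<^bsub>M\<^esub> y \<in> carrier M" using xy unfolding M_carrier M_mult by (simp add: NF_mult)
next
  fix x assume "x \<in> carrier M"
  then show "\<exists>y\<in>carrier M. y \<otimes>\<^bsub>M\<^esub> x = \<one>\<^bsub>M\<^esub>"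
    by (intro bexI[of _ "\<tau>F x"] M_\<tau>F) (auto simp: M_mult M_one M_carrier mult.commute)
qed (simp_all add: M_carrier M_mult M_one NF_one mult_ac)

lemma M_inv: "x \<in> carrier M \<Longrightarrow> inv\<^bsub>M\<^esub> x = \<tau>F x"
proof -
  interpret M: comm_group M by (rule M_comm_group)
  assume x: "x \<in> carrier M"
  have "\<tau>F x \<otimes>\<^bsub>M\<^esub> x = \<one>\<^bsub>M\<^esub>" using x unfolding M_carrier M_mult M_one by (simp add: mult.commute)
  then show ?thesis using M.inv_equality M_\<tau>F x by blast
qed

lemma M_act:
  assumes \<sigma>: "\<sigma> \<in> \<Gamma>" and x: "x \<in> carrier M"
  shows "F.act \<sigma> x \<in> carrier M"
proof -
  interpret f: comm_ring_hom "F.act \<sigma>" by (rule F.act_hom[OF \<sigma>])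
  interpret d: comm_ring_hom "D.act \<sigma>" by (rule D.act_hom[OF \<sigma>])
  show ?thesis using x unfolding M_carrier by (simp add: \<tau>F_act[OF \<sigma>] NF_act[OF \<sigma>] f.hom_mult[symmetric])
qed

lemma H1_trivial_iff_coboundary:
  "trivial_group (galois_H1 \<phi>S M F.act) \<longleftrightarrow>
    (\<forall>c \<in> carrier (galois_Z1 \<phi>S M F.act). \<exists>a\<in>carrier M. \<forall>\<sigma>\<in>\<Gamma>. c \<sigma> = \<tau>F a * F.act \<sigma> a)"
proof -
  have "trivial_group (galois_H1 \<phi>S M F.act) \<longleftrightarrow>
    (\<forall>c \<in> carrier (galois_Z1 \<phi>S M F.act). \<exists>a\<in>carrier M. \<forall>\<sigma>\<in>\<Gamma>. c \<sigma> = inv\<^bsub>M\<^esub> a \<otimes>\<^bsub>M\<^esub> F.act \<sigma> a)"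
  proof (rule galois_H1_trivial_iff[OF M_comm_group M_act])
    fix \<sigma> x y assume "\<sigma> \<in> \<Gamma>"
    interpret f: comm_ring_hom "F.act \<sigma>" by (rule F.act_hom) fact
    show "F.act \<sigma> (x \<otimes>\<^bsub>M\<^esub> y) = F.act \<sigma> x \<otimes>\<^bsub>M\<^esub> F.act \<sigma> y" unfolding M_mult by (rule f.hom_mult)
  qed
  then show ?thesis by (simp add: M_inv M_mult)
qed

lemma \<phi>S_eq_0: "\<phi>S x = 0 \<longleftrightarrow> x = 0" by (rule field_hom_eq_0_iff[OF F.S_hom])

text \<open>
  With \<open>\<delta>\<^sup>2 = d\<close> in \<open>S\<close>, the element \<open>t = \<theta> / \<delta>\<close> has square \<open>1\<close>, and \<open>\<epsilon> = (1 + t) / 2\<close>,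
  \<open>\<epsilon>' = (1 - t) / 2\<close> split \<open>K \<otimes> S\<close> into two copies of \<open>S\<close> exchanged by the involution.  Let \<open>\<mu>1\<close>, \<open>\<mu>2\<close>
  be the components of \<open>\<mu>\<close>, with \<open>\<mu>1 * \<mu>2 = N u\<close>, and \<open>s\<^sup>3 = \<mu>1\<close>.  Then \<open>z = s \<epsilon> + s\<inverse> u \<epsilon>'\<close> has
  \<open>z * \<tau> z = u\<close>, and its norm has the components \<open>s\<^sup>3 = \<mu>1\<close> and \<open>s\<inverse>\<^sup>3 * N u = \<mu>2\<close>.
\<close>
lemma split_solution:
  assumes adm: "admissible \<phi>L \<phi>K \<iota> u \<mu>"
  obtains z where "z * \<tau>F z = iE (iL u)" "NF z = jK \<mu>"
proof -
  have twoS: "(2::'s) \<noteq> 0" and threeS: "(3::'s) \<noteq> 0"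
    using two three \<phi>S_eq_0[of 2] \<phi>S_eq_0[of 3] by (simp_all add: F.\<phi>S.hom_numeral)
  obtain \<delta> where \<delta>: "\<delta> ^ 2 = \<phi>S d"
    by (rule separably_closed_root[OF sc, of 2 "\<phi>S d"]) (use twoS d_nonzero in \<open>simp_all add: \<phi>S_eq_0\<close>)
  have \<delta>0: "\<delta> \<noteq> 0" using \<delta> d_nonzero by (auto simp: \<phi>S_eq_0)
  define t where "t = jS (inverse \<delta>) * jK \<theta>"
  have jK\<theta>: "jK \<theta> = jS \<delta> * t" unfolding t_def using \<delta>0
    by (simp add: mult.assoc[symmetric] D.iS.hom_mult[symmetric])
  have tt: "t * t = 1"
  proof -
    have "t * t = jS (inverse \<delta> * inverse \<delta>) * jK (\<theta> * \<theta>)"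
      unfolding t_def by (simp add: D.iS.hom_mult D.iE.hom_mult mult_ac)
    also have "\<dots> = jS (inverse \<delta> * inverse \<delta> * \<delta> ^ 2)" unfolding \<theta>_square jKS \<delta> D.iS.hom_mult ..
    also have "inverse \<delta> * inverse \<delta> * \<delta> ^ 2 = 1" using \<delta>0 by (simp add: power2_eq_square field_simps)
    finally show ?thesis by simp
  qed
  define h where "h = jS (1/2)"
  have h: "h * 2 = 1"
  proof -
    have "h * 2 = jS (1/2 * 2)" unfolding h_def D.iS.hom_mult by (simp add: D.iS.hom_numeral)
    then show ?thesis using twoS by simp
  qed
  define \<epsilon> \<epsilon>' where "\<epsilon> = h * (1 + t)" and "\<epsilon>' = h * (1 - t)"
  have sum1: "\<epsilon> + \<epsilon>' = 1"
  proof -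
    have "\<epsilon> + \<epsilon>' = h * 2" unfolding \<epsilon>_def \<epsilon>'_def by (simp add: algebra_simps)
    then show ?thesis using h by simp
  qed
  have orth: "\<epsilon> * \<epsilon>' = 0"
  proof -
    have "\<epsilon> * \<epsilon>' = h * h * (1 - t * t)" unfolding \<epsilon>_def \<epsilon>'_def by (simp add: algebra_simps)
    then show ?thesis unfolding tt by simp
  qed
  have idem: "\<epsilon> * \<epsilon> = \<epsilon>" "\<epsilon>' * \<epsilon>' = \<epsilon>'"
  proof -
    have "\<epsilon> * \<epsilon> = \<epsilon> * (\<epsilon> + \<epsilon>')" "\<epsilon>' * \<epsilon>' = (\<epsilon> + \<epsilon>') * \<epsilon>'" using orth by (simp_all add: distrib_left distrib_right)
    then show "\<epsilon> * \<epsilon> = \<epsilon>" "\<epsilon>' * \<epsilon>' = \<epsilon>'" unfolding sum1 by simp_all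
  qed
  have swap: "\<iota>D \<epsilon> = \<epsilon>'" "\<iota>D \<epsilon>' = \<epsilon>"
  proof -
    have "\<iota>D t = - t" unfolding t_def by (simp add: \<iota>D.hom_mult \<iota>D_jS \<iota>D_jK \<iota>_\<theta> D.iE.hom_uminus)
    then show "\<iota>D \<epsilon> = \<epsilon>'" "\<iota>D \<epsilon>' = \<epsilon>" unfolding \<epsilon>_def \<epsilon>'_def h_def
      by (simp_all add: \<iota>D.hom_mult \<iota>D.hom_add \<iota>D.hom_minus \<iota>D_jS)
  qed
  have t\<epsilon>: "t * \<epsilon> = \<epsilon>" "t * \<epsilon>' = - \<epsilon>'"
  proof -
    have "t * \<epsilon> = h * (t + t * t)" "t * \<epsilon>' = h * (t - t * t)"
      unfolding \<epsilon>_def \<epsilon>'_def by (simp_all add: algebra_simps)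
    then show "t * \<epsilon> = \<epsilon>" "t * \<epsilon>' = - \<epsilon>'" unfolding tt \<epsilon>_def \<epsilon>'_def by (simp_all add: algebra_simps)
  qed
  obtain m n where \<mu>: "\<mu> = \<phi>K m + \<phi>K n * \<theta>" by (rule K_decomp)
  define \<mu>1 \<mu>2 where "\<mu>1 = \<phi>S m + \<phi>S n * \<delta>" and "\<mu>2 = \<phi>S m - \<phi>S n * \<delta>"
  have jK\<mu>: "jK \<mu> = jS (\<phi>S m) + jS (\<phi>S n * \<delta>) * t"
    unfolding \<mu> by (simp add: D.iE.hom_add D.iE.hom_mult jKS jK\<theta> D.iS.hom_mult mult.assoc)
  have \<mu>\<epsilon>: "jK \<mu> * \<epsilon> = jS \<mu>1 * \<epsilon>" "jK \<mu> * \<epsilon>' = jS \<mu>2 * \<epsilon>'"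
    unfolding jK\<mu> \<mu>1_def \<mu>2_def
    by (simp_all add: distrib_right left_diff_distrib mult.assoc t\<epsilon> D.iS.hom_add D.iS.hom_minus)
  have adm': "alg_norm \<phi>L u = alg_norm \<phi>K \<mu>" and \<mu>u: "\<mu> dvd 1" using adm unfolding admissible_def by auto
  have \<mu>12: "\<mu>1 * \<mu>2 = \<phi>S (alg_norm \<phi>K \<mu>)"
  proof -
    have "\<phi>K (alg_norm \<phi>K \<mu>) = \<phi>K (m * m - n * n * d)"
    proof -
      have "\<mu> * \<iota> \<mu> = \<phi>K m * \<phi>K m - \<phi>K n * \<phi>K n * (\<theta> * \<theta>)" unfolding \<mu> \<iota>_decomp by (simp add: algebra_simps)
      then show ?thesis unfolding K_norm \<theta>_square by (simp add: \<phi>K.hom_minus \<phi>K.hom_mult)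
    qed
    then have "alg_norm \<phi>K \<mu> = m * m - n * n * d" using \<phi>K_eq_0[of "alg_norm \<phi>K \<mu> - (m * m - n * n * d)"]
      by (simp add: \<phi>K.hom_minus)
    moreover have "\<mu>1 * \<mu>2 = \<phi>S m * \<phi>S m - \<phi>S n * \<phi>S n * \<delta> ^ 2"
      unfolding \<mu>1_def \<mu>2_def by (simp add: algebra_simps power2_eq_square)
    ultimately show ?thesis unfolding \<delta> by (simp add: F.\<phi>S.hom_minus F.\<phi>S.hom_mult)
  qed
  have "alg_norm \<phi>K \<mu> \<noteq> 0"
  proof
    assume z: "alg_norm \<phi>K \<mu> = 0"
    obtain \<nu> where \<nu>: "1 = \<mu> * \<nu>" using \<mu>u by (rule dvdE)
    have "\<mu> * \<iota> \<mu> = 0" using K_norm[of \<mu>] z by simp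
    then have "\<nu> * \<iota> \<nu> * (\<mu> * \<iota> \<mu>) = 0" by simp
    moreover have "\<nu> * \<iota> \<nu> * (\<mu> * \<iota> \<mu>) = (\<mu> * \<nu>) * \<iota> (\<mu> * \<nu>)" by (simp add: \<iota>.hom_mult mult_ac)
    ultimately show False unfolding \<nu>[symmetric] by simp
  qed
  then have \<mu>1: "\<mu>1 \<noteq> 0" using \<mu>12 by (auto simp: \<phi>S_eq_0)
  obtain s where s: "s ^ 3 = \<mu>1"
    by (rule separably_closed_root[OF sc, of 3 \<mu>1]) (use threeS \<mu>1 in simp_all)
  have s0: "s \<noteq> 0" using s \<mu>1 by auto
  define U where "U = iE (iL u)"
  have \<tau>U: "\<tau>F U = U" unfolding U_def \<tau>F_iE \<tau>_iL ..
  define z where "z = iS s * \<kappa> \<epsilon> + iS (inverse s) * U * \<kappa> \<epsilon>'"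
  have \<kappa>orth: "\<kappa> \<epsilon> * \<kappa> \<epsilon>' = 0" "\<kappa> \<epsilon> * \<kappa> \<epsilon> = \<kappa> \<epsilon>" "\<kappa> \<epsilon>' * \<kappa> \<epsilon>' = \<kappa> \<epsilon>'" "\<kappa> \<epsilon> + \<kappa> \<epsilon>' = 1"
    using orth idem sum1 by (simp_all flip: \<kappa>.hom_mult \<kappa>.hom_add)
  have "z * \<tau>F z = U"
  proof -
    have "\<tau>F z = iS s * \<kappa> \<epsilon>' + iS (inverse s) * U * \<kappa> \<epsilon>"
      unfolding z_def by (simp add: \<tau>F.hom_add \<tau>F.hom_mult \<tau>F_iS \<tau>U \<tau>F_\<kappa> swap)
    then have "z * \<tau>F z = iS s * iS s * (\<kappa> \<epsilon> * \<kappa> \<epsilon>') + iS s * iS (inverse s) * U * (\<kappa> \<epsilon> * \<kappa> \<epsilon> + \<kappa> \<epsilon>' * \<kappa> \<epsilon>')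
        + iS (inverse s) * iS (inverse s) * U * U * (\<kappa> \<epsilon> * \<kappa> \<epsilon>')"
      unfolding z_def by (simp add: algebra_simps)
    also have "\<dots> = iS (s * inverse s) * U" unfolding \<kappa>orth F.iS.hom_mult by simp
    finally show ?thesis using s0 by simp
  qed
  moreover have "NF z = jK \<mu>"
  proof -
    \<comment> \<open>Since \<open>\<epsilon>\<close> is its own norm, the component of \<open>NF z\<close> at \<open>\<epsilon>\<close> is the norm of \<open>z * \<epsilon>\<close>.\<close>
    have cube: "\<epsilon> ^ 3 = \<epsilon>" "\<epsilon>' ^ 3 = \<epsilon>'" using idem by (simp_all add: power3_eq_cube)
    have e1: "NF z * \<epsilon> = jK \<mu> * \<epsilon>"
    proof -
      have "NF z * \<epsilon> = NF z * NF (\<kappa> \<epsilon>)" unfolding NF_scalar cube ..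
      also have "\<dots> = NF (z * \<kappa> \<epsilon>)" unfolding NF_mult ..
      also have "z * \<kappa> \<epsilon> = iS s * (\<kappa> \<epsilon> * \<kappa> \<epsilon>) + iS (inverse s) * U * (\<kappa> \<epsilon> * \<kappa> \<epsilon>')"
        unfolding z_def by (simp add: algebra_simps)
      also have "\<dots> = \<kappa> (jS s * \<epsilon>)" unfolding \<kappa>orth by (simp add: \<kappa>.hom_mult \<kappa>_jS)
      also have "NF \<dots> = jS (s ^ 3) * \<epsilon>" unfolding NF_scalar power_mult_distrib cube D.iS.hom_power ..
      finally show ?thesis unfolding s \<mu>\<epsilon> .
    qed
    have e2: "NF z * \<epsilon>' = jK \<mu> * \<epsilon>'"
    proof -
      have "NF z * \<epsilon>' = NF z * NF (\<kappa> \<epsilon>')" unfolding NF_scalar cube ..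
      also have "\<dots> = NF (z * \<kappa> \<epsilon>')" unfolding NF_mult ..
      also have "z * \<kappa> \<epsilon>' = iS s * (\<kappa> \<epsilon> * \<kappa> \<epsilon>') + iS (inverse s) * U * (\<kappa> \<epsilon>' * \<kappa> \<epsilon>')"
        unfolding z_def by (simp add: algebra_simps)
      also have "\<dots> = \<kappa> (jS (inverse s) * \<epsilon>') * U" unfolding \<kappa>orth by (simp add: \<kappa>.hom_mult \<kappa>_jS mult_ac)
      also have "NF \<dots> = jS (inverse s ^ 3) * \<epsilon>' * NF U"
        unfolding NF_mult NF_scalar power_mult_distrib cube D.iS.hom_power ..
      also have "NF U = jS (\<mu>1 * \<mu>2)" unfolding U_def NF_iE NE_iL jKS adm' \<mu>12 ..
      also have "jS (inverse s ^ 3) * \<epsilon>' * jS (\<mu>1 * \<mu>2) = jS (inverse s ^ 3 * \<mu>1 * \<mu>2) * \<epsilon>'"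
        by (simp add: D.iS.hom_mult mult_ac)
      also have "inverse s ^ 3 * \<mu>1 * \<mu>2 = \<mu>2" using s0 unfolding s[symmetric] by (simp add: power_mult_distrib[symmetric] power_inverse)
      finally show ?thesis unfolding \<mu>\<epsilon> .
    qed
    have "NF z * (\<epsilon> + \<epsilon>') = jK \<mu> * (\<epsilon> + \<epsilon>')" unfolding distrib_left e1 e2 ..
    then show ?thesis unfolding sum1 by simp
  qed
  ultimately show thesis using that unfolding U_def by blast
qed

text \<open>
  The cocycle is \<open>z\<inverse> \<sigma>(z)\<close>, where \<open>z\<close> has the given norms over \<open>S\<close> and \<open>y\<close> is its inverse.  It is
  continuous since it depends only on the values of \<open>\<sigma>\<close> at the coordinates of \<open>z\<close>.
\<close>
lemma norms_of_trivial_H1: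
  assumes triv: "\<And>c. c \<in> carrier (galois_Z1 \<phi>S M F.act) \<Longrightarrow> \<exists>a\<in>carrier M. \<forall>\<sigma>\<in>\<Gamma>. c \<sigma> = \<tau>F a * F.act \<sigma> a"
    and adm: "admissible \<phi>L \<phi>K \<iota> u \<mu>"
  obtains w where "w * \<tau> w = iL u" "alg_norm iK w = \<mu>"
proof -
  obtain z where z: "z * \<tau>F z = iE (iL u)" "NF z = jK \<mu>" by (rule split_solution[OF adm])
  obtain v where v: "u * v = 1" using adm unfolding admissible_def by (metis dvdE)
  define y where "y = \<tau>F z * iE (iL v)"
  have zy: "z * y = 1"
  proof -
    have "z * y = iE (iL (u * v))" unfolding y_def iL.hom_mult F.iE.hom_mult z(1)[symmetric] by (simp add: mult.assoc)
    then show ?thesis unfolding v by simp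
  qed
  define c where "c = (\<lambda>\<sigma>\<in>\<Gamma>. y * F.act \<sigma> z)"
  have c_in: "y * F.act \<sigma> z \<in> carrier M" if \<sigma>: "\<sigma> \<in> \<Gamma>" for \<sigma>
  proof -
    interpret f: comm_ring_hom "F.act \<sigma>" by (rule F.act_hom[OF \<sigma>])
    have "y * F.act \<sigma> z * \<tau>F (y * F.act \<sigma> z) = y * \<tau>F y * F.act \<sigma> (z * \<tau>F z)"
      by (simp add: \<tau>F.hom_mult \<tau>F_act[OF \<sigma>] f.hom_mult mult_ac)
    also have "\<dots> = y * \<tau>F y * (z * \<tau>F z)" unfolding z(1) F.act_iE[OF \<sigma>] ..
    also have "\<dots> = (z * y) * \<tau>F (z * y)" by (simp add: \<tau>F.hom_mult mult_ac)
    finally have 1: "y * F.act \<sigma> z * \<tau>F (y * F.act \<sigma> z) = 1" unfolding zy by simp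
    have "NF (y * F.act \<sigma> z) = NF y * NF z" unfolding NF_mult NF_act[OF \<sigma>] z(2) D.act_iE[OF \<sigma>] ..
    also have "\<dots> = NF (z * y)" unfolding NF_mult by (rule mult.commute)
    finally show ?thesis unfolding M_carrier using 1 zy NF_one by simp
  qed
  have "c \<in> carrier (galois_Z1 \<phi>S M F.act)"
  proof -
    have "galois_continuous \<phi>S c" unfolding galois_continuous_def
    proof
      fix \<sigma> assume \<sigma>: "\<sigma> \<in> \<Gamma>"
      define X where "X = F.co z ` ({..<3} \<times> {..<2})"
      show "\<exists>X. finite X \<and> (\<forall>\<rho>\<in>\<Gamma>. (\<forall>x\<in>X. \<rho> x = \<sigma> x) \<longrightarrow> c \<rho> = c \<sigma>)"
      proof (intro exI[of _ X] conjI ballI impI)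
        show "finite X" unfolding X_def by simp
        fix \<rho> assume \<rho>: "\<rho> \<in> \<Gamma>" and eq: "\<forall>x\<in>X. \<rho> x = \<sigma> x"
        have "F.act \<rho> z = F.act \<sigma> z"
          by (rule F.co_eqI) (use eq in \<open>auto simp: F.act_coord[OF \<rho>] F.act_coord[OF \<sigma>] X_def\<close>)
        then show "c \<rho> = c \<sigma>" unfolding c_def using \<sigma> \<rho> by simp
      qed
    qed
    moreover have "c (\<sigma> \<circ> \<rho>) = c \<sigma> * F.act \<sigma> (c \<rho>)" if \<sigma>: "\<sigma> \<in> \<Gamma>" and \<rho>: "\<rho> \<in> \<Gamma>" for \<sigma> \<rho>
    proof -
      interpret f: comm_ring_hom "F.act \<sigma>" by (rule F.act_hom[OF \<sigma>])
      have "y * F.act \<sigma> z * F.act \<sigma> (y * F.act \<rho> z) = y * F.act \<sigma> (z * y) * F.act \<sigma> (F.act \<rho> z)"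
        by (simp add: f.hom_mult mult_ac)
      then show ?thesis unfolding zy c_def using \<sigma> \<rho> galois_group_comp[OF \<sigma> \<rho>] by (simp add: F.act_comp)
    qed
    ultimately show ?thesis unfolding galois_Z1_def M_mult using c_in unfolding c_def by simp
  qed
  from triv[OF this] obtain a where a: "a \<in> carrier M" "\<And>\<sigma>. \<sigma> \<in> \<Gamma> \<Longrightarrow> c \<sigma> = \<tau>F a * F.act \<sigma> a" by blast
  have aM: "a * \<tau>F a = 1" "NF a = 1" using a(1) unfolding M_carrier by auto
  have "F.act \<sigma> (z * \<tau>F a) = z * \<tau>F a" if \<sigma>: "\<sigma> \<in> \<Gamma>" for \<sigma>
  proof -
    interpret f: comm_ring_hom "F.act \<sigma>" by (rule F.act_hom[OF \<sigma>])
    have "y * F.act \<sigma> z = \<tau>F a * F.act \<sigma> a" using a(2)[OF \<sigma>] \<sigma> unfolding c_def by simp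
    then have "z * (y * F.act \<sigma> z) * F.act \<sigma> (\<tau>F a) = z * (\<tau>F a * F.act \<sigma> a) * F.act \<sigma> (\<tau>F a)" by simp
    then have "(z * y) * F.act \<sigma> (z * \<tau>F a) = z * \<tau>F a * F.act \<sigma> (a * \<tau>F a)"
      by (simp add: f.hom_mult mult_ac)
    then show ?thesis unfolding zy aM(1) by simp
  qed
  then obtain w where w: "z * \<tau>F a = iE w" by (rule F.act_fixed)
  have "iE (w * \<tau> w) = iE (iL u)"
  proof -
    have "iE (w * \<tau> w) = (z * \<tau>F z) * (a * \<tau>F a)"
      unfolding F.iE.hom_mult \<tau>F_iE[symmetric] w[symmetric] by (simp add: \<tau>F.hom_mult \<tau>F_invol mult_ac)
    then show ?thesis unfolding aM z by simp
  qed
  then have 1: "w * \<tau> w = iL u" unfolding F.iE_inj .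
  have "jK (alg_norm iK w) = jK \<mu>"
    unfolding NF_iE[symmetric] w[symmetric] NF_mult NF_\<tau>F aM z by simp
  then have "alg_norm iK w = \<mu>" unfolding D.iE_inj .
  then show thesis using that 1 by blast
qed

text \<open>
  By Hilbert 90, \<open>c \<sigma> = v\<inverse> \<sigma>(v)\<close> for a unit \<open>v\<close> of \<open>E \<otimes> S\<close>.  As \<open>c\<close> has values in the torus, \<open>v * \<tau> v\<close>
  and the norm of \<open>v\<close> are invariant and form an admissible pair.  If \<open>w\<close> has the same norms, then
  \<open>a = v w\<inverse>\<close> lies in the torus and has the same coboundary.
\<close>
lemma coboundary_of_norms:
  assumes norms: "\<And>u \<mu>. admissible \<phi>L \<phi>K \<iota> u \<mu> \<Longrightarrow> \<exists>w. w * \<tau> w = iL u \<and> alg_norm iK w = \<mu>"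
    and c: "c \<in> carrier (galois_Z1 \<phi>S M F.act)"
  obtains a where "a \<in> carrier M" "\<And>\<sigma>. \<sigma> \<in> \<Gamma> \<Longrightarrow> c \<sigma> = \<tau>F a * F.act \<sigma> a"
proof -
  have cM: "c \<sigma> \<in> carrier M" if "\<sigma> \<in> \<Gamma>" for \<sigma> using c that unfolding galois_Z1_def by auto
  have cc: "c (\<sigma> \<circ> \<rho>) = c \<sigma> * F.act \<sigma> (c \<rho>)" if "\<sigma> \<in> \<Gamma>" "\<rho> \<in> \<Gamma>" for \<sigma> \<rho>
    using c that unfolding galois_Z1_def M_mult by simp
  have cont: "galois_continuous \<phi>S c" using c unfolding galois_Z1_def by simp
  have unit: "\<exists>b. c \<sigma> * b = 1" if "\<sigma> \<in> \<Gamma>" for \<sigma> using cM[OF that] unfolding M_carrier by blast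
  obtain z v where zv: "z * v = 1" and z: "\<And>\<sigma>. \<sigma> \<in> \<Gamma> \<Longrightarrow> c \<sigma> * F.act \<sigma> z = z"
    using F.hilbert_90[OF unit cc cont E_regular] by blast
  have c_eq: "c \<sigma> = z * F.act \<sigma> v" if \<sigma>: "\<sigma> \<in> \<Gamma>" for \<sigma>
  proof -
    interpret f: comm_ring_hom "F.act \<sigma>" by (rule F.act_hom[OF \<sigma>])
    have "z * F.act \<sigma> v = c \<sigma> * (F.act \<sigma> z * F.act \<sigma> v)" using z[OF \<sigma>] by (simp add: mult.assoc[symmetric])
    also have "F.act \<sigma> z * F.act \<sigma> v = 1" using zv by (simp flip: f.hom_mult)
    finally show ?thesis by simp
  qed
  have fix1: "F.act \<sigma> (v * \<tau>F v) = v * \<tau>F v" if \<sigma>: "\<sigma> \<in> \<Gamma>" for \<sigma>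
  proof -
    interpret f: comm_ring_hom "F.act \<sigma>" by (rule F.act_hom[OF \<sigma>])
    have "z * F.act \<sigma> v * \<tau>F (z * F.act \<sigma> v) = 1" using cM[OF \<sigma>] unfolding M_carrier c_eq[OF \<sigma>] by simp
    then have "z * \<tau>F z * F.act \<sigma> (v * \<tau>F v) = 1"
      by (simp add: \<tau>F.hom_mult \<tau>F_act[OF \<sigma>] f.hom_mult mult_ac)
    then have "v * \<tau>F v = v * \<tau>F v * (z * \<tau>F z * F.act \<sigma> (v * \<tau>F v))" by simp
    also have "\<dots> = (z * v) * \<tau>F (z * v) * F.act \<sigma> (v * \<tau>F v)" by (simp add: \<tau>F.hom_mult mult_ac)
    finally show ?thesis unfolding zv by simp
  qed
  obtain x where x: "v * \<tau>F v = iE x" by (rule F.act_fixed[OF fix1])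
  have "iE (\<tau> x) = iE x" unfolding \<tau>F_iE[symmetric] x[symmetric] by (simp add: \<tau>F.hom_mult \<tau>F_invol mult.commute)
  then obtain u where u: "x = iL u" using \<tau>_fixed unfolding F.iE_inj by blast
  have fix2: "D.act \<sigma> (NF v) = NF v" if \<sigma>: "\<sigma> \<in> \<Gamma>" for \<sigma>
  proof -
    have "NF z * D.act \<sigma> (NF v) = 1"
      using cM[OF \<sigma>] unfolding M_carrier c_eq[OF \<sigma>] NF_mult NF_act[OF \<sigma>] by simp
    then have "NF v = NF v * (NF z * D.act \<sigma> (NF v))" by simp
    also have "\<dots> = NF (z * v) * D.act \<sigma> (NF v)" by (simp add: NF_mult mult_ac)
    finally show ?thesis unfolding zv NF_one by simp
  qed
  obtain \<mu> where \<mu>: "NF v = jK \<mu>" by (rule D.act_fixed[OF fix2])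
  have uz: "iE (iL u) * (z * \<tau>F z) = 1"
  proof -
    have "iE (iL u) * (z * \<tau>F z) = (z * v) * \<tau>F (z * v)"
      unfolding u[symmetric] x[symmetric] by (simp add: \<tau>F.hom_mult mult_ac)
    then show ?thesis unfolding zv by simp
  qed
  obtain u' where u': "u * u' = 1"
  proof -
    obtain y where y: "u * u * y = u" using L_regular by blast
    have "iE (iL (u * y)) = iE (iL (u * y)) * (iE (iL u) * (z * \<tau>F z))" unfolding uz by simp
    also have "\<dots> = iE (iL (u * u * y)) * (z * \<tau>F z)" by (simp add: iL.hom_mult F.iE.hom_mult mult_ac)
    also have "\<dots> = iE (iL 1)" unfolding y uz by simp
    finally show thesis using that unfolding F.iE_inj iL_inj by blast
  qed
  have norm: "\<phi>K (alg_norm \<phi>L u) = \<mu> * \<iota> \<mu>"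
  proof -
    have "jK (\<phi>K (alg_norm \<phi>L u)) = NF (v * \<tau>F v)" unfolding x u NF_iE NE_iL ..
    also have "\<dots> = jK (\<mu> * \<iota> \<mu>)" unfolding NF_mult NF_\<tau>F \<mu> \<iota>D_jK D.iE.hom_mult ..
    finally show ?thesis unfolding D.iE_inj .
  qed
  have "admissible \<phi>L \<phi>K \<iota> u \<mu>" unfolding admissible_def
  proof (intro conjI)
    show "u dvd 1" using u' by (metis dvd_triv_left)
    show "\<phi>K (alg_norm \<phi>K \<mu>) = \<mu> * \<iota> \<mu>" by (rule K_norm)
    then have "\<phi>K (alg_norm \<phi>L u - alg_norm \<phi>K \<mu>) = 0" using norm by (simp add: \<phi>K.hom_minus)
    then show "alg_norm \<phi>L u = alg_norm \<phi>K \<mu>" unfolding \<phi>K_eq_0 by simp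
    have "alg_norm \<phi>L u * alg_norm \<phi>L u' = 1" using u' L.N_mult[of u u'] L.N_one by simp
    then have "\<mu> * (\<iota> \<mu> * \<phi>K (alg_norm \<phi>L u')) = 1"
      unfolding mult.assoc[symmetric] norm[symmetric] by (simp flip: \<phi>K.hom_mult)
    then show "\<mu> dvd 1" by (metis dvd_triv_left)
  qed
  then obtain w where w: "w * \<tau> w = iL u" "alg_norm iK w = \<mu>" using norms by blast
  define w' where "w' = \<tau> w * iL u'"
  have ww': "w * w' = 1"
  proof -
    have "w * w' = iL (u * u')" unfolding w'_def iL.hom_mult w(1)[symmetric] by (simp add: mult.assoc)
    then show ?thesis unfolding u' by simp
  qed
  define a where "a = v * iE w'"
  have aM: "a \<in> carrier M" unfolding M_carrier
  proof
    have "a * \<tau>F a = (v * \<tau>F v) * iE (w' * \<tau> w')"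
      unfolding a_def by (simp add: \<tau>F.hom_mult \<tau>F_iE F.iE.hom_mult mult_ac)
    also have "\<dots> = iE ((w * w') * \<tau> (w * w'))"
      unfolding x u w(1)[symmetric] by (simp add: F.iE.hom_mult \<tau>.hom_mult mult_ac)
    finally show "a * \<tau>F a = 1" unfolding ww' by simp
    have "NF a = jK (alg_norm iK (w * w'))" unfolding a_def NF_mult NF_iE \<mu> EK.N_mult w(2) D.iE.hom_mult ..
    then show "NF a = 1" unfolding ww' EK.N_one by simp
  qed
  have a_inv: "\<tau>F a = z * iE w"
  proof -
    have "a * (z * iE w) = (z * v) * iE (w * w')" unfolding a_def by (simp add: F.iE.hom_mult mult_ac)
    then have 1: "a * (z * iE w) = 1" unfolding zv ww' by simp
    have "\<tau>F a = \<tau>F a * (a * (z * iE w))" unfolding 1 by simp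
    also have "\<dots> = (a * \<tau>F a) * (z * iE w)" by (simp add: mult_ac)
    finally show ?thesis using aM unfolding M_carrier by simp
  qed
  show thesis
  proof (rule that[OF aM])
    fix \<sigma> assume \<sigma>: "\<sigma> \<in> \<Gamma>"
    interpret f: comm_ring_hom "F.act \<sigma>" by (rule F.act_hom[OF \<sigma>])
    have "\<tau>F a * F.act \<sigma> a = iE (w * w') * (z * F.act \<sigma> v)"
      unfolding a_inv unfolding a_def by (simp add: f.hom_mult F.act_iE[OF \<sigma>] F.iE.hom_mult mult_ac)
    then show "c \<sigma> = \<tau>F a * F.act \<sigma> a" unfolding ww' c_eq[OF \<sigma>] by simp
  qed
qed

theorem H1_trivial_iff_norms:
  "trivial_group (galois_H1 \<phi>S M F.act) \<longleftrightarrow>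
    (\<forall>u \<mu>. admissible \<phi>L \<phi>K \<iota> u \<mu> \<longrightarrow> (\<exists>w. w * \<tau> w = iL u \<and> alg_norm iK w = \<mu>))"
  unfolding H1_trivial_iff_coboundary
proof
  assume "\<forall>c\<in>carrier (galois_Z1 \<phi>S M F.act). \<exists>a\<in>carrier M. \<forall>\<sigma>\<in>\<Gamma>. c \<sigma> = \<tau>F a * F.act \<sigma> a"
  then show "\<forall>u \<mu>. admissible \<phi>L \<phi>K \<iota> u \<mu> \<longrightarrow> (\<exists>w. w * \<tau> w = iL u \<and> alg_norm iK w = \<mu>)"
    using norms_of_trivial_H1 by (metis (no_types, lifting))
next
  assume "\<forall>u \<mu>. admissible \<phi>L \<phi>K \<iota> u \<mu> \<longrightarrow> (\<exists>w. w * \<tau> w = iL u \<and> alg_norm iK w = \<mu>)"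
  then show "\<forall>c\<in>carrier (galois_Z1 \<phi>S M F.act). \<exists>a\<in>carrier M. \<forall>\<sigma>\<in>\<Gamma>. c \<sigma> = \<tau>F a * F.act \<sigma> a"
    using coboundary_of_norms by (metis (no_types, lifting))
qed

end

section \<open>The trace form\<close>

locale regular_cubic_algebra = cubic_algebra \<phi> bas "1/2"
  for \<phi> :: "'k::field \<Rightarrow> 'b::comm_ring_1" and bas +
  assumes three: "(3::'k) \<noteq> 0" and regular: "\<And>x::'b. \<exists>y. x * x * y = x"
begin

lemma two: "(2::'k) \<noteq> 0" using half by auto

text \<open>
  If \<open>x \<noteq> 0\<close>, regularity gives an idempotent \<open>e = x * y \<noteq> 0\<close>.  If its trace vanished, so would its second
  coefficient, and Cayley-Hamilton would read \<open>e = N e\<close>; but a scalar of trace \<open>0\<close> is \<open>0\<close>.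
\<close>
lemma trace_form_nondegenerate:
  assumes "\<And>y. T (x * y) = 0" shows "x = 0"
proof -
  obtain y where y: "x * x * y = x" using regular by blast
  define e where "e = x * y"
  have ee: "e * e = e" unfolding e_def using y by (metis mult.assoc mult.commute)
  have Te: "T e = 0" unfolding e_def by (rule assms)
  have "2 * S e = 0" unfolding two_S using ee Te by (simp add: power2_eq_square)
  then have "adj e = e" unfolding adj_def using ee Te two by (simp add: power2_eq_square)
  then have e: "e = \<phi> (N e)" using adj_mult_self[of e] ee by simp
  then have "3 * N e = 0" using Te T_scalar[of "N e"] by simp
  then have "e = 0" using e three by simp
  then show "x = 0" using y unfolding e_def by (metis mult.assoc mult_zero_right)
qed

text \<open>
  By nondegeneracy \<open>x \<mapsto> \<Sum>i. T (x * b\<^sub>i) b\<^sub>i\<close> is injective, so it hits every \<open>b\<^sub>i\<close>.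
\<close>
lemma dual_basis:
  obtains c where "\<And>i k. i < 3 \<Longrightarrow> k < 3 \<Longrightarrow> T (c i * bas k) = (if i = k then 1 else 0)"
proof -
  obtain B where "finite_dimensional_vector_space (alg_scale \<phi>) B"
    by (rule free_basis_finite_dimensional[OF hom basis])
  then interpret V: finite_dimensional_vector_space "alg_scale \<phi>" B .
  define \<Phi> where "\<Phi> x = (\<Sum>i<3. \<phi> (T (x * bas i)) * bas i)" for x
  have add: "\<Phi> (x + y) = \<Phi> x + \<Phi> y" for x y
    unfolding \<Phi>_def distrib_right T_add by (simp add: hom_add distrib_right sum.distrib)
  have scale: "\<Phi> (\<phi> a * x) = \<phi> a * \<Phi> x" for a x
    unfolding \<Phi>_def mult.assoc T_scale by (simp add: hom_mult sum_distrib_left mult.assoc)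
  have lin: "Vector_Spaces.linear (alg_scale \<phi>) (alg_scale \<phi>) \<Phi>"
    unfolding Vector_Spaces.linear_iff using V.vector_space_axioms add scale by (simp add: alg_scale_def)
  have zero: "x = 0" if z: "\<Phi> x = 0" for x
  proof (rule trace_form_nondegenerate)
    fix y
    have Tb: "T (x * bas i) = 0" if "i < 3" for i
      using free_basisD(3)[OF basis z[unfolded \<Phi>_def]] that by simp
    have "T (x * y) = T (x * (\<Sum>i<3. \<phi> (coord \<phi> {..<3} bas y i) * bas i))" by (simp add: coord_sum[OF basis])
    also have "\<dots> = (\<Sum>i<3. coord \<phi> {..<3} bas y i * T (x * bas i))"
      by (simp only: sum_distrib_left T_sum mult.left_commute[of x] T_scale)
    also have "\<dots> = 0" by (intro sum.neutral) (simp add: Tb)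
    finally show "T (x * y) = 0" .
  qed
  have "inj \<Phi>"
  proof (rule injI)
    fix x y assume "\<Phi> x = \<Phi> y"
    then have "\<Phi> (x - y) = 0" using add[of "x - y" y] by simp
    then show "x = y" using zero by fastforce
  qed
  from V.linear_inj_imp_surj[OF lin this] have "\<forall>i. \<exists>c. \<Phi> c = bas i" unfolding surj_def by metis
  then obtain c where c: "\<And>i. \<Phi> (c i) = bas i" by metis
  have "T (c i * bas k) = (if i = k then 1 else 0)" if "i < 3" "k < 3" for i k
  proof -
    have "coord \<phi> {..<3} bas (bas i) k = T (c i * bas k)"
      by (rule coord_unique[OF hom basis _]) (use c[of i] that in \<open>simp_all add: \<Phi>_def\<close>)
    moreover have "coord \<phi> {..<3} bas (bas i) k = (if k = i then 1 else 0)"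
      by (rule coord_basis[OF hom basis]) (use that in simp_all)
    ultimately show ?thesis by metis
  qed
  then show thesis by (rule that)
qed

text \<open>
  Identities for a basis and its dual basis with respect to the trace form; each side pairs equally with
  everything.
\<close>
lemma casimir:
  obtains c where "(\<Sum>i<3. c i * bas i) = 1" "(\<Sum>i<3. \<phi> (T (bas i)) * c i) = 1"
    "(\<Sum>i<3. \<phi> (T (c i)) * bas i) = 1"
proof -
  obtain c where c: "\<And>i k. i < 3 \<Longrightarrow> k < 3 \<Longrightarrow> T (c i * bas k) = (if i = k then 1 else 0)"
    by (rule dual_basis) blast
  have expand: "T (x * y) = (\<Sum>k<3. coord \<phi> {..<3} bas y k * T (x * bas k))" for x y
  proof -
    have "T (x * y) = T (x * (\<Sum>i<3. \<phi> (coord \<phi> {..<3} bas y i) * bas i))" by (simp add: coord_sum[OF basis])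
    then show ?thesis by (simp only: sum_distrib_left T_sum mult.left_commute[of x] T_scale)
  qed
  have cT: "coord \<phi> {..<3} bas y i = T (c i * y)" if i: "i < 3" for y i
  proof -
    have "T (c i * y) = (\<Sum>k<3. if i = k then coord \<phi> {..<3} bas y k else 0)"
      unfolding expand[of "c i" y] by (rule sum.cong) (simp_all add: c[OF i])
    then show ?thesis using i by simp
  qed
  have 1: "(\<Sum>i<3. c i * bas i) = 1"
  proof -
    have "T (((\<Sum>i<3. c i * bas i) - 1) * x) = 0" for x
    proof -
      have "T ((\<Sum>i<3. c i * bas i) * x) = (\<Sum>i<3. T (c i * (x * bas i)))"
        unfolding sum_distrib_right T_sum by (simp add: mult_ac)
      also have "\<dots> = (\<Sum>i<3. coord \<phi> {..<3} bas (x * bas i) i)" by (rule sum.cong) (simp_all add: cT)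
      also have "\<dots> = T x" by (rule alg_norm_trace_coord(2)[OF hom basis, symmetric])
      finally show ?thesis by (simp add: left_diff_distrib T_diff)
    qed
    from trace_form_nondegenerate[OF this] show ?thesis by simp
  qed
  have 2: "(\<Sum>i<3. \<phi> (T (bas i)) * c i) = 1"
  proof -
    define x where "x = (\<Sum>i<3. \<phi> (T (bas i)) * c i)"
    have xk: "T (x * bas k) = T (1 * bas k)" if k: "k < 3" for k
    proof -
      have "T (x * bas k) = (\<Sum>i<3. T (bas i) * T (c i * bas k))"
        unfolding x_def by (simp only: sum_distrib_right T_sum mult.assoc T_scale)
      also have "\<dots> = (\<Sum>i<3. if k = i then T (bas i) else 0)" by (rule sum.cong) (simp_all add: c k)
      finally show ?thesis using k by simp
    qed
    have "T (x * y) = T (1 * y)" for y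
      unfolding expand[of x y] expand[of 1 y] by (rule sum.cong) (simp_all add: xk)
    then have "T ((x - 1) * y) = 0" for y by (simp add: left_diff_distrib T_diff)
    from trace_form_nondegenerate[OF this] show ?thesis unfolding x_def by simp
  qed
  have 3: "(\<Sum>i<3. \<phi> (T (c i)) * bas i) = 1"
  proof -
    have "(\<Sum>i<3. \<phi> (T (c i)) * bas i) = (\<Sum>i<3. \<phi> (coord \<phi> {..<3} bas 1 i) * bas i)"
      by (rule sum.cong) (simp_all add: cT)
    then show ?thesis by (simp add: coord_sum[OF basis])
  qed
  show thesis by (rule that[OF 1 2 3])
qed

text \<open>
  Sum the hypothesis over pairs of dual basis vectors.  By the identities in \<open>casimir\<close> the left-hand side
  becomes \<open>(3 - 2) y\<close> and the right-hand side \<open>(3 - 2 - 2 + 4) y\<close>.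
\<close>
lemma trace_twist_zero:
  fixes f :: "'b \<Rightarrow> 'b" and y :: 'b
  assumes \<alpha>: "comm_ring_hom \<alpha>" "\<And>a. \<alpha> (\<phi> a) = \<phi> a"
    and mult: "\<And>a b. (\<phi> (T (a * b)) - 2 * \<alpha> (a * b)) * y = (\<phi> (T a) - 2 * \<alpha> a) * ((\<phi> (T b) - 2 * \<alpha> b) * y)"
  shows "y = 0"
proof -
  interpret \<alpha>: comm_ring_hom \<alpha> by fact
  obtain c where c: "(\<Sum>i<3. c i * bas i) = 1" "(\<Sum>i<3. \<phi> (T (bas i)) * c i) = 1"
    "(\<Sum>i<3. \<phi> (T (c i)) * bas i) = 1" by (rule casimir)
  define u v where "u i = \<phi> (T (c i))" and "v i = \<phi> (T (bas i))" for i
  have s1: "(\<Sum>i<3. \<phi> (T (c i * bas i))) = 3"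
  proof -
    have "(\<Sum>i<3. \<phi> (T (c i * bas i))) = \<phi> (T (\<Sum>i<3. c i * bas i))" by (simp add: T_sum hom_sum)
    then show ?thesis unfolding c T_one by (simp add: hom_numeral)
  qed
  have s2: "(\<Sum>i<3. \<alpha> (c i) * \<alpha> (bas i)) = 1" using arg_cong[OF c(1), of \<alpha>] by (simp add: \<alpha>.hom_sum \<alpha>.hom_mult)
  have s3: "(\<Sum>i<3. v i * \<alpha> (c i)) = 1"
    using arg_cong[OF c(2), of \<alpha>] by (simp add: \<alpha>.hom_sum \<alpha>.hom_mult \<alpha>(2) v_def)
  have s4: "(\<Sum>i<3. u i * \<alpha> (bas i)) = 1"
    using arg_cong[OF c(3), of \<alpha>] by (simp add: \<alpha>.hom_sum \<alpha>.hom_mult \<alpha>(2) u_def)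
  have s5: "(\<Sum>i<3. u i * v i) = 3"
  proof -
    have "(\<Sum>i<3. u i * v i) = \<phi> (\<Sum>i<3. T (c i) * T (bas i))" unfolding u_def v_def by (simp add: hom_sum hom_mult)
    also have "(\<Sum>i<3. T (c i) * T (bas i)) = T (\<Sum>i<3. \<phi> (T (c i)) * bas i)" by (simp only: T_sum T_scale)
    finally show ?thesis unfolding c T_one by (simp add: hom_numeral)
  qed
  have "(\<Sum>i<3. (\<phi> (T (c i * bas i)) - 2 * (\<alpha> (c i) * \<alpha> (bas i))) * y)
      = (\<Sum>i<3. (u i * v i - 2 * (v i * \<alpha> (c i)) - 2 * (u i * \<alpha> (bas i)) + 4 * (\<alpha> (c i) * \<alpha> (bas i))) * y)"
  proof (rule sum.cong)
    fix i
    show "(\<phi> (T (c i * bas i)) - 2 * (\<alpha> (c i) * \<alpha> (bas i))) * y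
      = (u i * v i - 2 * (v i * \<alpha> (c i)) - 2 * (u i * \<alpha> (bas i)) + 4 * (\<alpha> (c i) * \<alpha> (bas i))) * y"
      using mult[of "c i" "bas i"] unfolding \<alpha>.hom_mult u_def v_def by (simp add: algebra_simps)
  qed simp
  then have "(3 - 2 * 1) * y = (3 - 2 * 1 - 2 * 1 + 4 * 1) * y"
    unfolding sum_distrib_right[symmetric] sum_subtractf sum.distrib sum_distrib_left[symmetric] s1 s2 s3 s4 s5 .
  then have "2 * y = 0" by simp
  then show "y = 0" by (rule two_cancel)
qed

end

section \<open>Tits processes\<close>

context unitary_algebra
begin

sublocale Lr: regular_cubic_algebra \<phi>L bL
  by unfold_locales (fact three L_regular)+

abbreviation herm where "herm \<equiv> tits_herm \<iota> iL iK"
abbreviation scale where "scale \<equiv> tits_scale \<phi>L iL"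

lemma iL_herm: "iL (herm u b) = b * iL u * \<tau> b"
proof -
  have "\<tau> (b * iL u * \<tau> b) = b * iL u * \<tau> b" by (simp add: \<tau>.hom_mult \<tau>_iL \<tau>_invol mult_ac)
  then obtain a where "b * iL u * \<tau> b = iL a" by (rule \<tau>_fixed)
  then show ?thesis unfolding tits_herm_def \<tau>_def[symmetric] by (simp add: the_inv_iL)
qed

lemma unit_inv_eq: "u * v = 1 \<Longrightarrow> unit_inv u = (v::'z::comm_ring_1)"
  unfolding unit_inv_def by (rule the_equality) (auto, metis mult.assoc mult.commute mult_1)

text \<open>
  The part of the \<open>E\<close>-component of the adjoint that is quadratic in \<open>b\<close>.
\<close>
definition Q where "Q u \<mu> b = iK (\<iota> \<mu>) * EK.adj (\<tau> b) * iL (unit_inv u)"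

lemma T_adj: "L.T (L.adj a) = L.S a"
proof -
  have "L.T (L.adj a) = L.T (a^2) - L.T a ^ 2 + 3 * L.S a"
    unfolding L.adj_def by (simp add: L.T_add L.T_diff L.T_scale L.T_scalar power2_eq_square)
  then show ?thesis using L.two_S[of a] by simp
qed

text \<open>
  The identity \<open>a\<^sup># + T(a) a - T(a\<^sup>#) = a\<^sup>2\<close> in \<open>L\<close> turns the definition of the square into this form.
\<close>
lemma square_eq: "tits_square \<phi>L \<iota> iL iK u \<mu> (a, b) =
  (a * a - herm u b + \<phi>L (L.T (herm u b)), Q u \<mu> b + iL (\<phi>L (L.T a) - a) * b)"
  unfolding tits_square_def tits_sharp_def tits_trace_def tits_scale_def L.alg_adjoint_eq EK.alg_adjoint_eq
    \<tau>_def[symmetric] Q_def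
  by (simp add: L.T_diff T_adj \<phi>L.hom_minus iL.hom_minus algebra_simps)
     (simp add: L.adj_def algebra_simps power2_eq_square)

lemma scale_eq: "scale c (a, b) = (\<phi>L c * a, iL (\<phi>L c) * b)"
  unfolding tits_scale_def by simp

lemma scale_vector_space: "vector_space scale"
  by unfold_locales (auto simp: tits_scale_def algebra_simps \<phi>L.hom_add \<phi>L.hom_mult iL.hom_add iL.hom_mult)

lemma half_L_mult: "\<phi>L (1/2) * (2 * x) = x"
proof -
  have "\<phi>L (1/2) * 2 = 1" using half_L by (metis \<phi>L.hom_mult \<phi>L.hom_numeral \<phi>L.hom_one mult.commute)
  then show ?thesis by (simp add: mult.assoc[symmetric])
qed

text \<open>
  So \<open>L\<close> is a subalgebra with its own product, and it acts on the complement \<open>E\<close> through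
  \<open>(T(a) - a) / 2\<close>.
\<close>
lemma mult_L: "tits_mult \<phi>L \<iota> iL iK u \<mu> (a, 0) (x, b) = (a * x, iL (\<phi>L (1/2) * (\<phi>L (L.T a) - a)) * b)"
proof -
  have h0: "herm u 0 = 0" using iL_herm[of u 0] by (simp add: iL_eq_0)
  have q0: "Q u \<mu> 0 = 0" using EK.adj_scale[of 0 1] unfolding Q_def by simp
  have "tits_square \<phi>L \<iota> iL iK u \<mu> ((a, 0) + (x, b)) - tits_square \<phi>L \<iota> iL iK u \<mu> (a, 0)
      - tits_square \<phi>L \<iota> iL iK u \<mu> (x, b) = (2 * (a * x), iL (\<phi>L (L.T a) - a) * b)"
    by (simp add: square_eq h0 q0 L.T_add \<phi>L.hom_add iL.hom_minus iL.hom_add) (simp add: algebra_simps)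
  then show ?thesis unfolding tits_mult_def by (simp add: scale_eq half_L_mult iL.hom_mult mult.assoc)
qed

lemma mult_self: "tits_mult \<phi>L \<iota> iL iK u \<mu> (a, b) (a, b) = tits_square \<phi>L \<iota> iL iK u \<mu> (a, b)"
proof -
  have h: "herm u (b + b) = 4 * herm u b"
  proof -
    have "iL (herm u (b + b)) = iL (4 * herm u b)"
      unfolding iL.hom_mult iL_herm \<tau>.hom_add iL.hom_numeral by (simp only: distrib_left distrib_right) (simp add: mult.assoc)
    then show ?thesis unfolding iL_inj .
  qed
  have q: "Q u \<mu> (b + b) = 4 * Q u \<mu> b"
  proof -
    have "EK.adj (\<tau> (b + b)) = EK.adj (iK 2 * \<tau> b)" by (simp only: \<tau>.hom_add iK.hom_numeral mult_2)
    also have "\<dots> = 4 * EK.adj (\<tau> b)" unfolding EK.adj_scale by (simp add: iK.hom_numeral)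
    finally show ?thesis unfolding Q_def by (simp add: mult_ac)
  qed
  have half: "iL (\<phi>L (1/2)) * (2 * y) = y" for y
  proof -
    have "iL (\<phi>L (1/2)) * 2 = 1" using half_L
      by (metis \<phi>L.hom_mult \<phi>L.hom_numeral \<phi>L.hom_one iL.hom_mult iL.hom_numeral iL.hom_one mult.commute)
    then show ?thesis by (simp add: mult.assoc[symmetric])
  qed
  obtain A B where sq: "tits_square \<phi>L \<iota> iL iK u \<mu> (a, b) = (A, B)" by fastforce
  then have A: "A = a * a - herm u b + \<phi>L (L.T (herm u b))" and B: "B = Q u \<mu> b + iL (\<phi>L (L.T a) - a) * b"
    unfolding square_eq by simp_all
  have T4: "L.T (4 * x) = 4 * L.T x" for x using L.T_scale[of 4 x] by (simp add: \<phi>L.hom_numeral)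
  have "(a + a) * (a + a) - 4 * herm u b + \<phi>L (L.T (4 * herm u b)) = 4 * A"
    unfolding A T4 \<phi>L.hom_mult \<phi>L.hom_numeral by (simp add: algebra_simps)
  moreover have "4 * Q u \<mu> b + iL (\<phi>L (L.T (a + a)) - (a + a)) * (b + b) = 4 * B"
  proof -
    have "\<phi>L (L.T (a + a)) - (a + a) = 2 * (\<phi>L (L.T a) - a)"
      unfolding L.T_add \<phi>L.hom_add by (simp add: algebra_simps)
    then have e: "iL (\<phi>L (L.T (a + a)) - (a + a)) = 2 * iL (\<phi>L (L.T a) - a)"
      by (simp only: iL.hom_mult iL.hom_numeral)
    show ?thesis unfolding B e by (simp add: algebra_simps)
  qed
  ultimately have "tits_square \<phi>L \<iota> iL iK u \<mu> (a + a, b + b) = (4 * A, 4 * B)"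
    unfolding square_eq h q by simp
  then have "tits_mult \<phi>L \<iota> iL iK u \<mu> (a, b) (a, b) = scale (1/2) (2 * A, 2 * B)"
    unfolding tits_mult_def by (simp add: sq)
  then show ?thesis unfolding scale_eq half_L_mult half sq .
qed

text \<open>
  The isomorphism is \<open>(a, b) \<mapsto> (a, b w)\<close>.  It respects the adjoints because \<open>w\<^sup># = N(w) w\<inverse>\<close>.
\<close>
lemma isomorphic_of_norms:
  assumes w: "w * \<tau> w = iL u" "alg_norm iK w = \<mu>" and u: "u * v = 1"
  shows "tits_L_isomorphic \<phi>L \<iota> iL iK (u, \<mu>) (1, 1)"
proof -
  define w' where "w' = \<tau> w * iL v"
  have ww': "w * w' = 1" unfolding w'_def using w(1) u by (metis iL.hom_mult iL.hom_one mult.assoc)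
  define h where "h = (\<lambda>(a, b). (a::'l, b * w))"
  have h_add: "h (x + y) = h x + h y" for x y unfolding h_def by (cases x; cases y) (simp add: distrib_right)
  have h_diff: "h (x - y) = h x - h y" for x y using h_add[of "x - y" y] by simp
  have h_scale: "h (scale c x) = scale c (h x)" for c x unfolding h_def by (cases x) (simp add: scale_eq mult.assoc)
  have lin: "Vector_Spaces.linear scale scale h"
    unfolding Vector_Spaces.linear_iff using scale_vector_space h_add h_scale by blast
  have bij: "bij h"
  proof (rule bijI)
    show "inj h"
    proof (rule injI)
      fix x y assume "h x = h y"
      then have "fst x = fst y" "snd x * w = snd y * w" unfolding h_def by (auto split: prod.splits)
      then show "x = y" using ww' by (metis mult.assoc mult.right_neutral prod.expand)
    qed
    have "y = h (fst y, snd y * w')" for y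
      unfolding h_def using ww' by (cases y) (simp add: mult.assoc mult.commute[of w'])
    then show "surj h" unfolding surj_def by blast
  qed
  have herm: "herm 1 (b * w) = herm u b" for b
  proof -
    have "iL (herm 1 (b * w)) = b * (w * \<tau> w) * \<tau> b" unfolding iL_herm by (simp add: \<tau>.hom_mult mult_ac)
    then have "iL (herm 1 (b * w)) = iL (herm u b)" unfolding w iL_herm .
    then show ?thesis unfolding iL_inj .
  qed
  have \<tau>w: "\<tau> w * \<tau> w' = 1" using ww' by (metis \<tau>.hom_mult \<tau>.hom_one)
  have adj_w: "EK.adj (\<tau> w) = iK (\<iota> \<mu>) * iL v * w"
  proof -
    have "\<tau> w * EK.adj (\<tau> w) = iK (\<iota> \<mu>)" unfolding EK.adj_mult_self NE_\<tau> w ..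
    then have "(w * \<tau> w * iL v) * EK.adj (\<tau> w) = iK (\<iota> \<mu>) * iL v * w" by (metis mult.assoc mult.commute)
    moreover have "w * \<tau> w * iL v = 1" unfolding w iL.hom_mult[symmetric] u by simp
    ultimately show ?thesis by simp
  qed
  have Q: "Q 1 1 (b * w) = Q u \<mu> b * w" for b
  proof -
    have "Q 1 1 (b * w) = EK.adj (\<tau> w * \<tau> b)"
      unfolding Q_def using unit_inv_eq[of "1::'l" 1] by (simp add: \<tau>.hom_mult mult.commute)
    also have "\<dots> = EK.adj (\<tau> w) * EK.adj (\<tau> b)" by (rule EK.adj_mult_unit[OF \<tau>w])
    finally show ?thesis unfolding adj_w Q_def unit_inv_eq[OF u] by (simp add: mult_ac)
  qed
  have sq: "h (tits_square \<phi>L \<iota> iL iK u \<mu> x) = tits_square \<phi>L \<iota> iL iK 1 1 (h x)" for x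
    unfolding h_def by (cases x) (simp add: square_eq herm Q distrib_right mult.assoc)
  have mult: "h (tits_mult \<phi>L \<iota> iL iK u \<mu> x y) = tits_mult \<phi>L \<iota> iL iK 1 1 (h x) (h y)" for x y
    unfolding tits_mult_def h_scale h_diff sq h_add ..
  have "h ` (UNIV \<times> {0}) = UNIV \<times> {0}" unfolding h_def by (auto simp: image_def)
  then show ?thesis unfolding tits_L_isomorphic_def using lin bij mult by auto
qed

lemma free_basis_automorphism:
  assumes \<alpha>: "comm_ring_hom \<alpha>" "bij \<alpha>" "\<And>c. \<alpha> (\<phi>L c) = \<phi>L c"
  shows "free_basis \<phi>L {..<3} (\<lambda>i. \<alpha> (bL i))"
proof -
  interpret \<alpha>: comm_ring_hom \<alpha> by fact
  have e: "(\<Sum>i<3. \<phi>L (c i) * \<alpha> (bL i)) = \<alpha> (\<Sum>i<3. \<phi>L (c i) * bL i)" for c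
    by (simp add: \<alpha>.hom_sum \<alpha>.hom_mult \<alpha>(3))
  show ?thesis unfolding free_basis_def e
  proof (intro conjI allI impI ballI)
    fix x
    obtain y where "x = \<alpha> y" using \<alpha>(2) unfolding bij_def surj_def by blast
    moreover obtain c where "y = (\<Sum>i<3. \<phi>L (c i) * bL i)" using free_basisD(2)[OF L_basis] by blast
    ultimately show "\<exists>c. x = \<alpha> (\<Sum>i<3. \<phi>L (c i) * bL i)" by blast
  next
    fix c i assume "\<alpha> (\<Sum>i<3. \<phi>L (c i) * bL i) = 0" "i \<in> {..<3::nat}"
    moreover from this have "(\<Sum>i<3. \<phi>L (c i) * bL i) = 0"
      using \<alpha>(2) by (metis \<alpha>.hom_zero bij_is_inj injD)
    ultimately show "c i = 0" using free_basisD(3)[OF L_basis] by blast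
  qed simp
qed

text \<open>
  Put \<open>w = \<psi> 1\<close>.  Since \<open>\<psi>\<close> is an isometry, \<open>\<psi> \<omega> = w * \<rho>\<close> with \<open>\<tau> \<rho> = - \<rho>\<close> and \<open>\<rho> * \<tau> \<rho> = - d\<close>, i.e.
  \<open>\<rho> = q \<omega>\<close> with \<open>q\<^sup>2 = 1\<close>.  For \<open>\<mu> = m + n \<theta>\<close> and \<open>N w = m' + n' \<theta>\<close> the compatibility with adjoints at
  \<open>1\<close> says \<open>m' = m\<close> and \<open>n' = n q\<close>.  Squaring, \<open>n'\<^sup>2 = n\<^sup>2\<close> in the field \<open>k\<close>, so \<open>N w\<close> is \<open>\<mu>\<close> or
  \<open>\<iota> \<mu>\<close>; in the second case \<open>\<tau> w\<close> has norm \<open>\<mu>\<close>.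
\<close>
lemma norms_of_semilinear_map:
  assumes u: "u * v = 1" and \<psi>_add: "\<And>x y. \<psi> (x + y) = \<psi> x + \<psi> y"
    and \<psi>_lin: "\<And>a x. \<psi> (iL a * x) = iL a * \<psi> x"
    and \<psi>_herm: "\<And>x. \<psi> x * \<tau> (\<psi> x) = x * iL u * \<tau> x"
    and \<psi>_adj: "\<psi> (Q u \<mu> 1) = EK.adj (\<tau> (\<psi> 1))"
  obtains w where "w * \<tau> w = iL u" "alg_norm iK w = \<mu>"
proof -
  define w where "w = \<psi> 1"
  have ww: "w * \<tau> w = iL u" using \<psi>_herm[of 1] unfolding w_def by simp
  have wwv: "w * \<tau> w * iL v = 1" unfolding ww iL.hom_mult[symmetric] u by simp
  have \<tau>\<omega>: "\<tau> \<omega> = - \<omega>" using \<tau>_decomp[of 0 1] by simp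
  have \<psi>\<omega>: "\<psi> \<omega> * \<tau> (\<psi> \<omega>) = - (iL (\<phi>L d) * iL u)"
    unfolding \<psi>_herm \<tau>\<omega> \<omega>_square[symmetric] by (simp add: mult_ac)
  have cross: "w * \<tau> (\<psi> \<omega>) + \<psi> \<omega> * \<tau> w = 0"
  proof -
    have "w * \<tau> (\<psi> \<omega>) + \<psi> \<omega> * \<tau> w = \<psi> (1 + \<omega>) * \<tau> (\<psi> (1 + \<omega>)) - w * \<tau> w - \<psi> \<omega> * \<tau> (\<psi> \<omega>)"
      unfolding \<psi>_add w_def[symmetric] \<tau>.hom_add by (simp add: algebra_simps)
    also have "\<dots> = (1 + \<omega>) * iL u * (1 - \<omega>) - iL u - \<omega> * iL u * (- \<omega>)"
      unfolding \<psi>_herm ww \<tau>.hom_add \<tau>\<omega> by simp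
    also have "\<dots> = 0" by (simp add: algebra_simps)
    finally show ?thesis .
  qed
  define \<rho> where "\<rho> = \<psi> \<omega> * \<tau> w * iL v"
  have \<psi>\<omega>_eq: "\<psi> \<omega> = w * \<rho>"
  proof -
    have "w * \<rho> = \<psi> \<omega> * (w * \<tau> w * iL v)" unfolding \<rho>_def by (simp add: mult_ac)
    then show ?thesis unfolding wwv by simp
  qed
  have \<tau>\<rho>: "\<tau> \<rho> = - \<rho>"
  proof -
    have "\<tau> \<rho> + \<rho> = (w * \<tau> (\<psi> \<omega>) + \<psi> \<omega> * \<tau> w) * iL v"
      unfolding \<rho>_def by (simp add: \<tau>.hom_mult \<tau>_iL \<tau>_invol algebra_simps)
    then show ?thesis unfolding cross by (simp add: eq_neg_iff_add_eq_0)
  qed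
  obtain p q where pq: "\<rho> = iL p + iL q * \<omega>" by (rule E_decomp)
  have "iL (2 * p) + iL 0 * \<omega> = \<tau> \<rho> + \<rho>"
    unfolding pq \<tau>_decomp by (simp add: iL.hom_mult iL.hom_numeral)
  then have "iL (2 * p) + iL 0 * \<omega> = 0" unfolding \<tau>\<rho> by simp
  then have "p = 0" using E_decomp_0 two_cancel_L by blast
  then have \<rho>: "\<rho> = iL q * \<omega>" using pq by simp
  have qq: "q * q = 1"
  proof -
    have "\<rho> * \<tau> \<rho> = (\<psi> \<omega> * \<tau> (\<psi> \<omega>)) * (w * \<tau> w * iL v) * iL v"
      unfolding \<rho>_def by (simp add: \<tau>.hom_mult \<tau>_iL \<tau>_invol mult_ac)
    also have "\<dots> = - (iL (\<phi>L d) * iL (u * v))" unfolding wwv \<psi>\<omega> by (simp add: iL.hom_mult mult.assoc)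
    finally have "\<rho> * \<tau> \<rho> = - iL (\<phi>L d)" unfolding u by simp
    moreover have "\<rho> * \<tau> \<rho> = - (iL q * iL q * (\<omega> * \<omega>))" unfolding \<tau>\<rho> unfolding \<rho> by (simp add: mult_ac)
    ultimately have "iL (q * q * \<phi>L d) = iL (\<phi>L d)" unfolding \<omega>_square by (simp add: iL.hom_mult)
    then have e: "q * q * \<phi>L d = \<phi>L d" unfolding iL_inj .
    have "\<phi>L d * \<phi>L (inverse d) = 1" using d_nonzero by (metis \<phi>L.hom_mult \<phi>L.hom_one right_inverse)
    then show ?thesis using e by (metis mult.assoc mult.right_neutral)
  qed
  obtain m n where \<mu>: "\<mu> = \<phi>K m + \<phi>K n * \<theta>" by (rule K_decomp)
  define \<nu> where "\<nu> = alg_norm iK w"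
  obtain m' n' where \<nu>: "\<nu> = \<phi>K m' + \<phi>K n' * \<theta>" by (rule K_decomp)
  have iK\<iota>: "iK (\<iota> (\<phi>K m + \<phi>K n * \<theta>)) = iL (\<phi>L m) - iL (\<phi>L n) * \<omega>" for m n
    unfolding \<iota>_decomp \<omega>_def by (simp add: iK.hom_minus iK.hom_mult iLK)
  have "iK (\<iota> \<nu>) = \<tau> w * EK.adj (\<tau> w)" unfolding EK.adj_mult_self NE_\<tau> \<nu>_def ..
  also have "EK.adj (\<tau> w) = \<psi> (Q u \<mu> 1)" unfolding \<psi>_adj w_def ..
  also have "Q u \<mu> 1 = iL (v * \<phi>L m) * 1 + iL (- (v * \<phi>L n)) * \<omega>"
    unfolding Q_def \<mu> iK\<iota> unit_inv_eq[OF u] by (simp add: EK.adj_one iL.hom_mult iL.hom_uminus algebra_simps)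
  also have "\<psi> \<dots> = iL (v * \<phi>L m) * w + iL (- (v * \<phi>L n)) * (w * (iL q * \<omega>))"
    unfolding \<psi>_add \<psi>_lin w_def[symmetric] \<psi>\<omega>_eq \<rho> ..
  also have "\<tau> w * \<dots> = (w * \<tau> w * iL v) * (iL (\<phi>L m) + iL (- (\<phi>L n * q)) * \<omega>)"
    by (simp add: iL.hom_mult iL.hom_uminus algebra_simps)
  finally have "iL (\<phi>L m') + iL (- \<phi>L n') * \<omega> = iL (\<phi>L m) + iL (- (\<phi>L n * q)) * \<omega>"
    unfolding wwv \<nu> iK\<iota> by (simp add: iL.hom_uminus)
  from E_decomp_unique[OF this] have "\<phi>L m' = \<phi>L m" and n'q: "\<phi>L n' = \<phi>L n * q" by simp_all
  then have m': "m' = m" using \<phi>L_eq_0[of "m' - m"] by (simp add: \<phi>L.hom_minus)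
  have "\<phi>L (n' * n') = \<phi>L n * \<phi>L n * (q * q)" unfolding \<phi>L.hom_mult n'q by (simp add: mult_ac)
  then have "\<phi>L (n' * n' - n * n) = 0" unfolding qq by (simp add: \<phi>L.hom_minus \<phi>L.hom_mult)
  then have "n' * n' = n * n" unfolding \<phi>L_eq_0 by simp
  then have "n' = n \<or> n' = - n" by (simp add: square_eq_iff)
  then show thesis
  proof
    assume "n' = n"
    then have "alg_norm iK w = \<mu>" using \<mu> \<nu> m' unfolding \<nu>_def by simp
    then show thesis using that ww by blast
  next
    assume "n' = - n"
    then have "\<nu> = \<iota> \<mu>" unfolding \<mu> \<iota>_decomp \<nu> m' by (simp add: \<phi>K.hom_uminus)
    then have "alg_norm iK (\<tau> w) = \<mu>" unfolding NE_\<tau> \<nu>_def[symmetric] by (simp add: \<iota>_invol)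
    moreover have "\<tau> w * \<tau> (\<tau> w) = iL u" using ww by (simp add: \<tau>_invol mult.commute)
    ultimately show thesis using that by blast
  qed
qed

text \<open>
  \<open>h\<close> induces an automorphism \<open>\<alpha>\<close> of \<open>L\<close>, which preserves the trace.  Comparing the actions of \<open>L\<close> shows
  that \<open>h\<close> maps the complement \<open>E\<close> of \<open>L\<close> to itself (\<open>trace_twist_zero\<close>), so it is given there by an
  \<open>\<alpha>\<close>-semilinear map \<open>g\<close>.  Comparing squares shows that \<open>g\<close> respects the hermitian forms and the
  adjoints.  The inverse of \<open>\<alpha>\<close>, extended to \<open>E\<close>, makes \<open>g\<close> linear.
\<close>
lemma norms_of_isomorphic:
  assumes iso: "tits_L_isomorphic \<phi>L \<iota> iL iK (u, \<mu>) (1, 1)" and u: "u * v = 1"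
  obtains w where "w * \<tau> w = iL u" "alg_norm iK w = \<mu>"
proof -
  obtain h where lin: "Vector_Spaces.linear scale scale h" and bij: "bij h"
    and h_mult: "\<And>x y. h (tits_mult \<phi>L \<iota> iL iK u \<mu> x y) = tits_mult \<phi>L \<iota> iL iK 1 1 (h x) (h y)"
    and h_L: "h ` (UNIV \<times> {0}) = UNIV \<times> {0}"
    using iso unfolding tits_L_isomorphic_def by auto
  have h_add: "h (x + y) = h x + h y" and h_scale: "h (scale c x) = scale c (h x)" for x y c
    using lin unfolding Vector_Spaces.linear_iff by blast+
  define \<alpha> where "\<alpha> a = fst (h (a, 0))" for a
  define f where "f b = fst (h (0, b))" for b
  define g where "g b = snd (h (0, b))" for b
  have h_a: "h (a, 0) = (\<alpha> a, 0)" for a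
  proof -
    have "h (a, 0) \<in> UNIV \<times> {0}" using h_L by blast
    then show ?thesis unfolding \<alpha>_def by (metis mem_Sigma_iff prod.collapse singletonD)
  qed
  have h_b: "h (0, b) = (f b, g b)" for b unfolding f_def g_def by simp
  have \<alpha>_add: "\<alpha> (a + a') = \<alpha> a + \<alpha> a'" for a a'
    using h_add[of "(a, 0)" "(a', 0)"] by (simp add: h_a)
  have f_add: "f (b + b') = f b + f b'" and g_add: "g (b + b') = g b + g b'" for b b'
    using h_add[of "(0, b)" "(0, b')"] by (simp_all add: h_b)
  have \<alpha>_scale: "\<alpha> (\<phi>L c * a) = \<phi>L c * \<alpha> a" for c a
    using h_scale[of c "(a, 0)"] by (simp add: h_a scale_eq)
  have f_scale: "f (iL (\<phi>L c) * b) = \<phi>L c * f b" and g_scale: "g (iL (\<phi>L c) * b) = iL (\<phi>L c) * g b" for c b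
    using h_scale[of c "(0, b)"] by (simp_all add: h_b scale_eq)
  have \<alpha>_mult: "\<alpha> (a * a') = \<alpha> a * \<alpha> a'" for a a'
    using h_mult[of "(a, 0)" "(a', 0)"] by (simp add: h_a mult_L)
  have bij_\<alpha>: "bij \<alpha>"
  proof (rule bijI)
    show "inj \<alpha>"
    proof (rule injI)
      fix a a' assume "\<alpha> a = \<alpha> a'"
      then have "h (a, 0) = h (a', 0)" by (simp add: h_a)
      then show "a = a'" using bij by (simp add: bij_is_inj inj_eq)
    qed
    have "\<exists>a. y = \<alpha> a" for y
    proof -
      have "(y, 0) \<in> h ` (UNIV \<times> {0})" unfolding h_L by simp
      then show ?thesis by (auto simp: h_a)
    qed
    then show "surj \<alpha>" unfolding surj_def by blast
  qed
  have \<alpha>_one: "\<alpha> 1 = 1"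
  proof -
    obtain a where "\<alpha> a = 1" using bij_\<alpha> by (metis bij_is_surj surjD)
    then show ?thesis using \<alpha>_mult[of a 1] by simp
  qed
  have \<alpha>_hom: "comm_ring_hom \<alpha>" by (rule comm_ring_homI) (fact \<alpha>_one \<alpha>_add \<alpha>_mult)+
  interpret \<alpha>: comm_ring_hom \<alpha> by fact
  have \<alpha>_const: "\<alpha> (\<phi>L c) = \<phi>L c" for c using \<alpha>_scale[of c 1] \<alpha>_one by simp
  have \<alpha>_T: "L.T (\<alpha> a) = L.T a" for a
    using alg_norm_trace_hom(2)[OF L_hom L_hom \<alpha>_hom comm_ring_hom_id _ L_basis
      free_basis_automorphism[OF \<alpha>_hom bij_\<alpha> \<alpha>_const], of a] \<alpha>_const by simp
  have act: "f (iL a * b) = (\<phi>L (L.T a) - 2 * \<alpha> a) * f b" "g (iL a * b) = iL (\<alpha> a) * g b" for a b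
  proof -
    define X where "X = iL (\<phi>L (1/2)) * (iL (\<phi>L (L.T a)) * b + iL (\<phi>L (- 1)) * (iL a * b))"
    have "tits_mult \<phi>L \<iota> iL iK u \<mu> (a, 0) (0, b) = (0, X)"
      unfolding mult_L X_def by (simp add: iL.hom_mult iL.hom_minus iL.hom_uminus \<phi>L.hom_uminus algebra_simps)
    then have "(f X, g X) = h (tits_mult \<phi>L \<iota> iL iK u \<mu> (a, 0) (0, b))" unfolding h_b[symmetric] by (rule arg_cong[OF sym])
    also have "\<dots> = tits_mult \<phi>L \<iota> iL iK 1 1 (h (a, 0)) (h (0, b))" by (rule h_mult)
    also have "\<dots> = (\<alpha> a * f b, iL (\<phi>L (1/2) * (\<phi>L (L.T a) - \<alpha> a)) * g b)"
      unfolding h_a h_b mult_L \<alpha>_T ..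
    finally have *: "(f X, g X) = \<dots>" .
    have X: "f X = \<alpha> a * f b" "g X = iL (\<phi>L (1/2) * (\<phi>L (L.T a) - \<alpha> a)) * g b" using * by simp_all
    have 1: "\<phi>L (1/2) * (\<phi>L (L.T a) * f b - f (iL a * b)) = \<alpha> a * f b"
      using X(1) unfolding X_def f_scale f_add by (simp add: \<phi>L.hom_uminus)
    have "2 * (\<phi>L (1/2) * x) = x" for x using half_L_mult[of x] by (simp add: mult.left_commute)
    from this[of "\<phi>L (L.T a) * f b - f (iL a * b)"]
    have "\<phi>L (L.T a) * f b - f (iL a * b) = 2 * (\<alpha> a * f b)" unfolding 1 by simp
    then show "f (iL a * b) = (\<phi>L (L.T a) - 2 * \<alpha> a) * f b" by (simp add: algebra_simps)
    have 2: "iL (\<phi>L (1/2)) * (iL (\<phi>L (L.T a)) * g b - g (iL a * b)) = iL (\<phi>L (1/2)) * (iL (\<phi>L (L.T a)) * g b - iL (\<alpha> a) * g b)"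
      using X(2) unfolding X_def g_scale g_add by (simp add: \<phi>L.hom_uminus iL.hom_uminus iL.hom_mult iL.hom_minus algebra_simps)
    have "iL (\<phi>L 2) * iL (\<phi>L (1/2)) = 1" using half_L by (metis \<phi>L.hom_mult \<phi>L.hom_one iL.hom_mult iL.hom_one)
    then have "iL (\<phi>L (L.T a)) * g b - g (iL a * b) = iL (\<phi>L (L.T a)) * g b - iL (\<alpha> a) * g b"
      using arg_cong[OF 2, of "\<lambda>x. iL (\<phi>L 2) * x"] by (simp add: mult.assoc[symmetric])
    then show "g (iL a * b) = iL (\<alpha> a) * g b" by simp
  qed
  have f0: "f b = 0" for b
  proof (rule Lr.trace_twist_zero[OF \<alpha>_hom \<alpha>_const])
    fix a a'
    have "f (iL (a * a') * b) = f (iL a * (iL a' * b))" by (simp add: iL.hom_mult mult.assoc)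
    then show "(\<phi>L (L.T (a * a')) - 2 * \<alpha> (a * a')) * f b = (\<phi>L (L.T a) - 2 * \<alpha> a) * ((\<phi>L (L.T a') - 2 * \<alpha> a') * f b)"
      unfolding act .
  qed
  have h_ab: "h (a, b) = (\<alpha> a, g b)" for a b using h_add[of "(a, 0)" "(0, b)"] by (simp add: h_a h_b f0)
  have sq: "\<alpha> (- herm u b + \<phi>L (L.T (herm u b))) = - herm 1 (g b) + \<phi>L (L.T (herm 1 (g b)))"
    and g_Q: "g (Q u \<mu> b) = EK.adj (\<tau> (g b))" for b
  proof -
    have "h (tits_square \<phi>L \<iota> iL iK u \<mu> (0, b)) = tits_square \<phi>L \<iota> iL iK 1 1 (0, g b)"
      using h_mult[of "(0, b)" "(0, b)"] unfolding h_ab mult_self by simp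
    then have *: "(\<alpha> (- herm u b + \<phi>L (L.T (herm u b))), g (Q u \<mu> b))
      = (- herm 1 (g b) + \<phi>L (L.T (herm 1 (g b))), Q 1 1 (g b))"
      unfolding square_eq h_ab by simp
    then show "\<alpha> (- herm u b + \<phi>L (L.T (herm u b))) = - herm 1 (g b) + \<phi>L (L.T (herm 1 (g b)))" by simp
    show "g (Q u \<mu> b) = EK.adj (\<tau> (g b))"
      using * unfolding Q_def[of 1] using unit_inv_eq[of "1::'l" 1] by simp
  qed
  have g_herm: "\<alpha> (herm u b) = herm 1 (g b)" for b
  proof -
    \<comment> \<open>The difference \<open>D\<close> of the two forms is the scalar \<open>T D\<close>, and then \<open>T D = 3 T D\<close>.\<close>
    define D where "D = \<alpha> (herm u b) - herm 1 (g b)"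
    have "- \<alpha> (herm u b) + \<phi>L (L.T (herm u b)) = - herm 1 (g b) + \<phi>L (L.T (herm 1 (g b)))"
      using sq[of b] by (simp only: \<alpha>.hom_add \<alpha>.hom_uminus \<alpha>_const)
    then have "D = \<phi>L (L.T D)" unfolding D_def L.T_diff \<alpha>_T \<phi>L.hom_minus by (simp add: algebra_simps)
    then have e: "3 * L.T D = L.T D" using L.T_scalar[of "L.T D"] by simp
    have "2 * L.T D = 3 * L.T D - L.T D" by simp
    then have "2 * L.T D = 0" unfolding e by simp
    then have "L.T D = 0" using two by simp
    then have "D = 0" using \<open>D = \<phi>L (L.T D)\<close> by simp
    then show ?thesis unfolding D_def by simp
  qed
  define \<beta> where "\<beta> = inv_into UNIV \<alpha>"
  have \<beta>\<alpha>: "\<beta> (\<alpha> a) = a" for a unfolding \<beta>_def using bij_\<alpha> by (simp add: bij_is_inj)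
  have \<beta>_hom: "comm_ring_hom \<beta>" unfolding \<beta>_def by (rule comm_ring_hom_inv[OF \<alpha>_hom bij_\<alpha>])
  have bij_\<beta>: "bij \<beta>" unfolding \<beta>_def by (rule bij_imp_bij_inv[OF bij_\<alpha>])
  have \<beta>_const: "\<beta> (\<phi>L c) = \<phi>L c" for c using \<beta>\<alpha>[of "\<phi>L c"] by (simp add: \<alpha>_const)
  define \<beta>E where "\<beta>E = tensor_map iL iK iL iK \<beta> id"
  have *: "iL (\<beta> (\<phi>L c)) = iK (id (\<phi>K c))" for c by (simp add: \<beta>_const iLK)
  note tm = tensor_map[where f = \<beta> and g = id, OF tp \<beta>_hom comm_ring_hom_id iL.comm_ring_hom_axioms iK.comm_ring_hom_axioms *]
  have \<beta>E: "comm_ring_hom \<beta>E" "\<beta>E (iL a) = iL (\<beta> a)" "\<beta>E (iK c) = iK c" for a c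
    unfolding \<beta>E_def using tm(1) tm(3)[of a] tm(4)[of c] by simp_all
  interpret \<beta>E: comm_ring_hom \<beta>E by (rule \<beta>E(1))
  have \<beta>E_\<tau>: "\<beta>E (\<tau> x) = \<tau> (\<beta>E x)" for x
  proof -
    obtain a b where x: "x = iL a + iL b * \<omega>" by (rule E_decomp)
    have "\<beta>E (iL a' + iL b' * \<omega>) = iL (\<beta> a') + iL (\<beta> b') * \<omega>" for a' b'
      unfolding \<omega>_def by (simp add: \<beta>E.hom_add \<beta>E.hom_mult \<beta>E(2,3))
    moreover have "\<beta>E (iL a - iL b * \<omega>) = iL (\<beta> a) - iL (\<beta> b) * \<omega>"
      unfolding \<omega>_def by (simp add: \<beta>E.hom_minus \<beta>E.hom_mult \<beta>E(2,3))
    ultimately show ?thesis unfolding x by (simp add: \<tau>_decomp)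
  qed
  have "free_basis iK {..<3} (\<lambda>i. \<beta>E (iL (bL i)))"
    unfolding \<beta>E(2) by (rule tensor_basis_left[OF tp L_hom K_hom free_basis_automorphism[OF \<beta>_hom bij_\<beta> \<beta>_const]])
  then have \<beta>E_adj: "EK.adj (\<beta>E x) = \<beta>E (EK.adj x)" for x
    using cubic_adj_hom[OF EK.cubic_algebra_axioms EK.cubic_algebra_axioms \<beta>E(1) comm_ring_hom_id] \<beta>E(3) by simp
  show thesis
  proof (rule norms_of_semilinear_map[OF u, of "\<lambda>b. \<beta>E (g b)"])
    show "\<beta>E (g (x + y)) = \<beta>E (g x) + \<beta>E (g y)" for x y by (simp add: g_add \<beta>E.hom_add)
    show "\<beta>E (g (iL a * x)) = iL a * \<beta>E (g x)" for a x by (simp add: act \<beta>E.hom_mult \<beta>E(2) \<beta>\<alpha>)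
    show "\<beta>E (g x) * \<tau> (\<beta>E (g x)) = x * iL u * \<tau> x" for x
    proof -
      have "\<beta>E (g x) * \<tau> (\<beta>E (g x)) = \<beta>E (iL (herm 1 (g x)))"
        unfolding iL_herm by (simp add: \<beta>E.hom_mult \<beta>E_\<tau>)
      then show ?thesis unfolding g_herm[symmetric] \<beta>E(2) \<beta>\<alpha> iL_herm .
    qed
    show "\<beta>E (g (Q u \<mu> 1)) = EK.adj (\<tau> (\<beta>E (g 1)))" unfolding g_Q \<beta>E_\<tau>[symmetric] \<beta>E_adj ..
  qed (fact that)
qed

theorem isomorphic_iff_norms:
  assumes "admissible \<phi>L \<phi>K \<iota> u \<mu>"
  shows "tits_L_isomorphic \<phi>L \<iota> iL iK (u, \<mu>) (1, 1) \<longleftrightarrow> (\<exists>w. w * \<tau> w = iL u \<and> alg_norm iK w = \<mu>)"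
proof -
  obtain v where "u * v = 1" using assms unfolding admissible_def by (metis dvdE)
  then show ?thesis using isomorphic_of_norms norms_of_isomorphic by metis
qed

end

section \<open>The equivalence\<close>

theorem theorem5p6:
  fixes \<phi>L :: "'k::field \<Rightarrow> 'l::comm_ring_1"
    and \<phi>K :: "'k \<Rightarrow> 'c::comm_ring_1"
    and \<iota> :: "'c \<Rightarrow> 'c"
    and iL :: "'l \<Rightarrow> 'e::comm_ring_1" and iK :: "'c \<Rightarrow> 'e"
    and \<phi>S :: "'k \<Rightarrow> 's::field"
    and jK :: "'c \<Rightarrow> 'd::comm_ring_1" and jS :: "'s \<Rightarrow> 'd"
    and iE :: "'e \<Rightarrow> 'f::comm_ring_1" and iS :: "'s \<Rightarrow> 'f"
  assumes "CHAR('k) \<noteq> 2" and "CHAR('k) \<noteq> 3"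
    and "etale \<phi>L" and "vector_space.dim (alg_scale \<phi>L) UNIV = 3"
    and "etale \<phi>K" and "vector_space.dim (alg_scale \<phi>K) UNIV = 2"
    and "nontrivial_automorphism \<phi>K \<iota>"
    and "tensor_product \<phi>L \<phi>K iL iK"
    and "separable_closure \<phi>S"
    and "tensor_product \<phi>K \<phi>S jK jS"
    and "tensor_product (iL \<circ> \<phi>L) \<phi>S iE iS"
  shows "trivial_group (galois_H1 \<phi>S
            (SU_points iK (unitary_inv \<iota> iL iK) jK jS iE iS)
            (\<lambda>\<sigma>. tensor_map iE iS iE iS id \<sigma>))
         \<longleftrightarrow> (\<forall>u \<mu>. admissible \<phi>L \<phi>K \<iota> u \<mu> \<longrightarrow>
               tits_L_isomorphic \<phi>L \<iota> iL iK (u, \<mu>) (1, 1))"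
proof -
  have prime_char: "of_nat p \<noteq> (0::'k)" if "prime p" "CHAR('k) \<noteq> p" for p :: nat
    using that CHAR_not_1[where 'a = 'k] unfolding of_nat_eq_0_iff_char_dvd
    by (metis One_nat_def prime_nat_iff)
  have two: "(2::'k) \<noteq> 0" using prime_char[of 2] assms(1) by simp
  have three: "(3::'k) \<noteq> 0" using prime_char[of 3] assms(2) by simp
  obtain \<theta> d where K: "free_basis \<phi>K {..<2::nat} (\<lambda>i. if i = 0 then 1 else \<theta>)"
    "\<theta> * \<theta> = \<phi>K d" "d \<noteq> 0" "\<iota> \<theta> = - \<theta>"
    by (rule quadratic_etale_generator[OF assms(5,6) two assms(7)])
  obtain bL where L: "free_basis \<phi>L {..<3::nat} bL"
    by (rule free_basis_of_dim[OF etale_hom[OF assms(3)] assms(4)]) simp_all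
  have \<iota>: "comm_ring_hom \<iota>" "\<And>c. \<iota> (\<phi>K c) = \<phi>K c" using assms(7) unfolding nontrivial_automorphism_def by auto
  have regular: "\<And>x::'l. \<exists>y. x * x * y = x" using etale_regular[OF assms(3)] by metis
  interpret unitary_torus \<phi>L \<phi>K \<iota> iL iK bL \<theta> d \<phi>S jK jS iE iS
    by (intro unitary_torus.intro unitary_torus_axioms.intro assms unitary_algebra.intro[OF two three
          etale_hom[OF assms(3)] L regular etale_hom[OF assms(5)] K(1,2,3) \<iota> K(4) assms(8)])
  show ?thesis
    using H1_trivial_iff_norms isomorphic_iff_norms unfolding M_def F.act_def[abs_def] \<tau>_def by metis
qed

end
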